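(* Let $p$ be a prime number, let $R$ be a $p$-adically complete Noetherian integral domain of finite Krull dimension whose field of fractions has characteristic zero, and let $G$ be a finite group. Then the natural map $\mathrm{K}_1(R[G])\to \widehat{\mathrm{K}}_1(R[G])$ is an isomorphism.
   Context: $R$ is $p$-adically complete means that the natural map $R\to\varprojlim_n R/p^nR$ is an isomorphism. For a unital ring $S$, $\mathrm{K}_1(S)=\mathrm{GL}(S)/\mathrm{E}(S)$, where $\mathrm{GL}(S)=\varinjlim_n \mathrm{GL}_n(S)$ and $\mathrm{E}(S)$ is the subgroup generated by elementary matrices. The completed K-group is $\widehat{\mathrm{K}}_1(R[G])=\varprojlim_n \mathrm{K}_1(R[G]/(p^n))$, and the natural map is induced by the reductions $R[G]\to R[G]/(p^n)$. *)

theory Defs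
  imports "HOL-Algebra.QuotRing" "HOL-Algebra.Ring_Divisibility" "HOL-Algebra.Generated_Groups"
    "HOL-Computational_Algebra.Primes" "HOL-Library.Extended_Nat"
begin

section \<open>Commutative algebra\<close>

definition krull_dim :: "('a, 'm) ring_scheme \<Rightarrow> enat" where
  "krull_dim R = (SUP k \<in> {k. \<exists>P :: nat \<Rightarrow> 'a set.
      (\<forall>i\<le>k. primeideal (P i) R) \<and> (\<forall>i<k. P i \<subset> P (Suc i))}. enat k)"

definition frac_rel :: "('a, 'm) ring_scheme \<Rightarrow> (('a \<times> 'a) \<times> ('a \<times> 'a)) set" where
  "frac_rel R = {((a, b), (c, d)). a \<in> carrier R \<and> b \<in> carrier R - {\<zero>\<^bsub>R\<^esub>} \<and>
      c \<in> carrier R \<and> d \<in> carrier R - {\<zero>\<^bsub>R\<^esub>} \<and> a \<otimes>\<^bsub>R\<^esub> d = c \<otimes>\<^bsub>R\<^esub> b}"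

definition fraction_field :: "('a, 'm) ring_scheme \<Rightarrow> (('a \<times> 'a) set) ring" where
  "fraction_field R =
    \<lparr>carrier = (carrier R \<times> (carrier R - {\<zero>\<^bsub>R\<^esub>})) // frac_rel R,
     mult = (\<lambda>X Y. \<Union>(a, b)\<in>X. \<Union>(c, d)\<in>Y. frac_rel R `` {(a \<otimes>\<^bsub>R\<^esub> c, b \<otimes>\<^bsub>R\<^esub> d)}),
     one = frac_rel R `` {(\<one>\<^bsub>R\<^esub>, \<one>\<^bsub>R\<^esub>)},
     zero = frac_rel R `` {(\<zero>\<^bsub>R\<^esub>, \<one>\<^bsub>R\<^esub>)},
     add = (\<lambda>X Y. \<Union>(a, b)\<in>X. \<Union>(c, d)\<in>Y.
       frac_rel R `` {((a \<otimes>\<^bsub>R\<^esub> d) \<oplus>\<^bsub>R\<^esub> (c \<otimes>\<^bsub>R\<^esub> b), b \<otimes>\<^bsub>R\<^esub> d)})\<rparr>"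

definition char_zero :: "('a, 'm) ring_scheme \<Rightarrow> bool" where
  "char_zero K \<longleftrightarrow> (\<forall>n::nat. n > 0 \<longrightarrow> [n] \<cdot>\<^bsub>K\<^esub> \<one>\<^bsub>K\<^esub> \<noteq> \<zero>\<^bsub>K\<^esub>)"


section \<open>Reductions modulo powers of p and inverse limits\<close>

text \<open>All inverse systems below are indexed by every natural number \<open>n\<close>; the term at \<open>n = 0\<close>
  is the zero ring (respectively its trivial \<open>K\<^sub>1\<close>), which does not affect the limit.\<close>

definition inv_lim_set :: "(nat \<Rightarrow> 'a set) \<Rightarrow> (nat \<Rightarrow> 'a \<Rightarrow> 'a) \<Rightarrow> (nat \<Rightarrow> 'a) set" where
  "inv_lim_set C f = {x. (\<forall>n. x n \<in> C n) \<and> (\<forall>n. f n (x (Suc n)) = x n)}"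

definition inv_lim_group ::
    "(nat \<Rightarrow> ('a, 'm) monoid_scheme) \<Rightarrow> (nat \<Rightarrow> 'a \<Rightarrow> 'a) \<Rightarrow> (nat \<Rightarrow> 'a) monoid" where
  "inv_lim_group H f =
    \<lparr>carrier = inv_lim_set (\<lambda>n. carrier (H n)) f,
     mult = (\<lambda>x y n. x n \<otimes>\<^bsub>H n\<^esub> y n),
     one = (\<lambda>n. \<one>\<^bsub>H n\<^esub>)\<rparr>"

definition inv_lim_ring ::
    "(nat \<Rightarrow> ('a, 'm) ring_scheme) \<Rightarrow> (nat \<Rightarrow> 'a \<Rightarrow> 'a) \<Rightarrow> (nat \<Rightarrow> 'a) ring" where
  "inv_lim_ring S f =
    \<lparr>carrier = inv_lim_set (\<lambda>n. carrier (S n)) f,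
     mult = (\<lambda>x y n. x n \<otimes>\<^bsub>S n\<^esub> y n),
     one = (\<lambda>n. \<one>\<^bsub>S n\<^esub>),
     zero = (\<lambda>n. \<zero>\<^bsub>S n\<^esub>),
     add = (\<lambda>x y n. x n \<oplus>\<^bsub>S n\<^esub> y n)\<rparr>"

text \<open>The two-sided ideal \<open>(p\<^sup>n)\<close>; for commutative \<open>S\<close> this is \<open>p\<^sup>n S\<close>.\<close>

definition padic_ideal :: "nat \<Rightarrow> ('a, 'm) ring_scheme \<Rightarrow> nat \<Rightarrow> 'a set" where
  "padic_ideal p S n = Idl\<^bsub>S\<^esub> {[(p ^ n)] \<cdot>\<^bsub>S\<^esub> \<one>\<^bsub>S\<^esub>}"

definition padic_quot :: "nat \<Rightarrow> ('a, 'm) ring_scheme \<Rightarrow> nat \<Rightarrow> 'a set ring" where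
  "padic_quot p S n = S Quot padic_ideal p S n"

definition padic_proj :: "nat \<Rightarrow> ('a, 'm) ring_scheme \<Rightarrow> nat \<Rightarrow> 'a \<Rightarrow> 'a set" where
  "padic_proj p S n x = padic_ideal p S n +>\<^bsub>S\<^esub> x"

text \<open>The transition map \<open>S/(p\<^bsup>n+1\<^esup>) \<rightarrow> S/(p\<^sup>n)\<close>: the image of a coset \<open>X\<close> under the projection
  to \<open>S/(p\<^sup>n)\<close> is a singleton.\<close>

definition padic_trans :: "nat \<Rightarrow> ('a, 'm) ring_scheme \<Rightarrow> nat \<Rightarrow> 'a set \<Rightarrow> 'a set" where
  "padic_trans p S n X = the_elem (padic_proj p S n ` X)"

definition padically_complete :: "nat \<Rightarrow> ('a, 'm) ring_scheme \<Rightarrow> bool" where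
  "padically_complete p S \<longleftrightarrow>
    (\<lambda>x n. padic_proj p S n x) \<in> ring_iso S (inv_lim_ring (padic_quot p S) (padic_trans p S))"


section \<open>Group rings\<close>

text \<open>The group ring \<open>R[G]\<close> of a \<^emph>\<open>finite\<close> group \<open>G\<close>: no finite-support condition is imposed.\<close>

definition group_ring ::
    "('a, 'm) ring_scheme \<Rightarrow> ('g, 'k) monoid_scheme \<Rightarrow> ('g \<Rightarrow> 'a) ring" where
  "group_ring R G =
    \<lparr>carrier = carrier G \<rightarrow>\<^sub>E carrier R,
     mult = (\<lambda>f g. \<lambda>x\<in>carrier G.
       \<Oplus>\<^bsub>R\<^esub>y\<in>carrier G. f y \<otimes>\<^bsub>R\<^esub> g (inv\<^bsub>G\<^esub> y \<otimes>\<^bsub>G\<^esub> x)),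
     one = (\<lambda>x\<in>carrier G. if x = \<one>\<^bsub>G\<^esub> then \<one>\<^bsub>R\<^esub> else \<zero>\<^bsub>R\<^esub>),
     zero = (\<lambda>x\<in>carrier G. \<zero>\<^bsub>R\<^esub>),
     add = (\<lambda>f g. \<lambda>x\<in>carrier G. f x \<oplus>\<^bsub>R\<^esub> g x)\<rparr>"


section \<open>The group K1 of a ring\<close>

text \<open>
  An \<open>n \<times> n\<close> matrix \<open>A\<close> is represented by the infinite matrix \<open>diag(A, 1, 1, \<dots>)\<close>. With this
  encoding the stabilisation maps \<open>GL\<^sub>n(S) \<rightarrow> GL\<^sub>n\<^sub>+\<^sub>1(S)\<close> become inclusions, and the direct limit
  \<open>GL(S)\<close> is the union of the \<open>GL\<^sub>n(S)\<close>.

  In a product \<open>AB\<close> of two such matrices only finitely many summands are nonzero; the index set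
  of the sum is restricted accordingly because \<^const>\<open>finsum\<close> vanishes on infinite sets.
\<close>

definition mat_one :: "('a, 'm) ring_scheme \<Rightarrow> nat \<Rightarrow> nat \<Rightarrow> 'a" where
  "mat_one S i j = (if i = j then \<one>\<^bsub>S\<^esub> else \<zero>\<^bsub>S\<^esub>)"

definition mat_mult ::
    "('a, 'm) ring_scheme \<Rightarrow> (nat \<Rightarrow> nat \<Rightarrow> 'a) \<Rightarrow> (nat \<Rightarrow> nat \<Rightarrow> 'a) \<Rightarrow> nat \<Rightarrow> nat \<Rightarrow> 'a" where
  "mat_mult S A B i j =
    (\<Oplus>\<^bsub>S\<^esub>k\<in>{k. A i k \<noteq> \<zero>\<^bsub>S\<^esub> \<and> B k j \<noteq> \<zero>\<^bsub>S\<^esub>}. A i k \<otimes>\<^bsub>S\<^esub> B k j)"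

definition mat_monoid :: "('a, 'm) ring_scheme \<Rightarrow> nat \<Rightarrow> (nat \<Rightarrow> nat \<Rightarrow> 'a) monoid" where
  "mat_monoid S n =
    \<lparr>carrier = {A. (\<forall>i<n. \<forall>j<n. A i j \<in> carrier S) \<and>
       (\<forall>i j. i \<ge> n \<or> j \<ge> n \<longrightarrow> A i j = mat_one S i j)},
     mult = mat_mult S,
     one = mat_one S\<rparr>"

lemma (in ring) mat_mult_block:
  assumes "A \<in> carrier (mat_monoid R n)" "B \<in> carrier (mat_monoid R n)" "i < n" "j < n"
  shows "mat_mult R A B i j = (\<Oplus>k\<in>{..<n}. A i k \<otimes> B k j)"
proof -
  have c: "A i k \<in> carrier R" "B k j \<in> carrier R" for k
    using assms by (cases "k<n"; force simp: mat_monoid_def mat_one_def)+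
  have z: "A i k = \<zero>" if "k \<ge> n" for k
    using assms that by (force simp: mat_monoid_def mat_one_def)
  show ?thesis unfolding mat_mult_def
    apply (rule add.finprod_mono_neutral_cong_left)
    using c z assms by (auto simp: Pi_def) (meson leI) 
qed

definition GL_n :: "('a, 'm) ring_scheme \<Rightarrow> nat \<Rightarrow> (nat \<Rightarrow> nat \<Rightarrow> 'a) monoid" where
  "GL_n S n = units_of (mat_monoid S n)"

definition GL :: "('a, 'm) ring_scheme \<Rightarrow> (nat \<Rightarrow> nat \<Rightarrow> 'a) monoid" where
  "GL S = \<lparr>carrier = (\<Union>n. carrier (GL_n S n)), mult = mat_mult S, one = mat_one S\<rparr>"

definition elem_mat :: "('a, 'm) ring_scheme \<Rightarrow> nat \<Rightarrow> nat \<Rightarrow> 'a \<Rightarrow> nat \<Rightarrow> nat \<Rightarrow> 'a" where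
  "elem_mat S i j a k l = (if k = i \<and> l = j then a else mat_one S k l)"

definition elementary_group :: "('a, 'm) ring_scheme \<Rightarrow> (nat \<Rightarrow> nat \<Rightarrow> 'a) set" where
  "elementary_group S = generate (GL S) {elem_mat S i j a | i j a. i \<noteq> j \<and> a \<in> carrier S}"

definition K1 :: "('a, 'm) ring_scheme \<Rightarrow> (nat \<Rightarrow> nat \<Rightarrow> 'a) set monoid" where
  "K1 S = GL S Mod elementary_group S"

text \<open>The homomorphism induced by a ring homomorphism \<open>h : S \<rightarrow> T\<close>: all representatives of a
  coset are mapped to one and the same coset.\<close>

definition K1_map :: "('a, 'm) ring_scheme \<Rightarrow> ('b, 'k) ring_scheme \<Rightarrow> ('a \<Rightarrow> 'b) \<Rightarrow>
    (nat \<Rightarrow> nat \<Rightarrow> 'a) set \<Rightarrow> (nat \<Rightarrow> nat \<Rightarrow> 'b) set" where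
  "K1_map S T h X =
    the_elem ((\<lambda>A. elementary_group T #>\<^bsub>GL T\<^esub> (\<lambda>i j. h (A i j))) ` X)"

definition completed_K1 ::
    "nat \<Rightarrow> ('a, 'm) ring_scheme \<Rightarrow> (nat \<Rightarrow> (nat \<Rightarrow> nat \<Rightarrow> 'a set) set) monoid" where
  "completed_K1 p S = inv_lim_group (\<lambda>n. K1 (padic_quot p S n))
    (\<lambda>n. K1_map (padic_quot p S (Suc n)) (padic_quot p S n) (padic_trans p S n))"

definition K1_completion_map :: "nat \<Rightarrow> ('a, 'm) ring_scheme \<Rightarrow>
    (nat \<Rightarrow> nat \<Rightarrow> 'a) set \<Rightarrow> nat \<Rightarrow> (nat \<Rightarrow> nat \<Rightarrow> 'a set) set" where
  "K1_completion_map p S X = (\<lambda>n. K1_map S (padic_quot p S n) (padic_proj p S n) X)"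

end

theory Submission
  imports Defs "Jordan_Normal_Form.Determinant"
begin

text \<open>
  Write \<open>\<Lambda> = R[G]\<close>. Every class of \<open>K\<^sub>1(\<Lambda>)\<close> that dies in \<open>K\<^sub>1(\<Lambda>/p\<^sup>n)\<close> is represented by a matrix congruent to
  \<open>1\<close> modulo \<open>p\<^sup>n\<close>, and Gaussian elimination turns it into a unit of \<open>1 + p\<^sup>n\<Lambda>\<close>. Hence a compatible
  system in the limit is represented by a fixed matrix times a convergent product of units, which
  gives surjectivity. A single identity, \<open>1 + vw \<sim> 1 + wv\<close> modulo elementary matrices, yields the
  normality of \<open>E\<close>, the independence of the position of a diagonal entry, and the relation
  \<open>1 + ab \<sim> 1 + ba\<close> for units.

  For injectivity let \<open>u = 1 + p\<^sup>jc\<close> have a class in the image of \<open>1 + p\<^sup>n\<Lambda>\<close> for every \<open>n\<close>. For \<open>g\<close> in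
  \<open>G\<close> and \<open>C\<close> the subgroup generated by \<open>g\<close>, the determinant over the commutative ring \<open>R[C]\<close> kills
  elementary matrices; comparing terms of order \<open>p\<^sup>j\<close> shows that the trace of \<open>c\<close>, and therefore the
  sum of the coefficients of \<open>c\<close> over the conjugacy class of \<open>g\<close>, is divisible by \<open>p\<close> once \<open>j\<close> is at
  least \<open>|G|\<close>. So \<open>c\<close> is a combination of commutators modulo \<open>p\<close>, and by successive approximation
  \<open>u = \<Prod>\<^sub>x (1 + r\<^sub>x x) (1 + r\<^sub>x x')\<^sup>-\<^sup>1\<close>, where \<open>x'\<close> is a fixed representative of the class of \<open>x\<close>. As
  only the coefficients \<open>r\<^sub>x\<close> are refined, the product stays finite, and each of its factors is
  elementary.
\<close>

section \<open>Matrices over a ring\<close>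

text \<open>The obstacle is injectivity: a limit of elementary matrices has no reason to be
  elementary, as nothing bounds the number of factors. The approximation therefore improves a word
  of fixed shape, one quotient of units for each group element, in which only coefficients from R
  converge. One determinant over the group ring of the abelianization would not suffice, since
  conjugacy classes that merge there must still be separated; a subgroup C chosen for each g lets
  the trace over R[C] read off the conjugates of g. The competing representative is taken in 1 + p^n
  \<Lambda> with n = 2j: in det(1 + p^j c) = 1 + p^j tr(c) + O(p^(2j)) it then only affects the
  error term. Summing over all conjugations by G counts each element of the class as often as the
  order of the centralizer of g; this order is at most |G|, so its p-adic valuation is less than
  |G|, which is the origin of the bound on j. Characteristic zero enters where p^j and the p-part of
  that order are cancelled.\<close>

definition Mat :: "('a, 'm) ring_scheme \<Rightarrow> (nat \<Rightarrow> nat \<Rightarrow> 'a) monoid" where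
  "Mat S = \<lparr>carrier = (\<Union>n. carrier (mat_monoid S n)), mult = mat_mult S, one = mat_one S\<rparr>"

text \<open>The diagonal stays 1 whatever \<open>v N\<close> is, so the matrix is a product of
  elementary ones for every finitely supported \<open>v\<close>; \<open>row_mat\<close> follows the
  same convention.\<close>

definition col_mat :: "('a, 'm) ring_scheme \<Rightarrow> nat \<Rightarrow> (nat \<Rightarrow> 'a) \<Rightarrow> nat \<Rightarrow> nat \<Rightarrow> 'a" where
  "col_mat S N v i j = (if j = N \<and> i \<noteq> N then v i else mat_one S i j)"

definition row_mat :: "('a, 'm) ring_scheme \<Rightarrow> nat \<Rightarrow> (nat \<Rightarrow> 'a) \<Rightarrow> nat \<Rightarrow> nat \<Rightarrow> 'a" where
  "row_mat S N w i j = (if i = N \<and> j \<noteq> N then w j else mat_one S i j)"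

definition diag_at :: "('a, 'm) ring_scheme \<Rightarrow> nat \<Rightarrow> 'a \<Rightarrow> nat \<Rightarrow> nat \<Rightarrow> 'a" where
  "diag_at S N a i j = (if i = N \<and> j = N then a else mat_one S i j)"

definition rank1_mat :: "('a, 'm) ring_scheme \<Rightarrow> (nat \<Rightarrow> 'a) \<Rightarrow> (nat \<Rightarrow> 'a) \<Rightarrow> nat \<Rightarrow> nat \<Rightarrow> 'a" where
  "rank1_mat S v w i j = mat_one S i j \<oplus>\<^bsub>S\<^esub> v i \<otimes>\<^bsub>S\<^esub> w j"

definition fin_supp :: "('a, 'm) ring_scheme \<Rightarrow> nat \<Rightarrow> (nat \<Rightarrow> 'a) \<Rightarrow> bool" where
  "fin_supp S n v \<longleftrightarrow> (\<forall>i. v i \<in> carrier S) \<and> (\<forall>i\<ge>n. v i = \<zero>\<^bsub>S\<^esub>)"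

lemma (in abelian_monoid) finsum_swap:
  assumes "finite A" "finite B" "\<And>i j. i \<in> A \<Longrightarrow> j \<in> B \<Longrightarrow> f i j \<in> carrier G"
  shows "(\<Oplus>i\<in>A. \<Oplus>j\<in>B. f i j) = (\<Oplus>j\<in>B. \<Oplus>i\<in>A. f i j)"
  using assms(1,3)
proof (induction A rule: finite_induct)
  case empty
  then show ?case by (simp add: finsum_zero)
next
  case (insert a A)
  have "(\<Oplus>i\<in>insert a A. \<Oplus>j\<in>B. f i j) = (\<Oplus>j\<in>B. f a j) \<oplus> (\<Oplus>j\<in>B. \<Oplus>i\<in>A. f i j)"
    using insert by (subst finsum_insert) (auto intro!: finsum_closed)
  also have "\<dots> = (\<Oplus>j\<in>B. f a j \<oplus> (\<Oplus>i\<in>A. f i j))"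
    using insert by (subst finsum_addf) (auto intro!: finsum_closed)
  also have "\<dots> = (\<Oplus>j\<in>B. \<Oplus>i\<in>insert a A. f i j)"
    using insert by (intro finsum_cong') (auto intro!: finsum_closed)
  finally show ?case .
qed

lemma (in abelian_monoid) finsum_single:
  assumes "finite A" "k \<in> A" "f k \<in> carrier G" "\<And>i. i \<in> A \<Longrightarrow> i \<noteq> k \<Longrightarrow> f i = \<zero>"
  shows "(\<Oplus>i\<in>A. f i) = f k"
proof -
  have "(\<Oplus>i\<in>A. f i) = (\<Oplus>i\<in>{k}. f i)"
    using assms by (intro add.finprod_mono_neutral_cong_right) (auto simp: Pi_def, metis zero_closed)
  then show ?thesis using assms by (simp add: finsum_insert)
qed

lemma mult_Mat [simp]: "mult (Mat S) = mat_mult S" and one_Mat [simp]: "one (Mat S) = mat_one S"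
  by (simp_all add: Mat_def)

lemma mult_GL [simp]: "mult (GL S) = mat_mult S" and one_GL [simp]: "one (GL S) = mat_one S"
  by (simp_all add: GL_def)

lemma mult_mat_monoid [simp]: "mult (mat_monoid S n) = mat_mult S"
  and one_mat_monoid [simp]: "one (mat_monoid S n) = mat_one S"
  by (simp_all add: mat_monoid_def)

context ring
begin

section \<open>Stable matrices as a monoid, with \<open>GL\<close> as its group of units\<close>

lemma mat_one_closed [simp]: "mat_one R i j \<in> carrier R"
  by (simp add: mat_one_def)

lemma mat_monoid_iff:
  "A \<in> carrier (mat_monoid R n) \<longleftrightarrow>
    (\<forall>i j. A i j \<in> carrier R) \<and> (\<forall>i j. i \<ge> n \<or> j \<ge> n \<longrightarrow> A i j = mat_one R i j)"
  unfolding mat_monoid_def by simp (metis mat_one_closed not_le)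

lemma mat_monoid_mono: "A \<in> carrier (mat_monoid R n) \<Longrightarrow> n \<le> m \<Longrightarrow> A \<in> carrier (mat_monoid R m)"
  by (auto simp: mat_monoid_iff)

lemma MatI: "A \<in> carrier (mat_monoid R n) \<Longrightarrow> A \<in> carrier (Mat R)"
  by (auto simp: Mat_def)

lemma MatE:
  assumes "A \<in> carrier (Mat R)"
  obtains n where "A \<in> carrier (mat_monoid R n)"
  using assms by (auto simp: Mat_def)

lemma Mat_closed [simp]: "A \<in> carrier (Mat R) \<Longrightarrow> A i j \<in> carrier R"
  by (auto simp: Mat_def mat_monoid_iff)

lemma Mat_common:
  assumes "A \<in> carrier (Mat R)" "B \<in> carrier (Mat R)"
  obtains n where "n \<ge> m" "A \<in> carrier (mat_monoid R n)" "B \<in> carrier (mat_monoid R n)"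
proof -
  obtain a b where "A \<in> carrier (mat_monoid R a)" "B \<in> carrier (mat_monoid R b)"
    using assms by (auto elim!: MatE)
  then show thesis
    using that[of "max m (max a b)"] mat_monoid_mono by (metis max.cobounded1 max.cobounded2 max.coboundedI2)
qed

text \<open>\<open>mat_mult\<close> sums over the positions where both entries are nonzero, a set
  that changes with the matrices. Any finite set outside of which one of the entries vanishes may
  replace it; the product formulas below all rest on this.\<close>

lemma mat_mult_sum:
  assumes "finite K" "\<And>k. A i k \<in> carrier R" "\<And>k. B k j \<in> carrier R"
    "\<And>k. k \<notin> K \<Longrightarrow> A i k = \<zero> \<or> B k j = \<zero>"
  shows "mat_mult R A B i j = (\<Oplus>k\<in>K. A i k \<otimes> B k j)"
  unfolding mat_mult_def using assms
  by (intro add.finprod_mono_neutral_cong_left) auto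

text \<open>Row \<open>i\<close> of \<open>A\<close> is supported below \<open>n\<close> or, beyond
  the block, at its diagonal place \<open>i\<close>. The condition \<open>i < m\<close> keeps that
  place inside the sum, so \<open>B\<close> may be of any shape.\<close>

lemma mat_mult_lessThan:
  assumes "A \<in> carrier (mat_monoid R n)" "\<And>k. B k j \<in> carrier R" "n \<le> m" "i < m"
  shows "mat_mult R A B i j = (\<Oplus>k\<in>{..<m}. A i k \<otimes> B k j)"
  using assms by (intro mat_mult_sum) (auto simp: mat_monoid_iff mat_one_def)

lemma mat_mult_single:
  assumes "\<And>k. A i k \<in> carrier R" "\<And>k. B k j \<in> carrier R"
    "\<And>k. k \<noteq> l \<Longrightarrow> A i k = \<zero> \<or> B k j = \<zero>"
  shows "mat_mult R A B i j = A i l \<otimes> B l j"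
  using mat_mult_sum[of "{l}" A i B j] assms by simp

lemma mat_mult_pair:
  assumes "\<And>k. A i k \<in> carrier R" "\<And>k. B k j \<in> carrier R" "l \<noteq> m"
    "\<And>k. k \<noteq> l \<Longrightarrow> k \<noteq> m \<Longrightarrow> A i k = \<zero> \<or> B k j = \<zero>"
  shows "mat_mult R A B i j = A i l \<otimes> B l j \<oplus> A i m \<otimes> B m j"
  using mat_mult_sum[of "{l, m}" A i B j] assms by simp

lemma mat_mult_closed [simp]:
  assumes "\<And>i j. A i j \<in> carrier R" "\<And>i j. B i j \<in> carrier R"
  shows "mat_mult R A B i j \<in> carrier R"
  unfolding mat_mult_def using assms by (auto intro!: finsum_closed)

lemma mat_mult_monoid:
  assumes "A \<in> carrier (mat_monoid R n)" "B \<in> carrier (mat_monoid R n)"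
  shows "mat_mult R A B \<in> carrier (mat_monoid R n)"
proof -
  have "mat_mult R A B i j = mat_one R i j" if "i \<ge> n" for i j
    using assms that mat_mult_single[of A i B j i] by (auto simp: mat_monoid_iff mat_one_def)
  moreover have "mat_mult R A B i j = mat_one R i j" if "j \<ge> n" for i j
    using assms that mat_mult_single[of A i B j j] by (auto simp: mat_monoid_iff mat_one_def)
  ultimately show ?thesis
    using assms by (auto simp: mat_monoid_iff)
qed

lemma mat_one_mat_monoid [simp]: "mat_one R \<in> carrier (mat_monoid R n)"
  by (simp add: mat_monoid_iff)

lemma mat_mult_one_left: "(\<And>k j. A k j \<in> carrier R) \<Longrightarrow> mat_mult R (mat_one R) A = A"
proof (intro ext)
  fix i j assume "\<And>k j. A k j \<in> carrier R"
  then show "mat_mult R (mat_one R) A i j = A i j"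
    using mat_mult_single[of "mat_one R" i A j i] by (simp add: mat_one_def)
qed

lemma mat_mult_one_right: "(\<And>k j. A k j \<in> carrier R) \<Longrightarrow> mat_mult R A (mat_one R) = A"
proof (intro ext)
  fix i j assume "\<And>k j. A k j \<in> carrier R"
  then show "mat_mult R A (mat_one R) i j = A i j"
    using mat_mult_single[of A i "mat_one R" j j] by (simp add: mat_one_def)
qed

lemma mat_mult_assoc:
  assumes A: "A \<in> carrier (mat_monoid R n)" and B: "B \<in> carrier (mat_monoid R n)"
    and C: "C \<in> carrier (mat_monoid R n)"
  shows "mat_mult R (mat_mult R A B) C = mat_mult R A (mat_mult R B C)"
proof (intro ext)
  fix i j
  \<comment> \<open>One bound for all sums: it contains the block and also the rows \<open>i\<close>
    and \<open>j\<close>, which may lie outside the block and then have their only entry on the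
    diagonal.\<close>
  define m where "m = Suc (max n (max i j))"
  have m: "n \<le> m" "i < m" "j < m" by (auto simp: m_def)
  have [simp]: "A k l \<in> carrier R" "B k l \<in> carrier R" "C k l \<in> carrier R" for k l
    using assms by (auto simp: mat_monoid_iff)
  have "mat_mult R (mat_mult R A B) C i j = (\<Oplus>k\<in>{..<m}. mat_mult R A B i k \<otimes> C k j)"
    by (rule mat_mult_lessThan[OF mat_mult_monoid[OF A B]]) (use m in auto)
  also have "\<dots> = (\<Oplus>k\<in>{..<m}. \<Oplus>l\<in>{..<m}. A i l \<otimes> B l k \<otimes> C k j)"
    using m by (intro finsum_cong') (auto simp: mat_mult_lessThan[OF A] finsum_ldistr intro!: finsum_closed)
  also have "\<dots> = (\<Oplus>l\<in>{..<m}. \<Oplus>k\<in>{..<m}. A i l \<otimes> B l k \<otimes> C k j)"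
    by (rule finsum_swap) auto
  also have "\<dots> = (\<Oplus>l\<in>{..<m}. A i l \<otimes> mat_mult R B C l j)"
    using m by (intro finsum_cong') (auto simp: mat_mult_lessThan[OF B] finsum_rdistr m_assoc intro!: finsum_closed)
  also have "\<dots> = mat_mult R A (mat_mult R B C) i j"
    by (rule mat_mult_lessThan[OF A, symmetric]) (use m in auto)
  finally show "mat_mult R (mat_mult R A B) C i j = mat_mult R A (mat_mult R B C) i j" .
qed

lemma monoid_Mat: "monoid (Mat R)"
proof (rule monoidI; unfold mult_Mat one_Mat)
  show "mat_one R \<in> carrier (Mat R)" by (rule MatI[OF mat_one_mat_monoid[of 0]])
next
  fix A B C assume A: "A \<in> carrier (Mat R)" and B: "B \<in> carrier (Mat R)"
  then show "mat_mult R A B \<in> carrier (Mat R)"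
    by (metis Mat_common MatI mat_mult_monoid)
  assume C: "C \<in> carrier (Mat R)"
  obtain m where "C \<in> carrier (mat_monoid R m)" using C by (rule MatE)
  then obtain n where "A \<in> carrier (mat_monoid R n)" "B \<in> carrier (mat_monoid R n)" "C \<in> carrier (mat_monoid R n)"
    by (rule_tac Mat_common[OF A B, of m]) (rule that, assumption+, rule mat_monoid_mono)
  then show "mat_mult R (mat_mult R A B) C = mat_mult R A (mat_mult R B C)"
    by (rule mat_mult_assoc)
qed (auto simp: mat_mult_one_left mat_mult_one_right)

text \<open>\<open>Mat\<close> also admits matrices that are not known to be invertible. A matrix
  and its inverse in this union share some block size, so invertibility there already happens at a
  finite stage, and group facts about \<open>GL\<close> come from the units of one monoid.\<close>

lemma GL_eq_units: "GL R = units_of (Mat R)"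
proof -
  have "(\<Union>n. carrier (GL_n R n)) = Units (Mat R)"
  proof safe
    fix A n assume "A \<in> carrier (GL_n R n)"
    then show "A \<in> Units (Mat R)"
      by (auto simp: GL_n_def units_of_carrier Units_def intro: MatI)
  next
    fix A assume "A \<in> Units (Mat R)"
    then obtain B where AB: "A \<in> carrier (Mat R)" "B \<in> carrier (Mat R)"
      "mat_mult R A B = mat_one R" "mat_mult R B A = mat_one R"
      by (auto simp: Units_def)
    then obtain n where "A \<in> carrier (mat_monoid R n)" "B \<in> carrier (mat_monoid R n)"
      using Mat_common by blast
    then have "A \<in> carrier (GL_n R n)"
      using AB(3,4) by (auto simp: GL_n_def units_of_carrier Units_def)
    then show "A \<in> (\<Union>n. carrier (GL_n R n))" by blast
  qed
  then show ?thesis by (simp add: GL_def units_of_def)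
qed

lemma carrier_GL: "carrier (GL R) = Units (Mat R)"
  by (simp add: GL_eq_units units_of_carrier)

lemma group_GL: "group (GL R)"
  unfolding GL_eq_units by (rule monoid.units_group[OF monoid_Mat])

lemma GL_Mat: "A \<in> carrier (GL R) \<Longrightarrow> A \<in> carrier (Mat R)"
  by (simp add: carrier_GL Units_def)

lemma GLI:
  assumes "A \<in> carrier (Mat R)" "B \<in> carrier (Mat R)" "mat_mult R A B = mat_one R" "mat_mult R B A = mat_one R"
  shows "A \<in> carrier (GL R)"
  using assms by (auto simp: carrier_GL Units_def)

lemma inv_GL:
  assumes "A \<in> carrier (Mat R)" "B \<in> carrier (Mat R)" "mat_mult R A B = mat_one R" "mat_mult R B A = mat_one R"
  shows "inv\<^bsub>GL R\<^esub> A = B"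
  using assms group.inv_equality[OF group_GL, of B A] by (auto simp: GLI)

section \<open>Products with elementary, column, row and diagonal matrices\<close>

lemma col_mat_Mat [simp]: "fin_supp R n v \<Longrightarrow> col_mat R N v \<in> carrier (Mat R)"
  by (rule MatI[of _ "Suc (max n N)"]) (auto simp: mat_monoid_iff col_mat_def fin_supp_def mat_one_def)

lemma row_mat_Mat [simp]: "fin_supp R n v \<Longrightarrow> row_mat R N v \<in> carrier (Mat R)"
  by (rule MatI[of _ "Suc (max n N)"]) (auto simp: mat_monoid_iff row_mat_def fin_supp_def mat_one_def)

lemma diag_at_mat_monoid: "a \<in> carrier R \<Longrightarrow> N < n \<Longrightarrow> diag_at R N a \<in> carrier (mat_monoid R n)"
  by (auto simp: mat_monoid_iff diag_at_def mat_one_def)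

lemma diag_at_Mat [simp]: "a \<in> carrier R \<Longrightarrow> diag_at R N a \<in> carrier (Mat R)"
  by (rule MatI[OF diag_at_mat_monoid]) auto

lemma elem_mat_mat_monoid:
  "i < n \<Longrightarrow> j < n \<Longrightarrow> a \<in> carrier R \<Longrightarrow> elem_mat R i j a \<in> carrier (mat_monoid R n)"
  by (auto simp: mat_monoid_iff elem_mat_def mat_one_def)

lemma elem_mat_Mat [simp]: "a \<in> carrier R \<Longrightarrow> elem_mat R i j a \<in> carrier (Mat R)"
  by (rule MatI[OF elem_mat_mat_monoid[of _ "Suc (max i j)"]]) auto

lemma rank1_mat_Mat [simp]:
  "fin_supp R n v \<Longrightarrow> fin_supp R n w \<Longrightarrow> rank1_mat R v w \<in> carrier (Mat R)"
  by (rule MatI[of _ n]) (auto simp: mat_monoid_iff rank1_mat_def fin_supp_def)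

lemma elem_mat_mult:
  assumes "i \<noteq> j" "a \<in> carrier R" "\<And>k l. B k l \<in> carrier R"
  shows "mat_mult R (elem_mat R i j a) B k l = (if k = i then B i l \<oplus> a \<otimes> B j l else B k l)"
proof (cases "k = i")
  case True
  then show ?thesis using assms
    by (subst mat_mult_pair[where l = i and m = j]) (auto simp: elem_mat_def mat_one_def)
next
  case False
  then show ?thesis using assms
    by (subst mat_mult_single[where l = k]) (auto simp: elem_mat_def mat_one_def)
qed

lemma mult_elem_mat:
  assumes "i \<noteq> j" "a \<in> carrier R" "\<And>k l. B k l \<in> carrier R"
  shows "mat_mult R B (elem_mat R i j a) k l = (if l = j then B k j \<oplus> B k i \<otimes> a else B k l)"
proof (cases "l = j")
  case True
  then show ?thesis using assms
    by (subst mat_mult_pair[where l = j and m = i]) (auto simp: elem_mat_def mat_one_def)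
next
  case False
  then show ?thesis using assms
    by (subst mat_mult_single[where l = l]) (auto simp: elem_mat_def mat_one_def)
qed

lemma col_mat_mult:
  assumes "fin_supp R n v" "\<And>k l. B k l \<in> carrier R"
  shows "mat_mult R (col_mat R N v) B i j = (if i = N then B N j else B i j \<oplus> v i \<otimes> B N j)"
proof (cases "i = N")
  case True
  then show ?thesis using assms
    by (subst mat_mult_single[where l = i]) (auto simp: col_mat_def fin_supp_def mat_one_def)
next
  case False
  then show ?thesis using assms
    by (subst mat_mult_pair[where l = i and m = N]) (auto simp: col_mat_def fin_supp_def mat_one_def)
qed

lemma mult_row_mat:
  assumes "fin_supp R n w" "\<And>k l. B k l \<in> carrier R"
  shows "mat_mult R B (row_mat R N w) i j = (if j = N then B i N else B i j \<oplus> B i N \<otimes> w j)"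
proof (cases "j = N")
  case True
  then show ?thesis using assms
    by (subst mat_mult_single[where l = j]) (auto simp: row_mat_def fin_supp_def mat_one_def)
next
  case False
  then show ?thesis using assms
    by (subst mat_mult_pair[where l = j and m = N]) (auto simp: row_mat_def fin_supp_def mat_one_def)
qed

lemma diag_at_mult:
  assumes "a \<in> carrier R" "\<And>k l. B k l \<in> carrier R"
  shows "mat_mult R (diag_at R N a) B i j = (if i = N then a \<otimes> B N j else B i j)"
  using assms by (subst mat_mult_single[where l = i]) (auto simp: diag_at_def mat_one_def)

text \<open>Row \<open>N\<close> of the product is a full linear combination of the rows of
  \<open>B\<close>. The matrix \<open>row_mat\<close> ignores \<open>w N\<close>; requiring it to be
  zero makes the term at \<open>N\<close> vanish, so that the sum can run over all of
  \<open>{..<n}\<close>.\<close>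

lemma row_mat_mult:
  assumes "fin_supp R n w" "w N = \<zero>" "\<And>k l. B k l \<in> carrier R"
  shows "mat_mult R (row_mat R N w) B i j =
    (if i = N then B N j \<oplus> (\<Oplus>k\<in>{..<n}. w k \<otimes> B k j) else B i j)"
proof (cases "i = N")
  case True
  have *: "(\<Oplus>k\<in>{..<n} - {N}. row_mat R N w N k \<otimes> B k j) = (\<Oplus>k\<in>{..<n}. w k \<otimes> B k j)"
    using assms by (intro add.finprod_mono_neutral_cong_left) (auto simp: row_mat_def fin_supp_def)
  have "mat_mult R (row_mat R N w) B i j = (\<Oplus>k\<in>insert N ({..<n} - {N}). row_mat R N w N k \<otimes> B k j)"
    using assms True by (subst mat_mult_sum[where K = "insert N ({..<n} - {N})"])
      (auto simp: row_mat_def fin_supp_def mat_one_def)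
  also have "\<dots> = B N j \<oplus> (\<Oplus>k\<in>{..<n} - {N}. row_mat R N w N k \<otimes> B k j)"
    using assms by (subst finsum_insert) (auto simp: row_mat_def fin_supp_def mat_one_def)
  finally show ?thesis using True * by simp
next
  case False
  then show ?thesis using assms
    by (subst mat_mult_single[where l = i]) (auto simp: row_mat_def fin_supp_def mat_one_def)
qed

end

section \<open>Vaserstein's identity and the group K1\<close>

definition K1_class :: "('a, 'm) ring_scheme \<Rightarrow> (nat \<Rightarrow> nat \<Rightarrow> 'a) \<Rightarrow> (nat \<Rightarrow> nat \<Rightarrow> 'a) set" where
  "K1_class S A = elementary_group S #>\<^bsub>GL S\<^esub> A"

context ring
begin

lemma elem_mat_inverse:
  assumes "i \<noteq> j" "a \<in> carrier R"
  shows "mat_mult R (elem_mat R i j a) (elem_mat R i j (\<ominus> a)) = mat_one R"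
proof (intro ext)
  fix k l
  show "mat_mult R (elem_mat R i j a) (elem_mat R i j (\<ominus> a)) k l = mat_one R k l"
    using assms by (subst elem_mat_mult) (auto simp: elem_mat_def mat_one_def r_neg l_neg)
qed

lemma elem_mat_GL: "i \<noteq> j \<Longrightarrow> a \<in> carrier R \<Longrightarrow> elem_mat R i j a \<in> carrier (GL R)"
  using elem_mat_inverse[of i j a] elem_mat_inverse[of i j "\<ominus> a"]
  by (intro GLI[of _ "elem_mat R i j (\<ominus> a)"]) auto

lemma inv_elem_mat: "i \<noteq> j \<Longrightarrow> a \<in> carrier R \<Longrightarrow> inv\<^bsub>GL R\<^esub> (elem_mat R i j a) = elem_mat R i j (\<ominus> a)"
  using elem_mat_inverse[of i j a] elem_mat_inverse[of i j "\<ominus> a"]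
  by (intro inv_GL) auto

lemma elem_mats_GL: "{elem_mat R i j a | i j a. i \<noteq> j \<and> a \<in> carrier R} \<subseteq> carrier (GL R)"
  by (auto intro: elem_mat_GL)

lemma subgroup_elementary: "subgroup (elementary_group R) (GL R)"
  unfolding elementary_group_def by (rule group.generate_is_subgroup[OF group_GL elem_mats_GL])

lemma elementary_GL: "A \<in> elementary_group R \<Longrightarrow> A \<in> carrier (GL R)"
  using subgroup_elementary by (rule subgroup.mem_carrier)

lemma elementary_mult: "A \<in> elementary_group R \<Longrightarrow> B \<in> elementary_group R \<Longrightarrow> mat_mult R A B \<in> elementary_group R"
  using subgroup.m_closed[OF subgroup_elementary] by simp

lemma elementary_one: "mat_one R \<in> elementary_group R"
  using subgroup.one_closed[OF subgroup_elementary] by simp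

lemma elem_mat_elementary: "i \<noteq> j \<Longrightarrow> a \<in> carrier R \<Longrightarrow> elem_mat R i j a \<in> elementary_group R"
  unfolding elementary_group_def by (rule generate.incl) auto

text \<open>Induction on the support: the last entry is split off as one elementary factor, except
  at \<open>n = N\<close>, where \<open>col_mat\<close> does not see it.\<close>

lemma col_mat_elementary: "fin_supp R n v \<Longrightarrow> col_mat R N v \<in> elementary_group R"
proof (induction n arbitrary: v)
  case 0
  then have "col_mat R N v = mat_one R"
    by (auto simp: fin_supp_def col_mat_def mat_one_def intro!: ext)
  then show ?case by (simp add: elementary_one)
next
  case (Suc n)
  define v' where "v' = v(n := \<zero>)"
  have v': "fin_supp R n v'"
    using Suc.prems by (auto simp: fin_supp_def v'_def)
  show ?case
  proof (cases "n = N")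
    case True
    then have "col_mat R N v = col_mat R N v'"
      by (auto simp: col_mat_def v'_def intro!: ext)
    then show ?thesis using Suc.IH[OF v'] by simp
  next
    case False
    have vn: "v n \<in> carrier R" "v k \<in> carrier R" for k using Suc.prems by (auto simp: fin_supp_def)
    have "mat_mult R (elem_mat R n N (v n)) (col_mat R N v') = col_mat R N v"
    proof (intro ext)
      fix k l show "mat_mult R (elem_mat R n N (v n)) (col_mat R N v') k l = col_mat R N v k l"
        using False vn Mat_closed[OF col_mat_Mat[OF v']]
        by (subst elem_mat_mult) (auto simp: col_mat_def v'_def mat_one_def)
    qed
    then show ?thesis
      using Suc.IH[OF v'] elementary_mult elem_mat_elementary[OF False vn(1)] by metis
  qed
qed

lemma row_mat_elementary: "fin_supp R n v \<Longrightarrow> row_mat R N v \<in> elementary_group R"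
proof (induction n arbitrary: v)
  case 0
  then have "row_mat R N v = mat_one R"
    by (auto simp: fin_supp_def row_mat_def mat_one_def intro!: ext)
  then show ?case by (simp add: elementary_one)
next
  case (Suc n)
  define v' where "v' = v(n := \<zero>)"
  have v': "fin_supp R n v'"
    using Suc.prems by (auto simp: fin_supp_def v'_def)
  show ?case
  proof (cases "n = N")
    case True
    then have "row_mat R N v = row_mat R N v'"
      by (auto simp: row_mat_def v'_def intro!: ext)
    then show ?thesis using Suc.IH[OF v'] by simp
  next
    case False
    have vn: "v n \<in> carrier R" "v k \<in> carrier R" for k using Suc.prems by (auto simp: fin_supp_def)
    \<comment> \<open>Here the factor stands on the right: it adds a multiple of column
      \<open>N\<close> to column \<open>n\<close>, and column \<open>N\<close> of
      \<open>row_mat\<close> is a unit vector.\<close>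
    have "mat_mult R (row_mat R N v') (elem_mat R N n (v n)) = row_mat R N v"
    proof (intro ext)
      fix k l show "mat_mult R (row_mat R N v') (elem_mat R N n (v n)) k l = row_mat R N v k l"
        using False vn Mat_closed[OF row_mat_Mat[OF v']]
        by (subst mult_elem_mat) (auto simp: row_mat_def v'_def mat_one_def)
    qed
    then show ?thesis
      using Suc.IH[OF v'] elementary_mult elem_mat_elementary[OF False[symmetric] vn(1)] by metis
  qed
qed

text \<open>Since \<open>v\<close> and \<open>w\<close> vanish at \<open>N\<close>, this index
  serves as a fresh coordinate. Both sides are then the block matrix with rows (1, -v) and (w, 1),
  factored once with lower and once with upper triangular part first; the two Schur complements are
  1 + wv and 1 + vw.\<close>

lemma vaserstein_identity:
  assumes v: "fin_supp R n v" "v N = \<zero>" and w: "fin_supp R n w" "w N = \<zero>"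
    and g: "g = \<one> \<oplus> (\<Oplus>k\<in>{..<n}. w k \<otimes> v k)"
  defines "u \<equiv> \<lambda>i. \<ominus> v i"
  shows "mat_mult R (row_mat R N w) (mat_mult R (diag_at R N g) (col_mat R N u)) =
    mat_mult R (col_mat R N u) (mat_mult R (rank1_mat R v w) (row_mat R N w))"
proof (intro ext)
  fix i j
  define s where "s = (\<Oplus>k\<in>{..<n}. w k \<otimes> v k)"
  have vc [simp]: "v k \<in> carrier R" and wc [simp]: "w k \<in> carrier R" for k
    using v w by (auto simp: fin_supp_def)
  have u: "fin_supp R n u" using v by (auto simp: fin_supp_def u_def)
  have s [simp]: "s \<in> carrier R" unfolding s_def by (auto intro!: finsum_closed)
  have gc [simp]: "g \<in> carrier R" using s unfolding s_def g by auto
  define D where "D = mat_mult R (diag_at R N g) (col_mat R N u)"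
  have D: "D k l = (if k = N then (if l = N then g else \<zero>) else if l = N then u k else mat_one R k l)" for k l
    unfolding D_def using Mat_closed[OF col_mat_Mat[OF u]]
    by (subst diag_at_mult) (auto simp: col_mat_def mat_one_def)
  have uc [simp]: "u k \<in> carrier R" for k using u by (auto simp: fin_supp_def)
  have Dc: "D k l \<in> carrier R" for k l by (auto simp: D)
  have sum1: "(\<Oplus>k\<in>{..<n}. w k \<otimes> D k j) = w j" if "j \<noteq> N"
  proof (cases "j < n")
    case True
    then show ?thesis using that w
      by (subst finsum_single[where k = j]) (auto simp: D mat_one_def)
  next
    case False
    then have "(\<Oplus>k\<in>{..<n}. w k \<otimes> D k j) = (\<Oplus>k\<in>{..<n}. \<zero>)" using that w
      by (intro finsum_cong') (auto simp: D mat_one_def)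
    then show ?thesis using False w by (auto simp: fin_supp_def)
  qed
  have sum2: "(\<Oplus>k\<in>{..<n}. w k \<otimes> D k N) = \<ominus> s"
  proof -
    have "(\<Oplus>k\<in>{..<n}. w k \<otimes> D k N) = (\<Oplus>k\<in>{..<n}. \<ominus> \<one> \<otimes> (w k \<otimes> v k))"
      using w by (intro finsum_cong') (auto simp: D u_def r_minus l_minus)
    also have "\<dots> = \<ominus> \<one> \<otimes> s"
      unfolding s_def by (subst finsum_rdistr) auto
    finally show ?thesis by (simp add: l_minus)
  qed
  define B where "B = mat_mult R (rank1_mat R v w) (row_mat R N w)"
  have Ac: "rank1_mat R v w k l \<in> carrier R" for k l by (simp add: rank1_mat_def)
  have B: "B k l = (if l = N then mat_one R k N else rank1_mat R v w k l \<oplus> mat_one R k N \<otimes> w l)" for k l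
    unfolding B_def using Ac w by (subst mult_row_mat[OF w(1)]) (auto simp: rank1_mat_def)
  have Bc: "B k l \<in> carrier R" for k l using Ac by (auto simp: B)
  have L: "mat_mult R (row_mat R N w) D i j = (if i = N then D N j \<oplus> (\<Oplus>k\<in>{..<n}. w k \<otimes> D k j) else D i j)"
    using Dc by (subst row_mat_mult[OF w]) auto
  have Rr: "mat_mult R (col_mat R N u) B i j = (if i = N then B N j else B i j \<oplus> u i \<otimes> B N j)"
    using Bc by (subst col_mat_mult[OF u]) auto
  have g1: "g \<oplus> \<ominus> s = \<one>" unfolding g s_def[symmetric] by (simp add: a_assoc r_neg)
  have [simp]: "v i \<otimes> w j \<oplus> \<ominus> (v i \<otimes> w j) = \<zero>" by (simp add: r_neg)
  show "mat_mult R (row_mat R N w) D i j = mat_mult R (col_mat R N u) B i j"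
  proof (cases "i = N"; cases "j = N")
    assume "i = N" "j = N"
    then show ?thesis unfolding L Rr using sum2 g1 by (simp add: D B mat_one_def)
  next
    assume "i = N" "j \<noteq> N"
    then show ?thesis unfolding L Rr using sum1 v by (simp add: D B mat_one_def rank1_mat_def)
  next
    assume "i \<noteq> N" "j = N"
    then show ?thesis unfolding L Rr by (simp add: D B mat_one_def rank1_mat_def)
  next
    assume "i \<noteq> N" "j \<noteq> N"
    then show ?thesis unfolding L Rr using v(2)
      by (simp add: D B mat_one_def rank1_mat_def u_def l_minus a_assoc r_neg)
  qed
qed

text \<open>The triangular factors are invertible, so the identity can be solved for 1 + vw. Only
  the single entry 1 + wv has to be invertible; the invertibility of 1 + vw is then a
  consequence.\<close>

lemma vaserstein_solved:
  assumes v: "fin_supp R n v" "v N = \<zero>" and w: "fin_supp R n w" "w N = \<zero>"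
    and g: "g = \<one> \<oplus> (\<Oplus>k\<in>{..<n}. w k \<otimes> v k)" and D: "diag_at R N g \<in> carrier (GL R)"
  shows "\<exists>L\<in>elementary_group R. \<exists>U\<in>elementary_group R.
    rank1_mat R v w = inv\<^bsub>GL R\<^esub> U \<otimes>\<^bsub>GL R\<^esub> (L \<otimes>\<^bsub>GL R\<^esub> (diag_at R N g \<otimes>\<^bsub>GL R\<^esub> U)) \<otimes>\<^bsub>GL R\<^esub> inv\<^bsub>GL R\<^esub> L"
proof -
  define u where "u = (\<lambda>i. \<ominus> v i)"
  have u: "fin_supp R n u" using v by (auto simp: fin_supp_def u_def)
  define L where "L = row_mat R N w"
  define U where "U = col_mat R N u"
  let ?M = "Mat R" let ?A = "rank1_mat R v w" let ?D = "diag_at R N g"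
  have LU: "L \<in> elementary_group R" "U \<in> elementary_group R"
    unfolding L_def U_def using row_mat_elementary[OF w(1)] col_mat_elementary[OF u] by auto
  then have LUG: "L \<in> carrier (GL R)" "U \<in> carrier (GL R)" by (auto intro: elementary_GL)
  interpret M: monoid "Mat R" by (rule monoid_Mat)
  interpret G: group "GL R" by (rule group_GL)
  have c: "L \<in> carrier ?M" "U \<in> carrier ?M" "?A \<in> carrier ?M" "?D \<in> carrier ?M"
      "inv\<^bsub>GL R\<^esub> L \<in> carrier ?M" "inv\<^bsub>GL R\<^esub> U \<in> carrier ?M"
    using LUG v w D by (auto intro: GL_Mat)
  have id: "mat_mult R L (mat_mult R ?D U) = mat_mult R U (mat_mult R ?A L)"
    unfolding L_def U_def u_def by (rule vaserstein_identity[OF v w g])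
  have i: "mat_mult R L (inv\<^bsub>GL R\<^esub> L) = mat_one R" "mat_mult R (inv\<^bsub>GL R\<^esub> U) U = mat_one R"
    using G.r_inv[OF LUG(1)] G.l_inv[OF LUG(2)] by simp_all
  have "mat_mult R (mat_mult R (inv\<^bsub>GL R\<^esub> U) (mat_mult R L (mat_mult R ?D U))) (inv\<^bsub>GL R\<^esub> L) =
    mat_mult R (mat_mult R (mat_mult R (inv\<^bsub>GL R\<^esub> U) U) ?A) (mat_mult R L (inv\<^bsub>GL R\<^esub> L))"
    unfolding id using c M.m_assoc M.m_closed unfolding mult_Mat by simp
  also have "\<dots> = ?A"
    unfolding i using c by (simp add: mat_mult_one_left mat_mult_one_right)
  finally show ?thesis using LU unfolding mult_GL by metis
qed

lemma diag_at_one: "diag_at R N \<one> = mat_one R"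
  by (intro ext) (simp add: diag_at_def mat_one_def)

text \<open>For wv = 0 the middle factor is 1 and only elementary factors remain. The index
  \<open>n\<close> lies beyond both supports and serves as the fresh coordinate.\<close>

lemma rank1_elementary:
  assumes v: "fin_supp R n v" and w: "fin_supp R n w" and wv: "(\<Oplus>k\<in>{..<n}. w k \<otimes> v k) = \<zero>"
  shows "rank1_mat R v w \<in> elementary_group R"
proof -
  interpret G: group "GL R" by (rule group_GL)
  have "diag_at R n \<one> \<in> carrier (GL R)" unfolding diag_at_one using G.one_closed by simp
  then obtain L U where LU: "L \<in> elementary_group R" "U \<in> elementary_group R"
    "rank1_mat R v w = inv\<^bsub>GL R\<^esub> U \<otimes>\<^bsub>GL R\<^esub> (L \<otimes>\<^bsub>GL R\<^esub> (diag_at R n \<one> \<otimes>\<^bsub>GL R\<^esub> U)) \<otimes>\<^bsub>GL R\<^esub> inv\<^bsub>GL R\<^esub> L"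
    using vaserstein_solved[of n v n w \<one>] v w wv by (auto simp: fin_supp_def)
  then have "rank1_mat R v w = inv\<^bsub>GL R\<^esub> U \<otimes>\<^bsub>GL R\<^esub> (L \<otimes>\<^bsub>GL R\<^esub> U) \<otimes>\<^bsub>GL R\<^esub> inv\<^bsub>GL R\<^esub> L"
    using elementary_GL GL_Mat by (simp add: diag_at_one mat_mult_one_left)
  then show ?thesis using LU(1,2) subgroup.m_closed[OF subgroup_elementary] subgroup.m_inv_closed[OF subgroup_elementary]
    by metis
qed

text \<open>The conjugate is 1 + vw, where v is column \<open>i\<close> of \<open>A\<close> times
  \<open>a\<close> and w is row \<open>j\<close> of the inverse. Here wv is the entry (j, i) of the
  identity times \<open>a\<close>, hence zero.\<close>

lemma conj_elem_mat:
  assumes A: "A \<in> carrier (GL R)" and "i \<noteq> j" "a \<in> carrier R"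
  shows "A \<otimes>\<^bsub>GL R\<^esub> elem_mat R i j a \<otimes>\<^bsub>GL R\<^esub> inv\<^bsub>GL R\<^esub> A \<in> elementary_group R"
proof -
  interpret G: group "GL R" by (rule group_GL)
  define B where "B = inv\<^bsub>GL R\<^esub> A"
  have B: "B \<in> carrier (GL R)" using A by (simp add: B_def)
  have AB: "mat_mult R A B = mat_one R" "mat_mult R B A = mat_one R"
    using G.r_inv[OF A] G.l_inv[OF A] by (simp_all add: B_def)
  \<comment> \<open>The block must contain \<open>i\<close> and \<open>j\<close>; only then are
    column \<open>i\<close> and row \<open>j\<close> zero beyond \<open>n\<close>.\<close>
  obtain n where n: "n \<ge> Suc (max i j)" "A \<in> carrier (mat_monoid R n)" "B \<in> carrier (mat_monoid R n)"
    using Mat_common[OF GL_Mat[OF A] GL_Mat[OF B]] by blast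
  have Ac [simp]: "A k l \<in> carrier R" and Bc [simp]: "B k l \<in> carrier R" for k l
    using A B GL_Mat by auto
  define v where "v = (\<lambda>k. A k i \<otimes> a)"
  define w where "w = (\<lambda>l. B j l)"
  have ij: "i < n" "j < n" using n by auto
  have v: "fin_supp R n v" and w: "fin_supp R n w"
    using n(2,3) ij assms unfolding fin_supp_def v_def w_def mat_monoid_iff by (auto simp: mat_one_def)
  have "(\<Oplus>k\<in>{..<n}. w k \<otimes> v k) = (\<Oplus>k\<in>{..<n}. B j k \<otimes> A k i \<otimes> a)"
    using assms by (intro finsum_cong') (auto simp: w_def v_def m_assoc)
  also have "\<dots> = mat_mult R B A j i \<otimes> a"
    using assms n ij by (subst mat_mult_lessThan[OF n(3)]) (auto simp: finsum_ldistr)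
  also have "\<dots> = \<zero>" using assms by (simp add: AB mat_one_def)
  finally have E: "rank1_mat R v w \<in> elementary_group R"
    by (rule rank1_elementary[OF v w])
  have "mat_mult R (mat_mult R A (elem_mat R i j a)) B = rank1_mat R v w"
  proof (intro ext)
    fix k l
    define m where "m = Suc (max n (max k l))"
    have m: "n \<le> m" "k < m" "l < m" "j < m" using ij by (auto simp: m_def)
    have "elem_mat R i j a \<in> carrier (mat_monoid R n)"
      using ij assms(3) by (rule elem_mat_mat_monoid)
    then have AE: "mat_mult R A (elem_mat R i j a) \<in> carrier (mat_monoid R n)"
      using n(2) mat_mult_monoid by blast
    have "mat_mult R (mat_mult R A (elem_mat R i j a)) B k l =
      (\<Oplus>r\<in>{..<m}. mat_mult R A (elem_mat R i j a) k r \<otimes> B r l)"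
      by (rule mat_mult_lessThan[OF AE]) (use m in auto)
    also have "\<dots> = (\<Oplus>r\<in>{..<m}. A k r \<otimes> B r l \<oplus> (if j = r then A k i \<otimes> a \<otimes> B j l else \<zero>))"
      using assms by (intro finsum_cong') (auto simp: mult_elem_mat l_distr)
    also have "\<dots> = (\<Oplus>r\<in>{..<m}. A k r \<otimes> B r l) \<oplus> (\<Oplus>r\<in>{..<m}. (if j = r then A k i \<otimes> a \<otimes> B j l else \<zero>))"
      using assms by (subst finsum_addf) auto
    also have "(\<Oplus>r\<in>{..<m}. A k r \<otimes> B r l) = mat_mult R A B k l"
      by (rule mat_mult_lessThan[OF n(2), symmetric]) (use m in auto)
    also have "(\<Oplus>r\<in>{..<m}. (if j = r then A k i \<otimes> a \<otimes> B j l else \<zero>)) = A k i \<otimes> a \<otimes> B j l"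
      using assms m by (subst finsum_single[where k = j]) auto
    finally show "mat_mult R (mat_mult R A (elem_mat R i j a)) B k l = rank1_mat R v w k l"
      by (simp add: AB rank1_mat_def v_def w_def)
  qed
  then show ?thesis using E by (simp add: B_def)
qed

lemma normal_elementary: "elementary_group R \<lhd> GL R"
proof -
  interpret G: group "GL R" by (rule group_GL)
  have "x \<otimes>\<^bsub>GL R\<^esub> h \<otimes>\<^bsub>GL R\<^esub> inv\<^bsub>GL R\<^esub> x \<in> elementary_group R"
    if x: "x \<in> carrier (GL R)" and h: "h \<in> elementary_group R" for x h
    using h unfolding elementary_group_def
  proof (induction rule: generate.induct)
    case one
    then show ?case using x generate.one[of "GL R"] by (simp del: mult_GL one_GL)
  next
    case (incl h)
    then show ?case using conj_elem_mat[OF x] unfolding elementary_group_def by blast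
  next
    case (inv h)
    then show ?case using conj_elem_mat[OF x] inv_elem_mat
      unfolding elementary_group_def[symmetric] by (auto simp del: mult_GL one_GL)
  next
    case (eng h1 h2)
    have c: "h1 \<in> carrier (GL R)" "h2 \<in> carrier (GL R)"
      using eng.hyps elementary_GL unfolding elementary_group_def by auto
    have "x \<otimes>\<^bsub>GL R\<^esub> (h1 \<otimes>\<^bsub>GL R\<^esub> h2) \<otimes>\<^bsub>GL R\<^esub> inv\<^bsub>GL R\<^esub> x =
      (x \<otimes>\<^bsub>GL R\<^esub> h1 \<otimes>\<^bsub>GL R\<^esub> inv\<^bsub>GL R\<^esub> x) \<otimes>\<^bsub>GL R\<^esub> (x \<otimes>\<^bsub>GL R\<^esub> h2 \<otimes>\<^bsub>GL R\<^esub> inv\<^bsub>GL R\<^esub> x)"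
      using x c by (simp add: G.m_assoc G.inv_solve_left del: mult_GL one_GL)
    then show ?case using generate.eng[OF eng.IH] by (simp del: mult_GL one_GL)
  qed
  then show ?thesis using subgroup_elementary by (auto simp: G.normal_inv_iff)
qed

section \<open>Calculus of classes in \<open>K1\<close>\<close>

lemma group_K1: "group (K1 R)"
  unfolding K1_def by (rule normal.factorgroup_is_group[OF normal_elementary])

lemma carrier_K1: "carrier (K1 R) = K1_class R ` carrier (GL R)"
  by (simp add: K1_def carrier_FactGroup K1_class_def)

lemma K1_class_closed [simp]: "A \<in> carrier (GL R) \<Longrightarrow> K1_class R A \<in> carrier (K1 R)"
  by (simp add: carrier_K1)

lemma one_K1: "\<one>\<^bsub>K1 R\<^esub> = elementary_group R"
  by (simp add: K1_def)

lemma K1_class_mult: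
  "A \<in> carrier (GL R) \<Longrightarrow> B \<in> carrier (GL R) \<Longrightarrow>
    K1_class R (mat_mult R A B) = K1_class R A \<otimes>\<^bsub>K1 R\<^esub> K1_class R B"
  using normal.rcos_sum[OF normal_elementary, of A B] by (simp add: K1_class_def K1_def)

lemma K1_class_one_iff:
  "A \<in> carrier (GL R) \<Longrightarrow> K1_class R A = \<one>\<^bsub>K1 R\<^esub> \<longleftrightarrow> A \<in> elementary_group R"
  using group.coset_join1[OF group_GL _ _ subgroup_elementary, of A]
    group.coset_join2[OF group_GL _ subgroup_elementary, of A]
  by (auto simp: K1_class_def one_K1)

lemma K1_class_elementary: "A \<in> elementary_group R \<Longrightarrow> K1_class R A = \<one>\<^bsub>K1 R\<^esub>"
  using K1_class_one_iff elementary_GL by blast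

lemma K1_class_inv:
  assumes "A \<in> carrier (GL R)"
  shows "K1_class R (inv\<^bsub>GL R\<^esub> A) = inv\<^bsub>K1 R\<^esub> (K1_class R A)"
proof -
  interpret G: group "GL R" by (rule group_GL)
  interpret K: group "K1 R" by (rule group_K1)
  have "K1_class R (inv\<^bsub>GL R\<^esub> A) \<otimes>\<^bsub>K1 R\<^esub> K1_class R A = \<one>\<^bsub>K1 R\<^esub>"
    using K1_class_mult[of "inv\<^bsub>GL R\<^esub> A" A] assms G.l_inv[OF assms] K1_class_elementary[OF elementary_one] by simp
  then show ?thesis using assms by (intro K.inv_equality[symmetric]) auto
qed

text \<open>The elementary factors of the solved identity drop out in \<open>K1\<close>. The unit
  may be put at any diagonal place \<open>N\<close> where \<open>v\<close> and \<open>w\<close>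
  vanish.\<close>

lemma K1_class_rank1:
  assumes v: "fin_supp R n v" "v N = \<zero>" and w: "fin_supp R n w" "w N = \<zero>"
    and g: "g = \<one> \<oplus> (\<Oplus>k\<in>{..<n}. w k \<otimes> v k)" and D: "diag_at R N g \<in> carrier (GL R)"
  shows "K1_class R (rank1_mat R v w) = K1_class R (diag_at R N g)"
proof -
  interpret G: group "GL R" by (rule group_GL)
  interpret K: group "K1 R" by (rule group_K1)
  obtain L U where LU: "L \<in> elementary_group R" "U \<in> elementary_group R"
    "rank1_mat R v w = inv\<^bsub>GL R\<^esub> U \<otimes>\<^bsub>GL R\<^esub> (L \<otimes>\<^bsub>GL R\<^esub> (diag_at R N g \<otimes>\<^bsub>GL R\<^esub> U)) \<otimes>\<^bsub>GL R\<^esub> inv\<^bsub>GL R\<^esub> L"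
    using vaserstein_solved[OF assms] by blast
  have c: "L \<in> carrier (GL R)" "U \<in> carrier (GL R)" using LU elementary_GL by auto
  have m: "A \<in> carrier (GL R) \<Longrightarrow> B \<in> carrier (GL R) \<Longrightarrow>
    K1_class R (A \<otimes>\<^bsub>GL R\<^esub> B) = K1_class R A \<otimes>\<^bsub>K1 R\<^esub> K1_class R B" for A B
    using K1_class_mult by simp
  show ?thesis unfolding LU(3) using c D LU(1,2)
    by (simp add: m K1_class_inv K1_class_elementary del: mult_GL)
qed

lemma diag_at_mult_diag:
  "a \<in> carrier R \<Longrightarrow> b \<in> carrier R \<Longrightarrow> mat_mult R (diag_at R N a) (diag_at R N b) = diag_at R N (a \<otimes> b)"
  by (intro ext, subst diag_at_mult) (auto simp: diag_at_def mat_one_def)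

lemma diag_at_GL: "a \<in> Units R \<Longrightarrow> diag_at R N a \<in> carrier (GL R)"
  using diag_at_mult_diag[of a "inv a"] diag_at_mult_diag[of "inv a" a]
  by (intro GLI[of _ "diag_at R N (inv a)"]) (auto simp: diag_at_one)

lemma rank1_unit_vectors:
  assumes "a \<in> carrier R" "b \<in> carrier R"
  shows "rank1_mat R (\<lambda>k. if k = i then a else \<zero>) (\<lambda>k. if k = i then b else \<zero>) = diag_at R i (\<one> \<oplus> a \<otimes> b)"
  using assms by (intro ext) (auto simp: rank1_mat_def diag_at_def mat_one_def)

text \<open>The case of v = a and w = b, both concentrated at \<open>i\<close>: then 1 + vw is a
  diagonal matrix and wv = ba. The place \<open>j\<close> must differ from \<open>i\<close> so that
  both vectors vanish there.\<close>

lemma K1_class_swap_aux: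
  assumes ab: "a \<in> carrier R" "b \<in> carrier R" and u: "\<one> \<oplus> b \<otimes> a \<in> Units R" and "i \<noteq> j"
  shows "K1_class R (diag_at R i (\<one> \<oplus> a \<otimes> b)) = K1_class R (diag_at R j (\<one> \<oplus> b \<otimes> a))"
proof -
  have "(\<Oplus>k\<in>{..<Suc i}. (if k = i then b else \<zero>) \<otimes> (if k = i then a else \<zero>)) = b \<otimes> a"
    using ab by (subst finsum_single[where k = i]) auto
  then show ?thesis
    using K1_class_rank1[of "Suc i" "\<lambda>k. if k = i then a else \<zero>" j "\<lambda>k. if k = i then b else \<zero>" "\<one> \<oplus> b \<otimes> a"]
      assms diag_at_GL[OF u, of j] by (auto simp: fin_supp_def rank1_unit_vectors)
qed

text \<open>The swap is applied to the pair a - 1 and 1, whose two products coincide, so that only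
  the position changes.\<close>

lemma K1_class_diag_move:
  assumes "a \<in> Units R"
  shows "K1_class R (diag_at R i a) = K1_class R (diag_at R j a)"
proof (cases "i = j")
  case False
  have "\<one> \<oplus> (a \<ominus> \<one>) = a" using assms Units_closed by (simp add: minus_eq a_ac r_neg2 r_neg)
  then show ?thesis using K1_class_swap_aux[of "a \<ominus> \<one>" \<one> i j] assms False Units_closed by simp
qed auto

text \<open>The swap forces a change of place, so the entry goes to \<open>Suc i\<close> and is
  moved back.\<close>

lemma K1_class_swap:
  assumes ab: "a \<in> carrier R" "b \<in> carrier R" and u: "\<one> \<oplus> b \<otimes> a \<in> Units R"
  shows "K1_class R (diag_at R i (\<one> \<oplus> a \<otimes> b)) = K1_class R (diag_at R i (\<one> \<oplus> b \<otimes> a))"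
  using K1_class_swap_aux[OF assms, of i "Suc i"] K1_class_diag_move[OF u, of "Suc i" i] by simp

end

section \<open>Gaussian elimination and functoriality\<close>

context ring
begin

text \<open>By \<open>units\<close> the ideal lies in the Jacobson radical. Every pivot is congruent
  to 1 and hence a unit, and the Schur complement is again congruent to 1, so elimination never
  stops. Invertibility of \<open>A\<close> is therefore a conclusion.\<close>

lemma gauss_reduction:
  assumes I: "ideal I R" and units: "\<And>x. x \<in> I \<Longrightarrow> \<one> \<oplus> x \<in> Units R"
    and "A \<in> carrier (mat_monoid R n)" "\<And>i j. A i j \<ominus> mat_one R i j \<in> I"
  shows "A \<in> carrier (GL R) \<and> (\<exists>x\<in>I. K1_class R A = K1_class R (diag_at R 0 (\<one> \<oplus> x)))"
  using assms(3,4)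
proof (induction n arbitrary: A)
  case 0
  then have "A = mat_one R" by (auto simp: mat_monoid_iff intro!: ext)
  moreover have "\<zero> \<in> I" using I by (simp add: additive_subgroup.zero_closed ideal.axioms(1))
  ultimately show ?case using diag_at_one elementary_one elementary_GL by (metis r_zero one_closed)
next
  case (Suc n)
  interpret I: ideal I R by (rule I)
  interpret K: group "K1 R" by (rule group_K1)
  interpret G: group "GL R" by (rule group_GL)
  have Ac [simp]: "A i j \<in> carrier R" for i j using Suc.prems(1) by (auto simp: mat_monoid_iff)
  have out: "A i j = mat_one R i j" if "i > n \<or> j > n" for i j
    using Suc.prems(1) that by (auto simp: mat_monoid_iff Suc_le_eq)
  have off: "A i j \<in> I" if "i \<noteq> j" for i j
    using Suc.prems(2)[of i j] that by (simp add: mat_one_def minus_eq)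
  define g where "g = A n n"
  define x where "x = g \<ominus> \<one>"
  have gx: "g = \<one> \<oplus> x" unfolding x_def using a_lcomm[of \<one> "A n n" "\<ominus> \<one>"] by (simp add: g_def minus_eq r_neg)
  have x: "x \<in> I" using Suc.prems(2)[of n n] by (simp add: x_def g_def mat_one_def)
  have gU: "g \<in> Units R" using units[OF x] gx by simp
  define h where "h = inv g"
  have hg: "h \<in> carrier R" "g \<in> carrier R" "g \<otimes> h = \<one>" "h \<otimes> g = \<one>" using gU by (auto simp: h_def)
  have simps1 [simp]: "g \<otimes> (h \<otimes> y) = y" if "y \<in> carrier R" for y
    using hg that by (simp add: m_assoc[symmetric])
  \<comment> \<open>Clear the last column and row with the pivot \<open>g\<close>: \<open>A = U D B L\<close>.\<close>
  define b where "b = (\<lambda>i. if i < n then A i n \<otimes> h else \<zero>)"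
  define c where "c = (\<lambda>j. if j < n then h \<otimes> A n j else \<zero>)"
  define B where "B = (\<lambda>i j. if i < n \<and> j < n then A i j \<ominus> A i n \<otimes> (h \<otimes> A n j) else mat_one R i j)"
  have b: "fin_supp R n b" and c: "fin_supp R n c" using hg by (auto simp: fin_supp_def b_def c_def)
  have Bm: "B \<in> carrier (mat_monoid R n)" using hg by (auto simp: mat_monoid_iff B_def)
  have BI: "B i j \<ominus> mat_one R i j \<in> I" for i j
  proof (cases "i < n \<and> j < n")
    case True
    have "A i n \<otimes> (h \<otimes> A n j) \<in> I" using off[of i n] True hg by (auto intro: I.I_r_closed)
    moreover have "B i j \<ominus> mat_one R i j = (A i j \<ominus> mat_one R i j) \<ominus> A i n \<otimes> (h \<otimes> A n j)"
      using True hg by (simp add: B_def minus_eq a_ac)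
    ultimately show ?thesis using Suc.prems(2)[of i j] by (simp add: minus_eq)
  next
    case False
    then show ?thesis by (auto simp: B_def minus_eq r_neg)
  qed
  have IH: "B \<in> carrier (GL R)" "\<exists>x\<in>I. K1_class R B = K1_class R (diag_at R 0 (\<one> \<oplus> x))"
    using Suc.IH[OF Bm BI] by auto
  then obtain y where y: "y \<in> I" "K1_class R B = K1_class R (diag_at R 0 (\<one> \<oplus> y))" by blast
  let ?U = "col_mat R n b" and ?D = "diag_at R n g" and ?L = "row_mat R n c"
  have Bc [simp]: "B i j \<in> carrier R" for i j using Bm by (auto simp: mat_monoid_iff)
  have bc [simp]: "b i \<in> carrier R" "c i \<in> carrier R" for i using b c by (auto simp: fin_supp_def)
  define C where "C = mat_mult R B ?L"
  have C: "C i j = (if j = n then B i n else B i j \<oplus> B i n \<otimes> c j)" for i j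
    unfolding C_def by (rule mult_row_mat[OF c]) simp
  have Cc [simp]: "C i j \<in> carrier R" for i j by (simp add: C)
  define D where "D = mat_mult R ?D C"
  have D: "D i j = (if i = n then g \<otimes> C n j else C i j)" for i j
    unfolding D_def using hg by (intro diag_at_mult) auto
  have Dc [simp]: "D i j \<in> carrier R" for i j using hg by (simp add: D)
  have eq: "mat_mult R ?U D = A"
  proof (intro ext)
    fix i j
    have "mat_mult R ?U D i j = (if i = n then D n j else D i j \<oplus> b i \<otimes> D n j)"
      by (rule col_mat_mult[OF b]) simp
    also have "\<dots> = A i j"
    proof (cases "i = n"; cases "j = n")
      assume "i = n" "j = n" then show ?thesis using hg by (simp add: D C B_def mat_one_def g_def)
    next
      assume "i = n" "j \<noteq> n" then show ?thesis
        using hg out[of n j] by (auto simp: D C B_def mat_one_def c_def)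
    next
      assume "i \<noteq> n" "j = n" then show ?thesis
        using hg out[of i n] by (auto simp: D C B_def mat_one_def b_def m_assoc)
    next
      assume "i \<noteq> n" "j \<noteq> n" then show ?thesis
        using hg out[of i j]
        by (auto simp: D C B_def mat_one_def b_def c_def m_assoc minus_eq a_assoc l_neg)
    qed
    finally show "mat_mult R ?U D i j = A i j" .
  qed
  have E: "?U \<in> elementary_group R" "?L \<in> elementary_group R" "?D \<in> carrier (GL R)"
    using b c gU by (auto intro: col_mat_elementary row_mat_elementary diag_at_GL)
  then have G: "?U \<in> carrier (GL R)" "?L \<in> carrier (GL R)" by (auto intro: elementary_GL)
  have cl: "X \<in> carrier (GL R) \<Longrightarrow> Y \<in> carrier (GL R) \<Longrightarrow> mat_mult R X Y \<in> carrier (GL R)" for X Y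
    using G.m_closed by simp
  have CG: "C \<in> carrier (GL R)" "D \<in> carrier (GL R)" "A \<in> carrier (GL R)"
    unfolding eq[symmetric] D_def C_def using G E(3) IH(1) cl by auto
  have xy: "x \<in> carrier R" "y \<in> carrier R" using x y by auto
  have z: "x \<oplus> y \<oplus> x \<otimes> y \<in> I" using x y xy by (intro I.a_closed) (auto intro: I.I_r_closed)
  have yU: "\<one> \<oplus> y \<in> Units R" using units y by blast
  have "K1_class R A = K1_class R ?D \<otimes>\<^bsub>K1 R\<^esub> K1_class R B"
    unfolding eq[symmetric] using CG G E IH(1)
    by (simp add: K1_class_mult K1_class_elementary D_def C_def cl)
  \<comment> \<open>The pivot is carried to place 0, where it can be multiplied with the unit
    collected so far; (1 + x)(1 + y) stays in the coset of 1.\<close>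
  also have "\<dots> = K1_class R (diag_at R 0 g) \<otimes>\<^bsub>K1 R\<^esub> K1_class R (diag_at R 0 (\<one> \<oplus> y))"
    by (simp add: y(2) K1_class_diag_move[OF gU, of n 0])
  also have "\<dots> = K1_class R (diag_at R 0 (g \<otimes> (\<one> \<oplus> y)))"
    using gU yU hg xy by (simp add: K1_class_mult[symmetric] diag_at_GL diag_at_mult_diag)
  also have "g \<otimes> (\<one> \<oplus> y) = \<one> \<oplus> (x \<oplus> y \<oplus> x \<otimes> y)"
    unfolding gx using xy by (simp add: l_distr r_distr a_ac)
  finally show ?case using CG z by blast
qed

end

section \<open>Maps induced by ring homomorphisms\<close>

definition map_mat :: "('a \<Rightarrow> 'b) \<Rightarrow> (nat \<Rightarrow> nat \<Rightarrow> 'a) \<Rightarrow> nat \<Rightarrow> nat \<Rightarrow> 'b" where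
  "map_mat h A = (\<lambda>i j. h (A i j))"

context ring_hom_ring
begin

lemma hom_finsum_ring:
  "f \<in> A \<rightarrow> carrier R \<Longrightarrow> h (\<Oplus>\<^bsub>R\<^esub>i\<in>A. f i) = (\<Oplus>\<^bsub>S\<^esub>i\<in>A. h (f i))"
  by (induction A rule: infinite_finite_induct) (auto simp: Pi_def)

lemma map_mat_one: "map_mat h (mat_one R) = mat_one S"
  by (intro ext) (simp add: map_mat_def mat_one_def)

lemma map_mat_mat_monoid:
  "A \<in> carrier (mat_monoid R n) \<Longrightarrow> map_mat h A \<in> carrier (mat_monoid S n)"
  by (auto simp: R.mat_monoid_iff S.mat_monoid_iff map_mat_def mat_one_def)

text \<open>The homomorphism may kill entries and so shrink the index set in
  \<open>mat_mult\<close>; passing to a fixed range makes both sides comparable.\<close>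

lemma map_mat_mult:
  assumes "A \<in> carrier (Mat R)" "B \<in> carrier (Mat R)"
  shows "map_mat h (mat_mult R A B) = mat_mult S (map_mat h A) (map_mat h B)"
proof (intro ext)
  fix i j
  obtain n where n: "n \<ge> Suc i" "A \<in> carrier (mat_monoid R n)"
    using R.Mat_common[OF assms] by blast
  have "h (mat_mult R A B i j) = (\<Oplus>\<^bsub>S\<^esub>k\<in>{..<n}. h (A i k) \<otimes>\<^bsub>S\<^esub> h (B k j))"
    using assms n by (subst R.mat_mult_lessThan[OF n(2), of B j n]) (auto simp: hom_finsum_ring simp del: hom_finsum)
  also have "\<dots> = mat_mult S (map_mat h A) (map_mat h B) i j"
    using assms n S.mat_mult_lessThan[OF map_mat_mat_monoid[OF n(2)], of "map_mat h B" j n i]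
    by (auto simp: map_mat_def)
  finally show "map_mat h (mat_mult R A B) i j = mat_mult S (map_mat h A) (map_mat h B) i j"
    by (simp add: map_mat_def)
qed

lemma map_mat_Mat: "A \<in> carrier (Mat R) \<Longrightarrow> map_mat h A \<in> carrier (Mat S)"
  by (auto simp: Mat_def intro: map_mat_mat_monoid)

lemma map_mat_GL:
  assumes "A \<in> carrier (GL R)" shows "map_mat h A \<in> carrier (GL S)"
proof -
  interpret G: group "GL R" by (rule R.group_GL)
  define B where "B = inv\<^bsub>GL R\<^esub> A"
  have B: "A \<in> carrier (Mat R)" "B \<in> carrier (Mat R)" using assms by (auto simp: B_def intro: R.GL_Mat)
  have "mat_mult R A B = mat_one R" "mat_mult R B A = mat_one R"
    using G.r_inv[OF assms] G.l_inv[OF assms] by (auto simp: B_def)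
  then have "mat_mult S (map_mat h A) (map_mat h B) = mat_one S" "mat_mult S (map_mat h B) (map_mat h A) = mat_one S"
    using B by (metis map_mat_mult map_mat_one)+
  then show ?thesis using B by (intro S.GLI[of _ "map_mat h B"]) (auto intro: map_mat_Mat)
qed

lemma group_hom_GL: "group_hom (GL R) (GL S) (map_mat h)"
  by (intro group_hom.intro group_hom_axioms.intro R.group_GL S.group_GL homI)
    (auto intro: map_mat_GL simp: map_mat_mult R.GL_Mat)

lemma map_mat_elem_mat: "map_mat h (elem_mat R i j a) = elem_mat S i j (h a)"
  by (intro ext) (simp add: map_mat_def elem_mat_def mat_one_def)

lemma map_mat_diag_at: "map_mat h (diag_at R i a) = diag_at S i (h a)"
  by (intro ext) (simp add: map_mat_def diag_at_def mat_one_def)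

lemma map_mat_elementary_image: "map_mat h ` elementary_group R =
  generate (GL S) {elem_mat S i j (h a) | i j a. i \<noteq> j \<and> a \<in> carrier R}"
proof -
  have "map_mat h ` {elem_mat R i j a | i j a. i \<noteq> j \<and> a \<in> carrier R} =
      {elem_mat S i j (h a) | i j a. i \<noteq> j \<and> a \<in> carrier R}"
    by (force simp: map_mat_elem_mat[symmetric])
  then show ?thesis
    unfolding elementary_group_def using group_hom.generate_img[OF group_hom_GL R.elem_mats_GL] by simp
qed

lemma map_mat_elementary:
  assumes "A \<in> elementary_group R"
  shows "map_mat h A \<in> elementary_group S"
proof -
  have "{elem_mat S i j (h a) | i j a. i \<noteq> j \<and> a \<in> carrier R} \<subseteq>
      {elem_mat S i j a | i j a. i \<noteq> j \<and> a \<in> carrier S}"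
    using hom_closed by blast
  then have "map_mat h ` elementary_group R \<subseteq> elementary_group S"
    unfolding map_mat_elementary_image unfolding elementary_group_def
    by (rule group.mono_generate[OF S.group_GL])
  then show ?thesis using assms by auto
qed

text \<open>Elementary generators lift one by one along any surjection, while invertible matrices in
  general do not; lifting the latter will need completeness.\<close>

lemma map_mat_elementary_surj:
  assumes "h ` carrier R = carrier S"
  shows "map_mat h ` elementary_group R = elementary_group S"
proof -
  have "{elem_mat S i j (h a) | i j a. i \<noteq> j \<and> a \<in> carrier R} =
    {elem_mat S i j a | i j a. i \<noteq> j \<and> a \<in> carrier S}"
    unfolding assms[symmetric] by blast
  then show ?thesis using map_mat_elementary_image unfolding elementary_group_def by simp
qed

text \<open>Elementary matrices go to elementary matrices, so all representatives of a class have
  the same image class. This is the singleton property on which \<open>the_elem\<close> in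
  \<open>K1_map\<close> relies.\<close>

lemma K1_map_class:
  assumes "A \<in> carrier (GL R)"
  shows "K1_map R S h (K1_class R A) = K1_class S (map_mat h A)"
proof -
  have "K1_class S (map_mat h B) = K1_class S (map_mat h A)" if B: "B \<in> K1_class R A" for B
  proof -
    obtain e where e: "e \<in> elementary_group R" "B = mat_mult R e A"
      using B by (auto simp: K1_class_def r_coset_def)
    then have "K1_class S (map_mat h B) = K1_class S (map_mat h e) \<otimes>\<^bsub>K1 S\<^esub> K1_class S (map_mat h A)"
      using assms R.elementary_GL R.GL_Mat map_mat_GL by (simp add: map_mat_mult S.K1_class_mult)
    also have "\<dots> = K1_class S (map_mat h A)"
      using e assms map_mat_GL by (simp add: S.K1_class_elementary[OF map_mat_elementary] monoid.l_one[OF group.is_monoid[OF S.group_K1]])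
    finally show ?thesis .
  qed
  moreover have "A \<in> K1_class R A"
    unfolding K1_class_def by (rule group.rcos_self[OF R.group_GL assms R.subgroup_elementary])
  ultimately have "(\<lambda>B. K1_class S (map_mat h B)) ` K1_class R A = {K1_class S (map_mat h A)}" by blast
  then show ?thesis unfolding K1_map_def K1_class_def map_mat_def by simp
qed

lemma K1_map_hom: "K1_map R S h \<in> hom (K1 R) (K1 S)"
proof (rule homI)
  fix X assume "X \<in> carrier (K1 R)"
  then obtain A where A: "A \<in> carrier (GL R)" "X = K1_class R A"
    by (auto simp: R.carrier_K1)
  then show "K1_map R S h X \<in> carrier (K1 S)"
    using S.K1_class_closed[OF map_mat_GL[OF A(1)]] by (simp add: K1_map_class)
next
  fix X Y assume "X \<in> carrier (K1 R)" "Y \<in> carrier (K1 R)"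
  then obtain A B where AB: "A \<in> carrier (GL R)" "B \<in> carrier (GL R)" "X = K1_class R A" "Y = K1_class R B"
    by (auto simp: R.carrier_K1)
  have c: "mat_mult R A B \<in> carrier (GL R)"
    using AB(1,2) monoid.m_closed[OF group.is_monoid[OF R.group_GL], of A B] by simp
  have "K1_map R S h (X \<otimes>\<^bsub>K1 R\<^esub> Y) = K1_map R S h (K1_class R (mat_mult R A B))"
    using AB by (simp add: R.K1_class_mult)
  also have "\<dots> = K1_class S (mat_mult S (map_mat h A) (map_mat h B))"
    using AB c by (simp add: K1_map_class map_mat_mult R.GL_Mat)
  also have "\<dots> = K1_map R S h X \<otimes>\<^bsub>K1 S\<^esub> K1_map R S h Y"
    using AB by (simp add: S.K1_class_mult map_mat_GL K1_map_class)
  finally show "K1_map R S h (X \<otimes>\<^bsub>K1 R\<^esub> Y) = K1_map R S h X \<otimes>\<^bsub>K1 S\<^esub> K1_map R S h Y" .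
qed

end

section \<open>Rings complete for the p-adic topology\<close>

context ring
begin

section \<open>Multiples by natural numbers, the ideals generated by p^n and their quotients\<close>

lemma add_pow_one: "x \<in> carrier R \<Longrightarrow> [(k::nat)] \<cdot> \<one> \<otimes> x = [k] \<cdot> x"
  using add_pow_ldistr[of \<one> x k] by simp

lemma add_pow_minus: "x \<in> carrier R \<Longrightarrow> [(k::nat)] \<cdot> (\<ominus> x) = \<ominus> ([k] \<cdot> x)"
  using add_pow_rdistr[of "\<ominus> \<one>" x k] by (simp add: l_minus)

lemma add_pow_add: "x \<in> carrier R \<Longrightarrow> y \<in> carrier R \<Longrightarrow> [(k::nat)] \<cdot> (x \<oplus> y) = [k] \<cdot> x \<oplus> [k] \<cdot> y"
  by (rule add.nat_pow_distrib)

lemma add_pow_pow: "x \<in> carrier R \<Longrightarrow> [(a::nat)] \<cdot> ([(b::nat)] \<cdot> x) = [(a * b)] \<cdot> x"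
  using add.nat_pow_pow[of x a b] by (simp add: mult.commute)

lemma add_pow_finsum:
  assumes "finite A" "f \<in> A \<rightarrow> carrier R"
  shows "[(k::nat)] \<cdot> (\<Oplus>i\<in>A. f i) = (\<Oplus>i\<in>A. [k] \<cdot> f i)"
  using assms by (induction A rule: finite_induct) (auto simp: add_pow_add Pi_def)

lemma padic_ideal_ideal: "ideal (padic_ideal p R n) R"
  unfolding padic_ideal_def by (rule genideal_ideal) simp

text \<open>The generator is a multiple of 1 and hence central, so its multiples already form a
  two-sided ideal, also in a noncommutative ring.\<close>

lemma padic_ideal_eq: "padic_ideal p R n = (\<lambda>x. [(p ^ n)] \<cdot> x) ` carrier R"
proof
  have "subgroup ((\<lambda>x. [(p ^ n)] \<cdot> x) ` carrier R) (add_monoid R)"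
  proof (rule add.subgroupI)
    show "(\<lambda>x. [(p ^ n)] \<cdot> x) ` carrier R \<noteq> {}" by auto
  qed (auto simp: add_pow_minus[symmetric] add_pow_add[symmetric] a_inv_def[symmetric])
  then have "ideal ((\<lambda>x. [(p ^ n)] \<cdot> x) ` carrier R) R"
    by (intro idealI ring_axioms) (auto simp: add_pow_ldistr add_pow_rdistr)
  then show "padic_ideal p R n \<subseteq> (\<lambda>x. [(p ^ n)] \<cdot> x) ` carrier R"
    unfolding padic_ideal_def by (intro genideal_minimal) auto
next
  interpret I: ideal "padic_ideal p R n" R by (rule padic_ideal_ideal)
  have "[(p ^ n)] \<cdot> \<one> \<in> padic_ideal p R n"
    unfolding padic_ideal_def by (rule genideal_self') simp
  then have "[(p ^ n)] \<cdot> \<one> \<otimes> x \<in> padic_ideal p R n" if "x \<in> carrier R" for x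
    using that by (rule I.I_r_closed)
  then show "(\<lambda>x. [(p ^ n)] \<cdot> x) ` carrier R \<subseteq> padic_ideal p R n"
    by (auto simp: add_pow_one)
qed

lemma padic_idealI: "x \<in> carrier R \<Longrightarrow> [(p ^ n)] \<cdot> x \<in> padic_ideal p R n"
  by (auto simp: padic_ideal_eq)

lemma padic_idealE:
  assumes "x \<in> padic_ideal p R n"
  obtains y where "y \<in> carrier R" "x = [(p ^ n)] \<cdot> y"
  using assms by (auto simp: padic_ideal_eq)

lemma padic_ideal_carrier: "x \<in> padic_ideal p R n \<Longrightarrow> x \<in> carrier R"
  by (auto simp: padic_ideal_eq)

lemma padic_ideal_0: "padic_ideal p R 0 = carrier R"
  by (auto simp: padic_ideal_eq)

lemma padic_ideal_mono: "m \<le> n \<Longrightarrow> padic_ideal p R n \<subseteq> padic_ideal p R m"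
proof
  fix x assume mn: "m \<le> n" and "x \<in> padic_ideal p R n"
  then obtain y where y: "y \<in> carrier R" "x = [(p ^ n)] \<cdot> y" by (rule_tac padic_idealE)
  have "x = [(p ^ m)] \<cdot> ([(p ^ (n - m))] \<cdot> y)"
    using mn y by (simp add: add_pow_pow power_add[symmetric])
  then show "x \<in> padic_ideal p R m" using y by (simp add: padic_idealI)
qed

lemma padic_ideal_mult:
  assumes "x \<in> padic_ideal p R m" "y \<in> padic_ideal p R n"
  shows "x \<otimes> y \<in> padic_ideal p R (m + n)"
proof -
  obtain a b where ab: "a \<in> carrier R" "b \<in> carrier R" "x = [(p ^ m)] \<cdot> a" "y = [(p ^ n)] \<cdot> b"
    using assms by (auto elim!: padic_idealE)
  then have "x \<otimes> y = [(p ^ (m + n))] \<cdot> (a \<otimes> b)"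
    by (simp add: add_pow_ldistr add_pow_rdistr add_pow_pow power_add mult.commute)
  then show ?thesis using ab by (simp add: padic_idealI)
qed

lemma ring_padic_quot: "ring (padic_quot p R n)"
  unfolding padic_quot_def by (rule ideal.quotient_is_ring[OF padic_ideal_ideal])

lemma padic_proj_hom: "ring_hom_ring R (padic_quot p R n) (padic_proj p R n)"
  using ideal.rcos_ring_hom_ring[OF padic_ideal_ideal[of p n]]
  by (simp add: padic_quot_def padic_proj_def[abs_def])

lemma padic_proj_surj: "padic_proj p R n ` carrier R = carrier (padic_quot p R n)"
  by (auto simp: padic_quot_def padic_proj_def FactRing_def A_RCOSETS_def')

lemma padic_proj_eq_iff:
  "x \<in> carrier R \<Longrightarrow> y \<in> carrier R \<Longrightarrow>
    padic_proj p R n x = padic_proj p R n y \<longleftrightarrow> x \<ominus> y \<in> padic_ideal p R n"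
  using quotient_eq_iff_same_a_r_cos[OF padic_ideal_ideal] by (simp add: padic_proj_def)

lemma padic_proj_mono:
  "x \<in> carrier R \<Longrightarrow> y \<in> carrier R \<Longrightarrow> padic_proj p R n x = padic_proj p R n y \<Longrightarrow> m \<le> n \<Longrightarrow>
    padic_proj p R m x = padic_proj p R m y"
  using padic_ideal_mono[of m n p] by (auto simp: padic_proj_eq_iff)

text \<open>Representatives of one coset modulo p^(n+1) differ by an element of the larger ideal for
  \<open>n\<close>, so the image in \<open>padic_trans\<close> really is a singleton.\<close>

lemma padic_trans_proj:
  assumes x: "x \<in> carrier R"
  shows "padic_trans p R n (padic_proj p R (Suc n) x) = padic_proj p R n x"
proof -
  have "padic_proj p R n y = padic_proj p R n x" if "y \<in> padic_proj p R (Suc n) x" for y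
  proof -
    obtain i where i: "i \<in> padic_ideal p R (Suc n)" "y = i \<oplus> x"
      using \<open>y \<in> _\<close> by (auto simp: padic_proj_def a_r_coset_def')
    then have "i \<in> carrier R" "i \<in> padic_ideal p R n"
      using padic_ideal_carrier padic_ideal_mono[of n "Suc n" p] by auto
    then show ?thesis using i x by (simp add: padic_proj_eq_iff minus_eq a_assoc r_neg)
  qed
  moreover have "x \<in> padic_proj p R (Suc n) x"
  proof -
    have "\<zero> \<in> padic_ideal p R (Suc n)"
      using padic_idealI[of \<zero> p "Suc n"] by simp
    then show ?thesis using x by (force simp: padic_proj_def a_r_coset_def')
  qed
  ultimately have "padic_proj p R n ` padic_proj p R (Suc n) x = {padic_proj p R n x}" by blast
  then show ?thesis by (simp add: padic_trans_def)
qed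

lemma padic_trans_hom: "ring_hom_ring (padic_quot p R (Suc n)) (padic_quot p R n) (padic_trans p R n)"
proof -
  interpret h: ring_hom_ring R "padic_quot p R (Suc n)" "padic_proj p R (Suc n)" by (rule padic_proj_hom)
  interpret k: ring_hom_ring R "padic_quot p R n" "padic_proj p R n" by (rule padic_proj_hom)
  show ?thesis
  proof (rule ring_hom_ringI[OF ring_padic_quot ring_padic_quot])
    show "padic_trans p R n \<one>\<^bsub>padic_quot p R (Suc n)\<^esub> = \<one>\<^bsub>padic_quot p R n\<^esub>"
      using padic_trans_proj[of \<one> p n] by simp
  qed (auto simp: padic_proj_surj[symmetric] padic_trans_proj
      h.hom_add[symmetric] h.hom_mult[symmetric] simp del: h.hom_add h.hom_mult)
qed

lemma map_mat_trans_proj: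
  assumes "A \<in> carrier (Mat R)"
  shows "map_mat (padic_trans p R n) (map_mat (padic_proj p R (Suc n)) A) = map_mat (padic_proj p R n) A"
  using assms by (intro ext) (simp add: map_mat_def padic_trans_proj)

lemma map_mat_lift:
  assumes "A' \<in> carrier (Mat (padic_quot p R n))"
  shows "\<exists>A\<in>carrier (Mat R). map_mat (padic_proj p R n) A = A'"
proof -
  interpret h: ring_hom_ring R "padic_quot p R n" "padic_proj p R n" by (rule padic_proj_hom)
  obtain m where m: "A' \<in> carrier (mat_monoid (padic_quot p R n) m)" using assms by (rule h.S.MatE)
  have "\<exists>x\<in>carrier R. padic_proj p R n x = A' i j" for i j
  proof -
    have "A' i j \<in> padic_proj p R n ` carrier R"
      unfolding padic_proj_surj by (rule h.S.Mat_closed[OF assms])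
    then show ?thesis by force
  qed
  then obtain f where f: "\<And>i j. f i j \<in> carrier R" "\<And>i j. padic_proj p R n (f i j) = A' i j" by metis
  \<comment> \<open>Outside the block the identity itself is used and not a chosen lift of it;
    otherwise the result would not be a stable matrix.\<close>
  define A where "A = (\<lambda>i j. if i < m \<and> j < m then f i j else mat_one R i j)"
  have "A \<in> carrier (mat_monoid R m)" using f by (auto simp: mat_monoid_iff A_def)
  moreover have "map_mat (padic_proj p R n) A = A'"
  proof (intro ext)
    fix i j
    have "A' i j = mat_one (padic_quot p R n) i j" if "\<not> (i < m \<and> j < m)"
      using m that by (auto simp: h.S.mat_monoid_iff)
    then show "map_mat (padic_proj p R n) A i j = A' i j"
      using f by (auto simp: map_mat_def A_def mat_one_def)
  qed
  ultimately show ?thesis using MatI by blast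
qed

section \<open>The completion map on classes\<close>

lemma completion_map_class:
  "A \<in> carrier (GL R) \<Longrightarrow>
    K1_completion_map p R (K1_class R A) n = K1_class (padic_quot p R n) (map_mat (padic_proj p R n) A)"
  by (simp add: K1_completion_map_def ring_hom_ring.K1_map_class[OF padic_proj_hom])

lemma completion_map_hom:
  "(\<lambda>X. K1_completion_map p R X n) \<in> hom (K1 R) (K1 (padic_quot p R n))"
  using ring_hom_ring.K1_map_hom[OF padic_proj_hom] by (simp add: K1_completion_map_def)

lemma completion_map_trans:
  assumes "X \<in> carrier (K1 R)"
  shows "K1_map (padic_quot p R (Suc n)) (padic_quot p R n) (padic_trans p R n)
    (K1_completion_map p R X (Suc n)) = K1_completion_map p R X n"
proof -
  interpret h: ring_hom_ring R "padic_quot p R (Suc n)" "padic_proj p R (Suc n)" by (rule padic_proj_hom)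
  obtain A where A: "A \<in> carrier (GL R)" "X = K1_class R A" using assms by (auto simp: carrier_K1)
  then show ?thesis
    using ring_hom_ring.K1_map_class[OF padic_trans_hom h.map_mat_GL[OF A(1)]]
    by (simp add: completion_map_class map_mat_trans_proj GL_Mat)
qed

lemma carrier_completed_K1:
  "carrier (completed_K1 p R) = {x. (\<forall>n. x n \<in> carrier (K1 (padic_quot p R n))) \<and>
    (\<forall>n. K1_map (padic_quot p R (Suc n)) (padic_quot p R n) (padic_trans p R n) (x (Suc n)) = x n)}"
  by (simp add: completed_K1_def inv_lim_group_def inv_lim_set_def)

lemma K1_completion_map_hom: "K1_completion_map p R \<in> hom (K1 R) (completed_K1 p R)"
proof (rule homI)
  fix X assume X: "X \<in> carrier (K1 R)"
  show "K1_completion_map p R X \<in> carrier (completed_K1 p R)"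
    using hom_in_carrier[OF completion_map_hom X] completion_map_trans[OF X] by (simp add: carrier_completed_K1)
next
  fix X Y assume "X \<in> carrier (K1 R)" "Y \<in> carrier (K1 R)"
  then show "K1_completion_map p R (X \<otimes>\<^bsub>K1 R\<^esub> Y) =
    K1_completion_map p R X \<otimes>\<^bsub>completed_K1 p R\<^esub> K1_completion_map p R Y"
    using hom_mult[OF completion_map_hom, of X Y]
    by (intro ext) (simp add: completed_K1_def inv_lim_group_def)
qed

end

text \<open>Completeness in terms of elements: separatedness and limits of sequences whose
  consecutive terms agree modulo p^n. The ring may be noncommutative, as group rings have to
  qualify.\<close>

locale padic_complete_ring = ring +
  fixes p :: nat
  assumes separated: "x \<in> carrier R \<Longrightarrow> (\<And>n. x \<in> padic_ideal p R n) \<Longrightarrow> x = \<zero>"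
    and cauchy: "(\<And>n. f n \<in> carrier R) \<Longrightarrow> (\<And>n. f (Suc n) \<ominus> f n \<in> padic_ideal p R n) \<Longrightarrow>
      \<exists>x\<in>carrier R. \<forall>n. x \<ominus> f n \<in> padic_ideal p R n"
begin

abbreviation P :: "nat \<Rightarrow> 'a set" where "P \<equiv> padic_ideal p R"
abbreviation Q :: "nat \<Rightarrow> 'a set ring" where "Q \<equiv> padic_quot p R"
abbreviation proj :: "nat \<Rightarrow> 'a \<Rightarrow> 'a set" where "proj \<equiv> padic_proj p R"

lemma proj_hom: "ring_hom_ring R (Q n) (proj n)"
  by (rule padic_proj_hom)

lemma proj_eqI:
  assumes "x \<in> carrier R" "y \<in> carrier R" "\<And>n. proj n x = proj n y"
  shows "x = y"
proof -
  have "x \<ominus> y = \<zero>" using assms by (intro separated) (auto simp: padic_proj_eq_iff)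
  then show ?thesis using assms by simp
qed

lemma limit_exists:
  assumes "\<And>n. f n \<in> carrier R" "\<And>n. proj n (f (Suc n)) = proj n (f n)"
  shows "\<exists>x\<in>carrier R. \<forall>n. proj n x = proj n (f n)"
  using cauchy[of f] assms by (auto simp: padic_proj_eq_iff)

text \<open>The inverse is the fixed point of the contraction sending y to 1 - xy; its iterates from
  1 are the partial sums of the geometric series. The inverse is returned in the form 1 + y with y
  in \<open>P 1\<close> so that the lemma can be applied to it again.\<close>

lemma right_inverse:
  assumes x: "x \<in> P 1"
  shows "\<exists>y\<in>P 1. (\<one> \<oplus> x) \<otimes> (\<one> \<oplus> y) = \<one>"
proof -
  have xc: "x \<in> carrier R" using x by (rule padic_ideal_carrier)
  define f where "f = rec_nat \<one> (\<lambda>_ y. \<one> \<ominus> x \<otimes> y)"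
  have f0: "f 0 = \<one>" and fS: "f (Suc n) = \<one> \<ominus> x \<otimes> f n" for n by (simp_all add: f_def)
  have fc [simp]: "f n \<in> carrier R" for n by (induction n) (simp_all add: f0 fS xc)
  have d: "f (Suc n) \<ominus> f n \<in> P n" for n
  proof (induction n)
    case 0 then show ?case by (simp add: padic_ideal_0)
  next
    case (Suc n)
    interpret I: ideal "P (Suc n)" R by (rule padic_ideal_ideal)
    have "f (Suc (Suc n)) \<ominus> f (Suc n) = \<ominus> (x \<otimes> (f (Suc n) \<ominus> f n))"
      unfolding fS[of "Suc n"] using xc by (subst (2) fS)
        (simp add: minus_eq r_distr r_minus a_ac minus_add r_neg1 r_neg2 l_neg)
    moreover have "x \<otimes> (f (Suc n) \<ominus> f n) \<in> P (Suc n)"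
      using padic_ideal_mult[OF x Suc] by simp
    ultimately show ?case by simp
  qed
  obtain y where y: "y \<in> carrier R" "\<And>n. proj n y = proj n (f n)"
    using limit_exists[of f] d by (auto simp: padic_proj_eq_iff)
  have "(\<one> \<oplus> x) \<otimes> y = \<one>"
  proof (rule proj_eqI)
    fix n
    interpret h: ring_hom_ring R "Q n" "proj n" by (rule proj_hom)
    have "proj n ((\<one> \<oplus> x) \<otimes> y) = proj n ((\<one> \<oplus> x) \<otimes> f n)" using xc y by simp
    also have "(\<one> \<oplus> x) \<otimes> f n = f n \<oplus> (\<one> \<ominus> f (Suc n))"
      unfolding fS using xc by (simp add: l_distr minus_eq minus_add r_neg2 a_ac)
    also have "proj n (f n \<oplus> (\<one> \<ominus> f (Suc n))) = proj n (f n \<oplus> (\<one> \<ominus> f n))"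
    proof -
      have "proj n (f (Suc n)) = proj n (f n)" using d[of n] by (simp add: padic_proj_eq_iff)
      then show ?thesis by (simp add: minus_eq)
    qed
    also have "f n \<oplus> (\<one> \<ominus> f n) = \<one>" by (simp add: minus_eq a_ac r_neg2 r_neg)
    finally show "proj n ((\<one> \<oplus> x) \<otimes> y) = proj n \<one>" .
  qed (use xc y in auto)
  \<comment> \<open>The fixed point equation rewrites the limit as 1 plus the element -xy of
    \<open>P 1\<close>, which is the witness.\<close>
  moreover have "\<one> \<oplus> (\<ominus> (x \<otimes> y)) = y"
  proof -
    have "\<one> = y \<oplus> x \<otimes> y" using calculation xc y by (simp add: l_distr)
    then have "\<one> \<ominus> x \<otimes> y = y \<oplus> x \<otimes> y \<ominus> x \<otimes> y" by simp
    then show ?thesis using xc y by (simp add: minus_eq a_assoc r_neg)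
  qed
  moreover have "\<ominus> (x \<otimes> y) \<in> P 1"
  proof -
    interpret I: ideal "P 1" R by (rule padic_ideal_ideal)
    show ?thesis using I.I_r_closed[OF x y(1)] by (simp del: One_nat_def)
  qed
  ultimately show ?thesis by metis
qed

text \<open>The right inverse of 1 + x has itself a right inverse. An element with inverses on both
  sides has them equal, so that second inverse is 1 + x again.\<close>

lemma one_plus_unit:
  assumes x: "x \<in> P n" and "n \<ge> 1"
  shows "\<one> \<oplus> x \<in> Units R"
proof -
  have "x \<in> P 1" using assms padic_ideal_mono[of 1 n p] by auto
  then obtain y z where y: "y \<in> P 1" "(\<one> \<oplus> x) \<otimes> (\<one> \<oplus> y) = \<one>"
    and z: "z \<in> P 1" "(\<one> \<oplus> y) \<otimes> (\<one> \<oplus> z) = \<one>"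
    using right_inverse by metis
  have c: "\<one> \<oplus> x \<in> carrier R" "\<one> \<oplus> y \<in> carrier R" "\<one> \<oplus> z \<in> carrier R"
    using x y z padic_ideal_carrier by auto
  have "\<one> \<oplus> x = (\<one> \<oplus> x) \<otimes> ((\<one> \<oplus> y) \<otimes> (\<one> \<oplus> z))" using c z(2) by simp
  also have "\<dots> = \<one> \<oplus> z" using c y(2) by (simp add: m_assoc[symmetric])
  finally show ?thesis using c y(2) z(2) unfolding Units_def by auto
qed

lemma gauss_padic:
  assumes A: "A \<in> carrier (Mat R)" and n: "n \<ge> 1"
    and one: "map_mat (proj n) A = mat_one (Q n)"
  shows "A \<in> carrier (GL R)" "\<exists>x\<in>P n. K1_class R A = K1_class R (diag_at R 0 (\<one> \<oplus> x))"
proof -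
  interpret h: ring_hom_ring R "Q n" "proj n" by (rule proj_hom)
  obtain m where m: "A \<in> carrier (mat_monoid R m)" using A by (rule MatE)
  have "A i j \<ominus> mat_one R i j \<in> P n" for i j
  proof -
    have "map_mat (proj n) A i j = map_mat (proj n) (mat_one R) i j"
      by (simp add: one h.map_mat_one)
    then show ?thesis using A by (simp add: map_mat_def padic_proj_eq_iff)
  qed
  then have *: "A \<in> carrier (GL R) \<and> (\<exists>x\<in>P n. K1_class R A = K1_class R (diag_at R 0 (\<one> \<oplus> x)))"
    using gauss_reduction[OF padic_ideal_ideal _ m] one_plus_unit n by blast
  then show "A \<in> carrier (GL R)" "\<exists>x\<in>P n. K1_class R A = K1_class R (diag_at R 0 (\<one> \<oplus> x))"
    by auto
qed

text \<open>A lift B of the inverse makes AB and BA congruent to 1, hence invertible by elimination.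
  This gives A a right inverse and a left inverse, which then coincide.\<close>

lemma GL_lift:
  assumes A: "A \<in> carrier (Mat R)" and n: "n \<ge> 1" and inv: "map_mat (proj n) A \<in> carrier (GL (Q n))"
  shows "A \<in> carrier (GL R)"
proof -
  interpret h: ring_hom_ring R "Q n" "proj n" by (rule proj_hom)
  interpret M: monoid "Mat R" by (rule monoid_Mat)
  interpret G: group "GL (Q n)" by (rule h.S.group_GL)
  obtain B where B: "B \<in> carrier (Mat R)" "map_mat (proj n) B = inv\<^bsub>GL (Q n)\<^esub> (map_mat (proj n) A)"
    using map_mat_lift[OF h.S.GL_Mat[OF G.inv_closed[OF inv]]] by blast
  have AB: "mat_mult R A B \<in> carrier (Mat R)" "mat_mult R B A \<in> carrier (Mat R)"
    using M.m_closed A B by auto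
  have "map_mat (proj n) (mat_mult R A B) = mat_one (Q n)" "map_mat (proj n) (mat_mult R B A) = mat_one (Q n)"
    using G.r_inv[OF inv] G.l_inv[OF inv] A B by (auto simp: h.map_mat_mult)
  then have "mat_mult R A B \<in> Units (Mat R)" "mat_mult R B A \<in> Units (Mat R)"
    using gauss_padic(1) n AB carrier_GL by blast+
  then obtain C D where C: "C \<in> carrier (Mat R)" "mat_mult R (mat_mult R A B) C = mat_one R"
    and D: "D \<in> carrier (Mat R)" "mat_mult R D (mat_mult R B A) = mat_one R"
    unfolding Units_def by auto
  define E where "E = mat_mult R B C"
  define F where "F = mat_mult R D B"
  have EF: "E \<in> carrier (Mat R)" "F \<in> carrier (Mat R)"
    using M.m_closed[OF B(1) C(1)] M.m_closed[OF D(1) B(1)] by (auto simp: E_def F_def)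
  have AE: "mat_mult R A E = mat_one R"
    using C M.m_assoc[OF A B(1) C(1)] by (simp add: E_def)
  have FA: "mat_mult R F A = mat_one R"
    using D M.m_assoc[OF D(1) B(1) A] by (simp add: F_def)
  have "F = E"
    using M.m_assoc[OF EF(2) A EF(1)] EF AE FA by (simp add: mat_mult_one_left mat_mult_one_right)
  then show ?thesis using GLI[OF A EF(1) AE] FA by simp
qed

text \<open>The elementary matrix that trivialises the class modulo p^n lifts to an elementary
  matrix over the ring. Dividing by the lift leaves the class unchanged and makes the representative
  congruent to 1, so that elimination applies.\<close>

lemma completion_map_kernel:
  assumes X: "X \<in> carrier (K1 R)" and n: "n \<ge> 1" and triv: "K1_completion_map p R X n = \<one>\<^bsub>K1 (Q n)\<^esub>"
  shows "\<exists>x\<in>P n. X = K1_class R (diag_at R 0 (\<one> \<oplus> x))"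
proof -
  interpret h: ring_hom_ring R "Q n" "proj n" by (rule proj_hom)
  interpret G: group "GL R" by (rule group_GL)
  interpret GQ: group "GL (Q n)" by (rule h.S.group_GL)
  interpret K: group "K1 R" by (rule group_K1)
  obtain A where A: "A \<in> carrier (GL R)" "X = K1_class R A" using X by (auto simp: carrier_K1)
  have "map_mat (proj n) A \<in> elementary_group (Q n)"
    using triv A h.S.K1_class_one_iff[OF h.map_mat_GL[OF A(1)]] by (simp add: completion_map_class)
  then obtain e where e: "e \<in> elementary_group R" "map_mat (proj n) e = map_mat (proj n) A"
    using h.map_mat_elementary_surj[OF padic_proj_surj] by (metis imageE)
  have eG: "e \<in> carrier (GL R)" using e(1) by (rule elementary_GL)
  define F where "F = inv\<^bsub>GL R\<^esub> e \<otimes>\<^bsub>GL R\<^esub> A"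
  have F: "F \<in> carrier (GL R)" unfolding F_def using eG A by (intro G.m_closed) auto
  interpret hh: group_hom "GL R" "GL (Q n)" "map_mat (proj n)" by (rule h.group_hom_GL)
  have "map_mat (proj n) F = \<one>\<^bsub>GL (Q n)\<^esub>"
    unfolding F_def using eG A by (simp add: e(2) GQ.l_inv hh.hom_mult del: mult_GL one_GL)
  then obtain x where x: "x \<in> P n" "K1_class R F = K1_class R (diag_at R 0 (\<one> \<oplus> x))"
    using gauss_padic(2)[OF GL_Mat[OF F] n] by auto
  have "A = e \<otimes>\<^bsub>GL R\<^esub> F" unfolding F_def using eG A
    by (simp add: G.m_assoc[symmetric] G.r_inv del: mult_GL one_GL)
  then have "X = K1_class R e \<otimes>\<^bsub>K1 R\<^esub> K1_class R F"
    using A eG F by (simp add: K1_class_mult)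
  then have "X = K1_class R F"
    using K.l_one[OF K1_class_closed[OF F]] K1_class_elementary[OF e(1)] by simp
  then show ?thesis using x by blast
qed

lemma completion_map_lift:
  assumes n: "n \<ge> 1" and Y: "Y \<in> carrier (K1 (Q n))"
  shows "\<exists>A\<in>carrier (GL R). K1_completion_map p R (K1_class R A) n = Y"
proof -
  interpret h: ring_hom_ring R "Q n" "proj n" by (rule proj_hom)
  obtain B where B: "B \<in> carrier (GL (Q n))" "Y = K1_class (Q n) B" using Y by (auto simp: h.S.carrier_K1)
  obtain A where A: "A \<in> carrier (Mat R)" "map_mat (proj n) A = B"
    using map_mat_lift[OF h.S.GL_Mat[OF B(1)]] by blast
  then have "A \<in> carrier (GL R)" using GL_lift[OF A(1) n] B by simp
  then show ?thesis using A B by (intro bexI[of _ A]) (simp_all add: completion_map_class)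
qed

lemma completion_map_surj:
  assumes x: "x \<in> carrier (completed_K1 p R)"
  shows "\<exists>X\<in>carrier (K1 R). K1_completion_map p R X = x"
proof -
  interpret G: group "GL R" by (rule group_GL)
  interpret K: group "K1 R" by (rule group_K1)
  let ?cm = "\<lambda>A. K1_completion_map p R (K1_class R A)"
  let ?t = "\<lambda>n. K1_map (Q (Suc n)) (Q n) (padic_trans p R n)"
  have xc: "x n \<in> carrier (K1 (Q n))" and xt: "?t n (x (Suc n)) = x n" for n
    using x by (auto simp: carrier_completed_K1)
  obtain A where A: "A \<in> carrier (GL R)" "?cm A 1 = x 1"
    using completion_map_lift[of 1 "x 1"] xc by auto
  let ?D = "diag_at R 0"
  \<comment> \<open>Stage \<open>n\<close> controls the component \<open>Suc n\<close>: lifting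
    needs a level of at least 1. The matrix \<open>A\<close> never changes; only the unit
    multiplying it does.\<close>
  define Pr where "Pr = (\<lambda>n u. u \<in> carrier R \<and> proj 1 u = proj 1 \<one> \<and> ?cm (mat_mult R A (?D u)) (Suc n) = x (Suc n))"
  have unit: "u \<in> Units R" if "u \<in> carrier R" "proj 1 u = proj 1 \<one>" for u
  proof -
    have "\<one> \<oplus> (u \<ominus> \<one>) \<in> Units R" using that by (intro one_plus_unit[of _ 1]) (auto simp: padic_proj_eq_iff)
    moreover have "\<one> \<oplus> (u \<ominus> \<one>) = u" using that a_lcomm[of \<one> u "\<ominus> \<one>"] by (simp add: minus_eq r_neg)
    ultimately show ?thesis by simp
  qed
  have cl: "X \<in> carrier (GL R) \<Longrightarrow> Y \<in> carrier (GL R) \<Longrightarrow> mat_mult R X Y \<in> carrier (GL R)" for X Y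
    using G.m_closed by simp
  have step: "\<exists>v. Pr (Suc n) v \<and> proj (Suc n) v = proj (Suc n) u" if u: "Pr n u" for n u
  proof -
    interpret h: group_hom "K1 R" "K1 (Q (Suc n))" "\<lambda>X. K1_completion_map p R X (Suc n)"
      using completion_map_hom by (intro group_hom.intro group_hom_axioms.intro group_K1 ring.group_K1[OF ring_padic_quot])
    interpret r1: ring_hom_ring R "Q 1" "proj 1" by (rule proj_hom)
    interpret rn: ring_hom_ring R "Q (Suc n)" "proj (Suc n)" by (rule proj_hom)
    have uU: "u \<in> Units R" "u \<in> carrier R" using u unit by (auto simp: Pr_def)
    define C where "C = mat_mult R A (?D u)"
    have C: "C \<in> carrier (GL R)" "?cm C (Suc n) = x (Suc n)"
      using u A uU cl diag_at_GL by (auto simp: Pr_def C_def)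
    obtain B where B: "B \<in> carrier (GL R)" "?cm B (Suc (Suc n)) = x (Suc (Suc n))"
      using completion_map_lift[of "Suc (Suc n)" "x (Suc (Suc n))"] xc by auto
    have "?cm B (Suc n) = x (Suc n)"
      using completion_map_trans[OF K1_class_closed[OF B(1)], of p "Suc n"] B(2) xt[of "Suc n"] by simp
    \<comment> \<open>\<open>C\<close> is correct at level n + 1 and \<open>B\<close> at level n +
      2; they agree at level n + 1, so the quotient dies there and yields the next correction 1 +
      y.\<close>
    then have "K1_completion_map p R (inv\<^bsub>K1 R\<^esub> (K1_class R C) \<otimes>\<^bsub>K1 R\<^esub> K1_class R B) (Suc n) = \<one>\<^bsub>K1 (Q (Suc n))\<^esub>"
      using B C xc by (simp add: h.H.l_inv)
    then obtain y where y: "y \<in> P (Suc n)"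
      "inv\<^bsub>K1 R\<^esub> (K1_class R C) \<otimes>\<^bsub>K1 R\<^esub> K1_class R B = K1_class R (?D (\<one> \<oplus> y))"
      using completion_map_kernel[of "inv\<^bsub>K1 R\<^esub> (K1_class R C) \<otimes>\<^bsub>K1 R\<^esub> K1_class R B" "Suc n"] B C by auto
    have yU: "\<one> \<oplus> y \<in> Units R" using one_plus_unit[OF y(1)] by simp
    have yc: "y \<in> carrier R" using y(1) by (rule padic_ideal_carrier)
    define v where "v = u \<otimes> (\<one> \<oplus> y)"
    have vc: "v \<in> carrier R" using uU yc by (simp add: v_def)
    have "K1_class R B = K1_class R C \<otimes>\<^bsub>K1 R\<^esub> (inv\<^bsub>K1 R\<^esub> (K1_class R C) \<otimes>\<^bsub>K1 R\<^esub> K1_class R B)"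
      using B C by (simp add: K.m_assoc[symmetric])
    also have "\<dots> = K1_class R (mat_mult R C (?D (\<one> \<oplus> y)))"
      unfolding y(2) using C diag_at_GL[OF yU] by (simp add: K1_class_mult)
    also have "mat_mult R C (?D (\<one> \<oplus> y)) = mat_mult R A (?D v)"
    proof -
      interpret M: monoid "Mat R" by (rule monoid_Mat)
      have "mat_mult R C (?D (\<one> \<oplus> y)) = mat_mult R A (mat_mult R (?D u) (?D (\<one> \<oplus> y)))"
        unfolding C_def using M.m_assoc[of A "?D u" "?D (\<one> \<oplus> y)"] A(1) uU yc GL_Mat by simp
      then show ?thesis using uU yc by (simp add: diag_at_mult_diag v_def)
    qed
    finally have Bv: "K1_class R B = K1_class R (mat_mult R A (?D v))" .
    have "proj (Suc n) (\<one> \<oplus> y) = proj (Suc n) \<one>"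
      using y(1) yc by (subst padic_proj_eq_iff) (simp_all add: minus_eq a_ac r_neg2 r_neg)
    then have pv: "proj (Suc n) v = proj (Suc n) u"
      unfolding v_def using uU yc by (simp add: rn.hom_mult del: rn.hom_add)
    have "proj 1 v = proj 1 u" using padic_proj_mono[OF vc uU(2) pv, of 1] by simp
    then have "Pr (Suc n) v" using u B(2) Bv vc by (simp add: Pr_def)
    then show ?thesis using pv by blast
  qed
  have "Pr 0 \<one>" using A by (simp add: Pr_def diag_at_one mat_mult_one_right GL_Mat)
  then obtain u where u: "\<And>n. Pr n (u n)" "\<And>n. proj (Suc n) (u (Suc n)) = proj (Suc n) (u n)"
    using dependent_nat_choice[of Pr "\<lambda>n u v. proj (Suc n) v = proj (Suc n) u"] step by metis
  have uc: "u n \<in> carrier R" "proj 1 (u n) = proj 1 \<one>" "?cm (mat_mult R A (?D (u n))) (Suc n) = x (Suc n)" for n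
    using u(1)[of n] by (auto simp: Pr_def)
  have "proj n (u (Suc n)) = proj n (u n)" for n
    using padic_proj_mono[OF uc(1) uc(1) u(2), of n] by simp
  then obtain w where w: "w \<in> carrier R" "\<And>n. proj n w = proj n (u n)"
    using limit_exists[of u] uc(1) by blast
  have wU: "w \<in> Units R" using unit[OF w(1)] w(2)[of 1] uc(2)[of 1] by simp
  let ?X = "K1_class R (mat_mult R A (?D w))"
  have X: "?X \<in> carrier (K1 R)" using A diag_at_GL[OF wU] cl by simp
  have "K1_completion_map p R ?X n = x n" for n
  proof -
    interpret h: ring_hom_ring R "Q n" "proj n" by (rule proj_hom)
    have unU: "u n \<in> Units R" using unit uc by blast
    have G: "mat_mult R A (?D w) \<in> carrier (GL R)" "mat_mult R A (?D (u n)) \<in> carrier (GL R)"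
      using A wU unU diag_at_GL cl by auto
    \<comment> \<open>The limit agrees with \<open>u n\<close> modulo p^n only, while
      \<open>u n\<close> is adjusted to level n + 1; the transition map bridges the two
      levels.\<close>
    have "map_mat (proj n) (mat_mult R A (?D w)) = map_mat (proj n) (mat_mult R A (?D (u n)))"
      using A(1) w uc by (simp add: h.map_mat_mult GL_Mat h.map_mat_diag_at)
    then have "K1_completion_map p R ?X n = ?cm (mat_mult R A (?D (u n))) n"
      using G by (simp add: completion_map_class)
    also have "\<dots> = ?t n (?cm (mat_mult R A (?D (u n))) (Suc n))"
      using completion_map_trans[OF K1_class_closed[OF G(2)], of p n] by simp
    also have "\<dots> = x n" by (simp add: uc xt)
    finally show ?thesis .
  qed
  then show ?thesis using X by blast
qed

text \<open>\<open>key\<close> isolates what completeness alone does not give: a unit of 1 +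
  \<open>P k\<close> whose class is represented in 1 + \<open>P n\<close> for every n must have
  trivial class. The quotient of two classes with equal image has this form. The parameter
  \<open>k\<close> is free so that the depth may depend on the group.\<close>

theorem completion_map_iso:
  assumes k: "k \<ge> 1"
    and key: "\<And>x. x \<in> P k \<Longrightarrow>
      (\<And>n. n \<ge> 1 \<Longrightarrow> \<exists>y\<in>P n. K1_class R (diag_at R 0 (\<one> \<oplus> x)) = K1_class R (diag_at R 0 (\<one> \<oplus> y))) \<Longrightarrow>
      K1_class R (diag_at R 0 (\<one> \<oplus> x)) = \<one>\<^bsub>K1 R\<^esub>"
  shows "K1_completion_map p R \<in> iso (K1 R) (completed_K1 p R)"
proof -
  interpret K: group "K1 R" by (rule group_K1)
  have "inj_on (K1_completion_map p R) (carrier (K1 R))"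
  proof (rule inj_onI)
    fix X Y assume XY: "X \<in> carrier (K1 R)" "Y \<in> carrier (K1 R)"
      and eq: "K1_completion_map p R X = K1_completion_map p R Y"
    define Z where "Z = X \<otimes>\<^bsub>K1 R\<^esub> inv\<^bsub>K1 R\<^esub> Y"
    have Z: "Z \<in> carrier (K1 R)" using XY by (simp add: Z_def)
    have "K1_completion_map p R Z n = \<one>\<^bsub>K1 (Q n)\<^esub>" for n
    proof -
      interpret h: group_hom "K1 R" "K1 (Q n)" "\<lambda>X. K1_completion_map p R X n"
        using completion_map_hom by (intro group_hom.intro group_hom_axioms.intro group_K1 ring.group_K1[OF ring_padic_quot])
      show ?thesis unfolding Z_def using XY eq by (simp add: h.H.r_inv h.hom_closed)
    qed
    then have *: "\<exists>y\<in>P n. Z = K1_class R (diag_at R 0 (\<one> \<oplus> y))" if "n \<ge> 1" for n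
      using completion_map_kernel[OF Z that] by blast
    then obtain x where x: "x \<in> P k" "Z = K1_class R (diag_at R 0 (\<one> \<oplus> x))" using k by blast
    have "Z = \<one>\<^bsub>K1 R\<^esub>" using key[OF x(1)] * x(2) by metis
    then show "X = Y" using XY unfolding Z_def by (metis K.inv_closed K.inv_equality K.inv_inv)
  qed
  moreover have "K1_completion_map p R ` carrier (K1 R) = carrier (completed_K1 p R)"
    using completion_map_surj hom_in_carrier[OF K1_completion_map_hom] by (metis (no_types, lifting) image_iff subsetI subset_antisym)
  ultimately show ?thesis using K1_completion_map_hom by (simp add: iso_def bij_betw_def)
qed

end

section \<open>Group rings\<close>

text \<open>Injectivity of the map to the inverse limit gives separatedness. A sequence as in
  \<open>cauchy\<close> defines a point of the limit, and surjectivity supplies its limit in the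
  ring.\<close>

lemma padically_completeD:
  fixes R (structure)
  assumes "ring R" "padically_complete p R"
  shows "padic_complete_ring R p"
proof -
  interpret ring R by fact
  let ?L = "inv_lim_ring (padic_quot p R) (padic_trans p R)"
  have bij: "bij_betw (\<lambda>x n. padic_proj p R n x) (carrier R) (carrier ?L)"
    using assms(2) by (simp add: padically_complete_def ring_iso_def)
  show ?thesis
  proof
    fix x assume x: "x \<in> carrier R" "\<And>n. x \<in> padic_ideal p R n"
    then have "padic_proj p R n x = padic_proj p R n \<zero>" for n
      by (simp add: padic_proj_eq_iff minus_eq)
    then have "(\<lambda>n. padic_proj p R n x) = (\<lambda>n. padic_proj p R n \<zero>)" by (rule ext)
    then show "x = \<zero>" using bij x(1) by (auto simp: bij_betw_def dest: inj_onD)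
  next
    fix f assume f: "\<And>n. f n \<in> carrier R" "\<And>n. f (Suc n) \<ominus> f n \<in> padic_ideal p R n"
    have "padic_proj p R n y \<in> carrier (padic_quot p R n)" if "y \<in> carrier R" for n y
      using that padic_proj_surj by blast
    then have "(\<lambda>n. padic_proj p R n (f n)) \<in> carrier ?L"
      using f by (simp add: inv_lim_ring_def inv_lim_set_def padic_trans_proj padic_proj_eq_iff)
    then obtain x where x: "x \<in> carrier R" "(\<lambda>n. padic_proj p R n (f n)) = (\<lambda>n. padic_proj p R n x)"
      using bij by (auto simp: bij_betw_def)
    have "x \<ominus> f n \<in> padic_ideal p R n" for n
      using fun_cong[OF x(2), of n] x(1) f(1) by (simp add: padic_proj_eq_iff[symmetric])
    then show "\<exists>x\<in>carrier R. \<forall>n. x \<ominus> f n \<in> padic_ideal p R n" using x(1) by blast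
  qed
qed

text \<open>The monomial with coefficient \<open>r\<close> at the group element
  \<open>g\<close>.\<close>

definition gmon :: "('a, 'm) ring_scheme \<Rightarrow> ('g, 'k) monoid_scheme \<Rightarrow> 'a \<Rightarrow> 'g \<Rightarrow> 'g \<Rightarrow> 'a" where
  "gmon R G r g = (\<lambda>x\<in>carrier G. if x = g then r else \<zero>\<^bsub>R\<^esub>)"

locale finite_group_ring = ring R + G: group G for R (structure) and G :: "('g, 'k) monoid_scheme" +
  assumes fin: "finite (carrier G)"
begin

abbreviation \<Lambda> :: "('g \<Rightarrow> 'a) ring" where "\<Lambda> \<equiv> group_ring R G"

lemma gr_carrier: "f \<in> carrier \<Lambda> \<longleftrightarrow> f \<in> carrier G \<rightarrow>\<^sub>E carrier R"
  by (simp add: group_ring_def)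

lemma gr_closed [simp]: "f \<in> carrier \<Lambda> \<Longrightarrow> x \<in> carrier G \<Longrightarrow> f x \<in> carrier R"
  by (auto simp: gr_carrier)

lemma gr_eqI: "f \<in> carrier \<Lambda> \<Longrightarrow> g \<in> carrier \<Lambda> \<Longrightarrow> (\<And>x. x \<in> carrier G \<Longrightarrow> f x = g x) \<Longrightarrow> f = g"
  unfolding gr_carrier by (rule PiE_ext)

lemma gr_restrict: "(\<And>x. x \<in> carrier G \<Longrightarrow> f x \<in> carrier R) \<Longrightarrow> (\<lambda>x\<in>carrier G. f x) \<in> carrier \<Lambda>"
  by (auto simp: gr_carrier)

lemma gr_add: "x \<in> carrier G \<Longrightarrow> (f \<oplus>\<^bsub>\<Lambda>\<^esub> g) x = f x \<oplus> g x"
  by (simp add: group_ring_def)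

lemma gr_mult: "x \<in> carrier G \<Longrightarrow> (f \<otimes>\<^bsub>\<Lambda>\<^esub> g) x = (\<Oplus>y\<in>carrier G. f y \<otimes> g (inv\<^bsub>G\<^esub> y \<otimes>\<^bsub>G\<^esub> x))"
  by (simp add: group_ring_def)

lemma gr_one: "x \<in> carrier G \<Longrightarrow> \<one>\<^bsub>\<Lambda>\<^esub> x = (if x = \<one>\<^bsub>G\<^esub> then \<one> else \<zero>)"
  by (simp add: group_ring_def)

lemma gr_zero: "x \<in> carrier G \<Longrightarrow> \<zero>\<^bsub>\<Lambda>\<^esub> x = \<zero>"
  by (simp add: group_ring_def)

lemma gr_add_closed: "f \<in> carrier \<Lambda> \<Longrightarrow> g \<in> carrier \<Lambda> \<Longrightarrow> f \<oplus>\<^bsub>\<Lambda>\<^esub> g \<in> carrier \<Lambda>"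
  unfolding group_ring_def by auto

lemma gr_mult_closed: "f \<in> carrier \<Lambda> \<Longrightarrow> g \<in> carrier \<Lambda> \<Longrightarrow> f \<otimes>\<^bsub>\<Lambda>\<^esub> g \<in> carrier \<Lambda>"
  unfolding group_ring_def by (auto intro!: finsum_closed simp: PiE_iff)

lemma gr_one_closed: "\<one>\<^bsub>\<Lambda>\<^esub> \<in> carrier \<Lambda>"
  unfolding group_ring_def by auto

lemma gr_zero_closed: "\<zero>\<^bsub>\<Lambda>\<^esub> \<in> carrier \<Lambda>"
  unfolding group_ring_def by auto

lemma finsum_translate:
  assumes "g \<in> carrier G" "f \<in> carrier G \<rightarrow> carrier R"
  shows "(\<Oplus>x\<in>carrier G. f (g \<otimes>\<^bsub>G\<^esub> x)) = (\<Oplus>x\<in>carrier G. f x)"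
proof -
  have "(\<lambda>x. g \<otimes>\<^bsub>G\<^esub> x) ` carrier G = carrier G"
    using assms(1) G.surj_const_mult by blast
  moreover have "inj_on (\<lambda>x. g \<otimes>\<^bsub>G\<^esub> x) (carrier G)"
    using assms(1) by (auto intro: inj_onI)
  ultimately show ?thesis
    using finsum_reindex[of f "\<lambda>x. g \<otimes>\<^bsub>G\<^esub> x" "carrier G"] assms(2) by simp
qed

lemma gr_mult_assoc:
  assumes f: "f \<in> carrier \<Lambda>" and g: "g \<in> carrier \<Lambda>" and h: "h \<in> carrier \<Lambda>"
  shows "f \<otimes>\<^bsub>\<Lambda>\<^esub> g \<otimes>\<^bsub>\<Lambda>\<^esub> h = f \<otimes>\<^bsub>\<Lambda>\<^esub> (g \<otimes>\<^bsub>\<Lambda>\<^esub> h)"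
proof (rule gr_eqI)
  fix x assume x: "x \<in> carrier G"
  have "(f \<otimes>\<^bsub>\<Lambda>\<^esub> g \<otimes>\<^bsub>\<Lambda>\<^esub> h) x =
    (\<Oplus>y\<in>carrier G. \<Oplus>z\<in>carrier G. f z \<otimes> g (inv\<^bsub>G\<^esub> z \<otimes>\<^bsub>G\<^esub> y) \<otimes> h (inv\<^bsub>G\<^esub> y \<otimes>\<^bsub>G\<^esub> x))"
    unfolding gr_mult[OF x] using assms x fin
    by (intro finsum_cong') (auto simp: gr_mult finsum_ldistr intro!: finsum_closed)
  also have "\<dots> = (\<Oplus>z\<in>carrier G. \<Oplus>y\<in>carrier G. f z \<otimes> g (inv\<^bsub>G\<^esub> z \<otimes>\<^bsub>G\<^esub> y) \<otimes> h (inv\<^bsub>G\<^esub> y \<otimes>\<^bsub>G\<^esub> x))"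
    using assms x fin by (intro finsum_swap) auto
  also have "\<dots> = (\<Oplus>z\<in>carrier G. f z \<otimes> (\<Oplus>w\<in>carrier G. g w \<otimes> h (inv\<^bsub>G\<^esub> w \<otimes>\<^bsub>G\<^esub> (inv\<^bsub>G\<^esub> z \<otimes>\<^bsub>G\<^esub> x))))"
  proof (intro finsum_cong' refl)
    fix z assume z: "z \<in> carrier G"
    \<comment> \<open>The inner sum is reindexed by y = zw.\<close>
    have "(\<Oplus>y\<in>carrier G. f z \<otimes> g (inv\<^bsub>G\<^esub> z \<otimes>\<^bsub>G\<^esub> y) \<otimes> h (inv\<^bsub>G\<^esub> y \<otimes>\<^bsub>G\<^esub> x)) =
      (\<Oplus>w\<in>carrier G. f z \<otimes> g (inv\<^bsub>G\<^esub> z \<otimes>\<^bsub>G\<^esub> (z \<otimes>\<^bsub>G\<^esub> w)) \<otimes> h (inv\<^bsub>G\<^esub> (z \<otimes>\<^bsub>G\<^esub> w) \<otimes>\<^bsub>G\<^esub> x))"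
      using assms x z by (intro finsum_translate[symmetric]) auto
    also have "\<dots> = (\<Oplus>w\<in>carrier G. f z \<otimes> (g w \<otimes> h (inv\<^bsub>G\<^esub> w \<otimes>\<^bsub>G\<^esub> (inv\<^bsub>G\<^esub> z \<otimes>\<^bsub>G\<^esub> x))))"
      using assms x z by (intro finsum_cong')
        (auto simp: m_assoc G.m_assoc[symmetric] G.inv_mult_group)
    also have "\<dots> = f z \<otimes> (\<Oplus>w\<in>carrier G. g w \<otimes> h (inv\<^bsub>G\<^esub> w \<otimes>\<^bsub>G\<^esub> (inv\<^bsub>G\<^esub> z \<otimes>\<^bsub>G\<^esub> x)))"
      using assms x z fin by (subst finsum_rdistr) auto
    finally show "(\<Oplus>y\<in>carrier G. f z \<otimes> g (inv\<^bsub>G\<^esub> z \<otimes>\<^bsub>G\<^esub> y) \<otimes> h (inv\<^bsub>G\<^esub> y \<otimes>\<^bsub>G\<^esub> x)) =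
      f z \<otimes> (\<Oplus>w\<in>carrier G. g w \<otimes> h (inv\<^bsub>G\<^esub> w \<otimes>\<^bsub>G\<^esub> (inv\<^bsub>G\<^esub> z \<otimes>\<^bsub>G\<^esub> x)))" .
  qed (use assms x in \<open>auto intro!: finsum_closed\<close>)
  also have "\<dots> = (f \<otimes>\<^bsub>\<Lambda>\<^esub> (g \<otimes>\<^bsub>\<Lambda>\<^esub> h)) x"
    unfolding gr_mult[OF x] using assms x
    by (intro finsum_cong') (auto simp: gr_mult intro!: finsum_closed)
  finally show "(f \<otimes>\<^bsub>\<Lambda>\<^esub> g \<otimes>\<^bsub>\<Lambda>\<^esub> h) x = (f \<otimes>\<^bsub>\<Lambda>\<^esub> (g \<otimes>\<^bsub>\<Lambda>\<^esub> h)) x" .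
qed (use assms gr_mult_closed in auto)

lemma gmon_closed [simp]: "r \<in> carrier R \<Longrightarrow> gmon R G r g \<in> carrier \<Lambda>"
  unfolding gmon_def by (rule gr_restrict) auto

lemma gmon_mult:
  assumes "r \<in> carrier R" "g \<in> carrier G" "f \<in> carrier \<Lambda>" "x \<in> carrier G"
  shows "(gmon R G r g \<otimes>\<^bsub>\<Lambda>\<^esub> f) x = r \<otimes> f (inv\<^bsub>G\<^esub> g \<otimes>\<^bsub>G\<^esub> x)"
  unfolding gr_mult[OF assms(4)] using assms fin
  by (subst finsum_single[where k = g]) (auto simp: gmon_def)

lemma mult_gmon:
  assumes "r \<in> carrier R" "g \<in> carrier G" "f \<in> carrier \<Lambda>" "x \<in> carrier G"
  shows "(f \<otimes>\<^bsub>\<Lambda>\<^esub> gmon R G r g) x = f (x \<otimes>\<^bsub>G\<^esub> inv\<^bsub>G\<^esub> g) \<otimes> r"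
proof -
  have "inv\<^bsub>G\<^esub> (x \<otimes>\<^bsub>G\<^esub> inv\<^bsub>G\<^esub> g) \<otimes>\<^bsub>G\<^esub> x = g"
    using assms by (simp add: G.inv_mult_group G.m_assoc)
  moreover have "inv\<^bsub>G\<^esub> y \<otimes>\<^bsub>G\<^esub> x \<noteq> g" if "y \<in> carrier G" "y \<noteq> x \<otimes>\<^bsub>G\<^esub> inv\<^bsub>G\<^esub> g" for y
    using assms that by (metis G.inv_closed G.inv_solve_left G.inv_solve_right G.m_closed)
  ultimately show ?thesis
    unfolding gr_mult[OF assms(4)] using assms fin
    by (subst finsum_single[where k = "x \<otimes>\<^bsub>G\<^esub> inv\<^bsub>G\<^esub> g"]) (auto simp: gmon_def)
qed

lemma gr_one_gmon: "\<one>\<^bsub>\<Lambda>\<^esub> = gmon R G \<one> \<one>\<^bsub>G\<^esub>"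
  by (simp add: gmon_def group_ring_def)

lemma ring_group_ring: "ring \<Lambda>"
proof (rule ringI)
  show "abelian_group \<Lambda>"
  proof (rule abelian_groupI)
    fix f assume f: "f \<in> carrier \<Lambda>"
    have "(\<lambda>x\<in>carrier G. \<ominus> f x) \<oplus>\<^bsub>\<Lambda>\<^esub> f = \<zero>\<^bsub>\<Lambda>\<^esub>"
      using f by (intro gr_eqI gr_add_closed gr_restrict gr_zero_closed) (auto simp: gr_add gr_zero l_neg)
    then show "\<exists>g\<in>carrier \<Lambda>. g \<oplus>\<^bsub>\<Lambda>\<^esub> f = \<zero>\<^bsub>\<Lambda>\<^esub>"
      using f gr_restrict[of "\<lambda>x. \<ominus> f x"] by auto
  next
    fix f g h assume c: "f \<in> carrier \<Lambda>" "g \<in> carrier \<Lambda>" "h \<in> carrier \<Lambda>"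
    then show "f \<oplus>\<^bsub>\<Lambda>\<^esub> g \<oplus>\<^bsub>\<Lambda>\<^esub> h = f \<oplus>\<^bsub>\<Lambda>\<^esub> (g \<oplus>\<^bsub>\<Lambda>\<^esub> h)"
      by (intro gr_eqI gr_add_closed) (auto simp: gr_add a_assoc)
  next
    fix f g assume c: "f \<in> carrier \<Lambda>" "g \<in> carrier \<Lambda>"
    then show "f \<oplus>\<^bsub>\<Lambda>\<^esub> g = g \<oplus>\<^bsub>\<Lambda>\<^esub> f"
      by (intro gr_eqI gr_add_closed) (auto simp: gr_add a_comm)
  next
    fix f assume c: "f \<in> carrier \<Lambda>"
    then show "\<zero>\<^bsub>\<Lambda>\<^esub> \<oplus>\<^bsub>\<Lambda>\<^esub> f = f"
      by (intro gr_eqI gr_add_closed gr_zero_closed) (auto simp: gr_add gr_zero)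
  qed (auto intro: gr_add_closed gr_zero_closed)
next
  show "monoid \<Lambda>"
  proof (rule monoidI)
    fix f assume f: "f \<in> carrier \<Lambda>"
    show "\<one>\<^bsub>\<Lambda>\<^esub> \<otimes>\<^bsub>\<Lambda>\<^esub> f = f"
      using f by (intro gr_eqI gr_mult_closed gr_one_closed) (auto simp: gr_one_gmon gmon_mult)
    show "f \<otimes>\<^bsub>\<Lambda>\<^esub> \<one>\<^bsub>\<Lambda>\<^esub> = f"
      using f by (intro gr_eqI gr_mult_closed gr_one_closed) (auto simp: gr_one_gmon mult_gmon)
  qed (auto intro: gr_mult_closed gr_one_closed gr_mult_assoc)
next
  fix f g h assume c: "f \<in> carrier \<Lambda>" "g \<in> carrier \<Lambda>" "h \<in> carrier \<Lambda>"
  show "(f \<oplus>\<^bsub>\<Lambda>\<^esub> g) \<otimes>\<^bsub>\<Lambda>\<^esub> h = f \<otimes>\<^bsub>\<Lambda>\<^esub> h \<oplus>\<^bsub>\<Lambda>\<^esub> g \<otimes>\<^bsub>\<Lambda>\<^esub> h"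
  proof (intro gr_eqI gr_add_closed gr_mult_closed c)
    fix x assume x: "x \<in> carrier G"
    have "((f \<oplus>\<^bsub>\<Lambda>\<^esub> g) \<otimes>\<^bsub>\<Lambda>\<^esub> h) x =
      (\<Oplus>y\<in>carrier G. f y \<otimes> h (inv\<^bsub>G\<^esub> y \<otimes>\<^bsub>G\<^esub> x) \<oplus> g y \<otimes> h (inv\<^bsub>G\<^esub> y \<otimes>\<^bsub>G\<^esub> x))"
      unfolding gr_mult[OF x] using c x by (intro finsum_cong') (auto simp: gr_add l_distr)
    also have "\<dots> = (f \<otimes>\<^bsub>\<Lambda>\<^esub> h \<oplus>\<^bsub>\<Lambda>\<^esub> g \<otimes>\<^bsub>\<Lambda>\<^esub> h) x"
      using c x by (subst finsum_addf) (auto simp: gr_add gr_mult)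
    finally show "((f \<oplus>\<^bsub>\<Lambda>\<^esub> g) \<otimes>\<^bsub>\<Lambda>\<^esub> h) x = (f \<otimes>\<^bsub>\<Lambda>\<^esub> h \<oplus>\<^bsub>\<Lambda>\<^esub> g \<otimes>\<^bsub>\<Lambda>\<^esub> h) x" .
  qed
  show "h \<otimes>\<^bsub>\<Lambda>\<^esub> (f \<oplus>\<^bsub>\<Lambda>\<^esub> g) = h \<otimes>\<^bsub>\<Lambda>\<^esub> f \<oplus>\<^bsub>\<Lambda>\<^esub> h \<otimes>\<^bsub>\<Lambda>\<^esub> g"
  proof (intro gr_eqI gr_add_closed gr_mult_closed c)
    fix x assume x: "x \<in> carrier G"
    have "(h \<otimes>\<^bsub>\<Lambda>\<^esub> (f \<oplus>\<^bsub>\<Lambda>\<^esub> g)) x =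
      (\<Oplus>y\<in>carrier G. h y \<otimes> f (inv\<^bsub>G\<^esub> y \<otimes>\<^bsub>G\<^esub> x) \<oplus> h y \<otimes> g (inv\<^bsub>G\<^esub> y \<otimes>\<^bsub>G\<^esub> x))"
      unfolding gr_mult[OF x] using c x by (intro finsum_cong') (auto simp: gr_add r_distr)
    also have "\<dots> = (h \<otimes>\<^bsub>\<Lambda>\<^esub> f \<oplus>\<^bsub>\<Lambda>\<^esub> h \<otimes>\<^bsub>\<Lambda>\<^esub> g) x"
      using c x by (subst finsum_addf) (auto simp: gr_add gr_mult)
    finally show "(h \<otimes>\<^bsub>\<Lambda>\<^esub> (f \<oplus>\<^bsub>\<Lambda>\<^esub> g)) x = (h \<otimes>\<^bsub>\<Lambda>\<^esub> f \<oplus>\<^bsub>\<Lambda>\<^esub> h \<otimes>\<^bsub>\<Lambda>\<^esub> g) x" .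
  qed
qed

sublocale \<Lambda>: ring \<Lambda> by (rule ring_group_ring)

lemma gr_a_inv: "f \<in> carrier \<Lambda> \<Longrightarrow> x \<in> carrier G \<Longrightarrow> (\<ominus>\<^bsub>\<Lambda>\<^esub> f) x = \<ominus> f x"
proof -
  assume f: "f \<in> carrier \<Lambda>" and x: "x \<in> carrier G"
  have "(\<ominus>\<^bsub>\<Lambda>\<^esub> f \<oplus>\<^bsub>\<Lambda>\<^esub> f) x = \<zero>" using f x by (simp add: \<Lambda>.l_neg gr_zero)
  then have "(\<ominus>\<^bsub>\<Lambda>\<^esub> f) x \<oplus> f x = \<zero>" using x by (simp add: gr_add)
  then show ?thesis using f x minus_equality by simp
qed

lemma gr_minus: "f \<in> carrier \<Lambda> \<Longrightarrow> g \<in> carrier \<Lambda> \<Longrightarrow> x \<in> carrier G \<Longrightarrow> (f \<ominus>\<^bsub>\<Lambda>\<^esub> g) x = f x \<ominus> g x"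
  by (simp add: \<Lambda>.minus_eq minus_eq gr_add gr_a_inv)

lemma gr_add_pow: "f \<in> carrier \<Lambda> \<Longrightarrow> x \<in> carrier G \<Longrightarrow> ([(k::nat)] \<cdot>\<^bsub>\<Lambda>\<^esub> f) x = [k] \<cdot> f x"
  by (induction k) (simp_all add: gr_zero gr_add)

lemma gr_finsum:
  assumes "\<And>i. i \<in> A \<Longrightarrow> f i \<in> carrier \<Lambda>" "x \<in> carrier G"
  shows "(\<Oplus>\<^bsub>\<Lambda>\<^esub>i\<in>A. f i) x = (\<Oplus>i\<in>A. f i x)"
  using assms(1)
proof (induction A rule: infinite_finite_induct)
  case (insert i A)
  then have "(\<Oplus>\<^bsub>\<Lambda>\<^esub>i\<in>insert i A. f i) x = f i x \<oplus> (\<Oplus>\<^bsub>\<Lambda>\<^esub>i\<in>A. f i) x"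
    using assms(2) by (subst \<Lambda>.finsum_insert) (auto simp: gr_add)
  also have "\<dots> = (\<Oplus>i\<in>insert i A. f i x)"
    using insert assms(2) by (subst finsum_insert) auto
  finally show ?case .
qed (use assms(2) in \<open>auto simp: gr_zero\<close>)

lemma gr_padic_ideal:
  "f \<in> padic_ideal p \<Lambda> n \<longleftrightarrow> f \<in> carrier \<Lambda> \<and> (\<forall>x\<in>carrier G. f x \<in> padic_ideal p R n)"
proof
  assume "f \<in> padic_ideal p \<Lambda> n"
  then obtain g where "g \<in> carrier \<Lambda>" "f = [(p ^ n)] \<cdot>\<^bsub>\<Lambda>\<^esub> g" by (rule \<Lambda>.padic_idealE)
  then show "f \<in> carrier \<Lambda> \<and> (\<forall>x\<in>carrier G. f x \<in> padic_ideal p R n)"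
    by (simp add: gr_add_pow padic_idealI)
next
  assume f: "f \<in> carrier \<Lambda> \<and> (\<forall>x\<in>carrier G. f x \<in> padic_ideal p R n)"
  then have "\<forall>x\<in>carrier G. \<exists>y\<in>carrier R. f x = [(p ^ n)] \<cdot> y" by (auto simp: padic_ideal_eq)
  then obtain g where g: "\<And>x. x \<in> carrier G \<Longrightarrow> g x \<in> carrier R"
    "\<And>x. x \<in> carrier G \<Longrightarrow> f x = [(p ^ n)] \<cdot> g x" by metis
  have c: "(\<lambda>x\<in>carrier G. g x) \<in> carrier \<Lambda>" using g(1) by (rule gr_restrict)
  have "f = [(p ^ n)] \<cdot>\<^bsub>\<Lambda>\<^esub> (\<lambda>x\<in>carrier G. g x)"
    using f c g by (intro gr_eqI) (auto simp: gr_add_pow)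
  then show "f \<in> padic_ideal p \<Lambda> n" using c \<Lambda>.padic_idealI by metis
qed

text \<open>Divisibility by p^n in the group ring is divisibility of every coefficient, so
  separatedness and limits are inherited coefficientwise.\<close>

lemma padic_complete_group_ring:
  assumes "padic_complete_ring R p"
  shows "padic_complete_ring \<Lambda> p"
proof -
  interpret c: padic_complete_ring R p by fact
  show ?thesis
  proof
    fix f assume f: "f \<in> carrier \<Lambda>" "\<And>n. f \<in> padic_ideal p \<Lambda> n"
    show "f = \<zero>\<^bsub>\<Lambda>\<^esub>"
    proof (rule gr_eqI)
      fix x assume x: "x \<in> carrier G"
      then show "f x = \<zero>\<^bsub>\<Lambda>\<^esub> x" using f by (auto simp: gr_zero gr_padic_ideal intro: c.separated)
    qed (use f in auto)
  next
    fix f assume f: "\<And>n. f n \<in> carrier \<Lambda>" "\<And>n. f (Suc n) \<ominus>\<^bsub>\<Lambda>\<^esub> f n \<in> padic_ideal p \<Lambda> n"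
    have "\<exists>y\<in>carrier R. \<forall>n. y \<ominus> f n x \<in> padic_ideal p R n" if x: "x \<in> carrier G" for x
    proof (rule c.cauchy)
      fix n show "f (Suc n) x \<ominus> f n x \<in> padic_ideal p R n"
        using f(2)[of n] x f(1) by (simp add: gr_padic_ideal gr_minus)
    qed (use f x in auto)
    then obtain g where g: "\<And>x. x \<in> carrier G \<Longrightarrow> g x \<in> carrier R"
      "\<And>x n. x \<in> carrier G \<Longrightarrow> g x \<ominus> f n x \<in> padic_ideal p R n" by metis
    have c: "(\<lambda>x\<in>carrier G. g x) \<in> carrier \<Lambda>" using g(1) by (rule gr_restrict)
    then have "(\<lambda>x\<in>carrier G. g x) \<ominus>\<^bsub>\<Lambda>\<^esub> f n \<in> padic_ideal p \<Lambda> n" for n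
      using f g by (auto simp: gr_padic_ideal gr_minus)
    then show "\<exists>g\<in>carrier \<Lambda>. \<forall>n. g \<ominus>\<^bsub>\<Lambda>\<^esub> f n \<in> padic_ideal p \<Lambda> n" using c by blast
  qed
qed

lemma cring_group_ring:
  assumes R: "cring R" and "comm_group G"
  shows "cring \<Lambda>"
proof -
  interpret R: cring R by fact
  interpret C: comm_group G by fact
  have "f \<otimes>\<^bsub>\<Lambda>\<^esub> g = g \<otimes>\<^bsub>\<Lambda>\<^esub> f" if c: "f \<in> carrier \<Lambda>" "g \<in> carrier \<Lambda>" for f g
  proof (intro gr_eqI gr_mult_closed c)
    fix x assume x: "x \<in> carrier G"
    let ?h = "\<lambda>y. inv\<^bsub>G\<^esub> y \<otimes>\<^bsub>G\<^esub> x"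
    \<comment> \<open>In an abelian group the map sending y to the inverse of y times x is an
      involution; reindexing by it exchanges the two factors of the convolution.\<close>
    have inv: "?h (?h y) = y" if "y \<in> carrier G" for y
      using that x C.m_lcomm[of x y "inv\<^bsub>G\<^esub> x"]
      by (simp add: G.inv_mult_group G.m_assoc G.r_inv C.m_comm[of "inv\<^bsub>G\<^esub> x"])
    have cl: "?h y \<in> carrier G" if "y \<in> carrier G" for y using that x by simp
    have "?h ` carrier G = carrier G"
    proof (intro equalityI subsetI)
      fix y assume "y \<in> carrier G"
      then show "y \<in> ?h ` carrier G" using inv[of y] cl[of y] by (intro image_eqI[of _ _ "?h y"]) auto
    qed (use cl in auto)
    moreover have "inj_on ?h (carrier G)" by (rule inj_on_inverseI[of _ ?h]) (rule inv)
    ultimately have "(\<Oplus>y\<in>carrier G. g y \<otimes> f (?h y)) = (\<Oplus>y\<in>carrier G. g (?h y) \<otimes> f (?h (?h y)))"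
      using finsum_reindex[of "\<lambda>y. g y \<otimes> f (?h y)" ?h "carrier G"] c x by auto
    also have "\<dots> = (\<Oplus>y\<in>carrier G. f y \<otimes> g (?h y))"
      using c x by (intro finsum_cong') (auto simp: inv R.m_comm)
    finally show "(f \<otimes>\<^bsub>\<Lambda>\<^esub> g) x = (g \<otimes>\<^bsub>\<Lambda>\<^esub> f) x" by (simp add: gr_mult x)
  qed
  then show ?thesis
    by (intro cring.intro ring_group_ring comm_monoid.intro comm_monoid_axioms.intro \<Lambda>.is_monoid)
qed

end

text \<open>The n-fold sum of 1 in the fraction field is the class of (n 1, 1), so it would vanish
  if n 1 vanished in the domain.\<close>

lemma (in domain) char_zero_fraction_field:
  assumes "char_zero (fraction_field R)" "(n::nat) > 0"
  shows "[n] \<cdot> \<one> \<noteq> \<zero>"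
proof -
  let ?D = "carrier R \<times> (carrier R - {\<zero>})"
  \<comment> \<open>Multiplying by d, replacing ad by cb and cancelling b turns one cross relation
    into the other; cancellation uses the domain property.\<close>
  have eq: "frac_rel R `` {(a, b)} = frac_rel R `` {(c, d)}"
    if "a \<in> carrier R" "b \<in> carrier R - {\<zero>}" "c \<in> carrier R" "d \<in> carrier R - {\<zero>}" "a \<otimes> d = c \<otimes> b" for a b c d
  proof -
    have *: "a \<otimes> f = e \<otimes> b \<longleftrightarrow> c \<otimes> f = e \<otimes> d" if ef: "e \<in> carrier R" "f \<in> carrier R" for e f
    proof -
      have "a \<otimes> f = e \<otimes> b \<longleftrightarrow> d \<otimes> (a \<otimes> f) = d \<otimes> (e \<otimes> b)"
        using \<open>d \<in> _\<close> ef \<open>a \<in> _\<close> \<open>b \<in> _\<close> m_lcancel[of d] by auto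
      also have "d \<otimes> (a \<otimes> f) = b \<otimes> (c \<otimes> f)"
        using that ef \<open>a \<otimes> d = _\<close> by (metis (no_types, lifting) DiffD1 \<open>a \<in> _\<close> \<open>b \<in> _\<close> \<open>c \<in> _\<close> \<open>d \<in> _\<close> m_assoc m_comm)
      also have "d \<otimes> (e \<otimes> b) = b \<otimes> (e \<otimes> d)"
        using ef \<open>b \<in> _\<close> \<open>d \<in> _\<close> by (simp add: m_ac)
      finally show ?thesis using \<open>b \<in> _\<close> ef \<open>c \<in> _\<close> \<open>d \<in> _\<close> m_lcancel[of b] by auto
    qed
    show ?thesis using that * by (auto simp: frac_rel_def)
  qed
  \<comment> \<open>The field addition is a union over all pairs of representatives; each pair gives
    the same class, and both classes are nonempty.\<close>
  have add: "frac_rel R `` {(a, \<one>)} \<oplus>\<^bsub>fraction_field R\<^esub> frac_rel R `` {(b, \<one>)} = frac_rel R `` {(a \<oplus> b, \<one>)}"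
    if ab: "a \<in> carrier R" "b \<in> carrier R" for a b
  proof -
    have *: "frac_rel R `` {((x \<otimes> w) \<oplus> (z \<otimes> y), y \<otimes> w)} = frac_rel R `` {(a \<oplus> b, \<one>)}"
      if "((a, \<one>), (x, y)) \<in> frac_rel R" "((b, \<one>), (z, w)) \<in> frac_rel R" for x y z w
    proof (rule eq)
      have c: "x \<in> carrier R" "y \<in> carrier R - {\<zero>}" "z \<in> carrier R" "w \<in> carrier R - {\<zero>}"
        and xz: "a \<otimes> y = x" "b \<otimes> w = z"
        using that by (auto simp: frac_rel_def)
      show "(x \<otimes> w \<oplus> z \<otimes> y) \<otimes> \<one> = (a \<oplus> b) \<otimes> (y \<otimes> w)"
        unfolding xz[symmetric] using ab c by (simp add: l_distr r_distr m_ac)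
      show "y \<otimes> w \<in> carrier R - {\<zero>}" using c integral by blast
    qed (use that ab in \<open>auto simp: frac_rel_def\<close>)
    have ne: "((a, \<one>), (a, \<one>)) \<in> frac_rel R" "((b, \<one>), (b, \<one>)) \<in> frac_rel R"
      using ab by (auto simp: frac_rel_def)
    have "frac_rel R `` {(a, \<one>)} \<oplus>\<^bsub>fraction_field R\<^esub> frac_rel R `` {(b, \<one>)} =
      (\<Union>u\<in>frac_rel R `` {(a, \<one>)}. \<Union>v\<in>frac_rel R `` {(b, \<one>)}.
        frac_rel R `` {((fst u \<otimes> snd v) \<oplus> (fst v \<otimes> snd u), snd u \<otimes> snd v)})"
      by (simp add: fraction_field_def case_prod_beta')
    also have "\<dots> = (\<Union>u\<in>frac_rel R `` {(a, \<one>)}. \<Union>v\<in>frac_rel R `` {(b, \<one>)}. frac_rel R `` {(a \<oplus> b, \<one>)})"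
      using * by (intro SUP_cong refl) auto
    also have "\<dots> = frac_rel R `` {(a \<oplus> b, \<one>)}" using ne by blast
    finally show ?thesis .
  qed
  have "[m] \<cdot>\<^bsub>fraction_field R\<^esub> \<one>\<^bsub>fraction_field R\<^esub> = frac_rel R `` {([m] \<cdot> \<one>, \<one>)}" for m :: nat
  proof (induction m)
    case 0
    then show ?case by (simp add: fraction_field_def add_pow_def)
  next
    case (Suc m)
    have "[Suc m] \<cdot>\<^bsub>fraction_field R\<^esub> \<one>\<^bsub>fraction_field R\<^esub> =
      [m] \<cdot>\<^bsub>fraction_field R\<^esub> \<one>\<^bsub>fraction_field R\<^esub> \<oplus>\<^bsub>fraction_field R\<^esub> \<one>\<^bsub>fraction_field R\<^esub>"
      by (simp add: add_pow_def)
    also have "\<dots> = frac_rel R `` {([m] \<cdot> \<one>, \<one>)} \<oplus>\<^bsub>fraction_field R\<^esub> frac_rel R `` {(\<one>, \<one>)}"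
      unfolding Suc by (simp add: fraction_field_def)
    finally show ?case using add by simp
  qed
  moreover have "\<zero>\<^bsub>fraction_field R\<^esub> = frac_rel R `` {(\<zero>, \<one>)}" by (simp add: fraction_field_def)
  ultimately show ?thesis using assms unfolding char_zero_def by metis
qed

section \<open>Determinants over commutative rings\<close>

datatype 'a cterm = CVar 'a | CZero | COne | CNeg "'a cterm" | CAdd "'a cterm" "'a cterm" | CMul "'a cterm" "'a cterm"

inductive ceq :: "'a cterm \<Rightarrow> 'a cterm \<Rightarrow> bool" where
  ceq_refl: "ceq s s"
| ceq_sym: "ceq s t \<Longrightarrow> ceq t s"
| ceq_trans: "ceq s t \<Longrightarrow> ceq t u \<Longrightarrow> ceq s u"
| ceq_neg: "ceq s t \<Longrightarrow> ceq (CNeg s) (CNeg t)"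
| ceq_add: "ceq s t \<Longrightarrow> ceq s' t' \<Longrightarrow> ceq (CAdd s s') (CAdd t t')"
| ceq_mul: "ceq s t \<Longrightarrow> ceq s' t' \<Longrightarrow> ceq (CMul s s') (CMul t t')"
| ceq_add_assoc: "ceq (CAdd (CAdd s t) u) (CAdd s (CAdd t u))"
| ceq_add_comm: "ceq (CAdd s t) (CAdd t s)"
| ceq_add_zero: "ceq (CAdd CZero s) s"
| ceq_add_neg: "ceq (CAdd (CNeg s) s) CZero"
| ceq_mul_assoc: "ceq (CMul (CMul s t) u) (CMul s (CMul t u))"
| ceq_mul_comm: "ceq (CMul s t) (CMul t s)"
| ceq_mul_one: "ceq (CMul COne s) s"
| ceq_distrib: "ceq (CMul (CAdd s t) u) (CAdd (CMul s u) (CMul t u))"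

text \<open>Variables outside the carrier are sent to zero, so evaluation always lands in the
  carrier and respects \<open>ceq\<close> without side conditions.\<close>

primrec cterm_eval :: "('a, 'm) ring_scheme \<Rightarrow> 'a cterm \<Rightarrow> 'a" where
  "cterm_eval R (CVar a) = (if a \<in> carrier R then a else \<zero>\<^bsub>R\<^esub>)"
| "cterm_eval R CZero = \<zero>\<^bsub>R\<^esub>"
| "cterm_eval R COne = \<one>\<^bsub>R\<^esub>"
| "cterm_eval R (CNeg s) = \<ominus>\<^bsub>R\<^esub> cterm_eval R s"
| "cterm_eval R (CAdd s t) = cterm_eval R s \<oplus>\<^bsub>R\<^esub> cterm_eval R t"
| "cterm_eval R (CMul s t) = cterm_eval R s \<otimes>\<^bsub>R\<^esub> cterm_eval R t"

text \<open>Integer evaluation with all variables zero; it separates 0 from 1 in the free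
  ring.\<close>

primrec cterm_int :: "'a cterm \<Rightarrow> int" where
  "cterm_int (CVar a) = 0"
| "cterm_int CZero = 0"
| "cterm_int COne = 1"
| "cterm_int (CNeg s) = - cterm_int s"
| "cterm_int (CAdd s t) = cterm_int s + cterm_int t"
| "cterm_int (CMul s t) = cterm_int s * cterm_int t"

lemma ceq_cterm_int: "ceq s t \<Longrightarrow> cterm_int s = cterm_int t"
  by (induction rule: ceq.induct) (auto simp: algebra_simps)

text \<open>The free commutative ring on \<open>'a\<close>: identities proved for the type class
  \<^class>\<open>comm_ring_1\<close> descend from it to every \<^locale>\<open>cring\<close> with elements of type \<open>'a\<close>.\<close>

quotient_type 'a free_cring = "'a cterm" / ceq
  by (intro equivpI reflpI sympI transpI) (blast intro: ceq.intros)+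

instantiation free_cring :: (type) comm_ring_1
begin

lift_definition zero_free_cring :: "'a free_cring" is CZero .
lift_definition one_free_cring :: "'a free_cring" is COne .
lift_definition uminus_free_cring :: "'a free_cring \<Rightarrow> 'a free_cring" is CNeg by (rule ceq_neg)
lift_definition plus_free_cring :: "'a free_cring \<Rightarrow> 'a free_cring \<Rightarrow> 'a free_cring" is CAdd by (rule ceq_add)
lift_definition times_free_cring :: "'a free_cring \<Rightarrow> 'a free_cring \<Rightarrow> 'a free_cring" is CMul by (rule ceq_mul)
lift_definition minus_free_cring :: "'a free_cring \<Rightarrow> 'a free_cring \<Rightarrow> 'a free_cring" is "\<lambda>s t. CAdd s (CNeg t)"
  by (intro ceq_add ceq_neg)

instance
proof
  fix a b c :: "'a free_cring"
  show "a + b + c = a + (b + c)" by transfer (rule ceq_add_assoc)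
  show "a + b = b + a" by transfer (rule ceq_add_comm)
  show "0 + a = a" by transfer (rule ceq_add_zero)
  show "- a + a = 0" by transfer (rule ceq_add_neg)
  show "a - b = a + - b" by transfer (rule ceq_refl)
  show "a * b * c = a * (b * c)" by transfer (rule ceq_mul_assoc)
  show "a * b = b * a" by transfer (rule ceq_mul_comm)
  show "1 * a = a" by transfer (rule ceq_mul_one)
  show "(a + b) * c = a * c + b * c" by transfer (rule ceq_distrib)
  show "(0 :: 'a free_cring) \<noteq> 1" by transfer (use ceq_cterm_int in force)
qed

end

lift_definition fc_var :: "'a \<Rightarrow> 'a free_cring" is CVar .

definition fc_eval :: "('a, 'm) ring_scheme \<Rightarrow> 'a free_cring \<Rightarrow> 'a" where
  "fc_eval R x = cterm_eval R (rep_free_cring x)"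

lemma permutes_upt_less: "p permutes {0..<n::nat} \<Longrightarrow> i < n \<Longrightarrow> p i < n"
  using permutes_in_image[of p "{0..<n}" i] by simp

text \<open>The determinant is formed over the free commutative ring, with the entries as variables,
  and then evaluated.\<close>

definition rdet :: "('a, 'm) ring_scheme \<Rightarrow> nat \<Rightarrow> (nat \<Rightarrow> nat \<Rightarrow> 'a) \<Rightarrow> 'a" where
  "rdet R n A = fc_eval R (det (mat n n (\<lambda>(i, j). fc_var (A i j))))"

section \<open>Evaluation of the free ring in a \<open>cring\<close> and laws of its
  determinant\<close>

context cring
begin

lemma cterm_eval_closed [simp]: "cterm_eval R s \<in> carrier R"
  by (induction s) auto

lemma ceq_cterm_eval: "ceq s t \<Longrightarrow> cterm_eval R s = cterm_eval R t"
  by (induction rule: ceq.induct) (simp_all add: a_assoc m_assoc l_neg l_distr, simp_all add: a_comm m_comm)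

lemma fc_eval_abs: "fc_eval R (abs_free_cring s) = cterm_eval R s"
  unfolding fc_eval_def
  by (rule ceq_cterm_eval) (metis Quotient_free_cring Quotient_rep_abs ceq_refl)

lemma fc_cases: "\<exists>s. x = abs_free_cring s"
  by (metis Quotient_abs_rep Quotient_free_cring)

lemma fc_eval_closed [simp]: "fc_eval R x \<in> carrier R"
  by (simp add: fc_eval_def)

lemma fc_eval_zero [simp]: "fc_eval R 0 = \<zero>"
  by (simp add: zero_free_cring.abs_eq fc_eval_abs)

lemma fc_eval_one [simp]: "fc_eval R 1 = \<one>"
  by (simp add: one_free_cring.abs_eq fc_eval_abs)

lemma fc_eval_add [simp]: "fc_eval R (x + y) = fc_eval R x \<oplus> fc_eval R y"
proof -
  obtain s t where "x = abs_free_cring s" "y = abs_free_cring t" using fc_cases by metis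
  then show ?thesis by (simp add: plus_free_cring.abs_eq fc_eval_abs)
qed

lemma fc_eval_mult [simp]: "fc_eval R (x * y) = fc_eval R x \<otimes> fc_eval R y"
proof -
  obtain s t where "x = abs_free_cring s" "y = abs_free_cring t" using fc_cases by metis
  then show ?thesis by (simp add: times_free_cring.abs_eq fc_eval_abs)
qed

lemma fc_eval_var [simp]: "a \<in> carrier R \<Longrightarrow> fc_eval R (fc_var a) = a"
  by (simp add: fc_var.abs_eq fc_eval_abs)

lemma fc_eval_sum: "fc_eval R (sum f A) = (\<Oplus>i\<in>A. fc_eval R (f i))"
  by (induction A rule: infinite_finite_induct) auto

lemma fc_eval_of_nat: "fc_eval R (of_nat k * x) = [k] \<cdot> fc_eval R x"
proof (induction k)
  case (Suc k)
  then show ?case by (simp add: distrib_right a_comm del: fc_eval_mult)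
qed (simp del: fc_eval_mult)

lemma fc_eval_prod_cong:
  "(\<And>i. i \<in> A \<Longrightarrow> fc_eval R (f i) = fc_eval R (g i)) \<Longrightarrow> fc_eval R (prod f A) = fc_eval R (prod g A)"
  by (induction A rule: infinite_finite_induct) auto

lemma fc_eval_sum_cong:
  "(\<And>i. i \<in> A \<Longrightarrow> fc_eval R (f i) = fc_eval R (g i)) \<Longrightarrow> fc_eval R (sum f A) = fc_eval R (sum g A)"
  by (induction A rule: infinite_finite_induct) auto

text \<open>The determinant is a polynomial in the entries, so any lift of the entries to the free
  ring gives the same value. This freedom allows lifts that keep a shape, such as triangular or 1 +
  qX, which independent variables would hide.\<close>

lemma fc_eval_det:
  assumes "\<And>i j. i < n \<Longrightarrow> j < n \<Longrightarrow> fc_eval R (M i j) = A i j"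
  shows "fc_eval R (det (mat n n (\<lambda>(i, j). M i j))) = rdet R n A"
proof -
  have "fc_eval R (signof p * (\<Prod>i = 0..<n. M i (p i))) = fc_eval R (signof p * (\<Prod>i = 0..<n. fc_var (A i (p i))))"
    if p: "p permutes {0..<n}" for p
  proof -
    have "fc_eval R (M i (p i)) = fc_eval R (fc_var (A i (p i)))" if "i < n" for i
    proof -
      have "p i < n" using p that by (rule permutes_upt_less)
      then have "fc_eval R (M i (p i)) = A i (p i)" using assms that by simp
      then show ?thesis using fc_eval_closed[of "M i (p i)"] by simp
    qed
    then show ?thesis unfolding fc_eval_mult
      by (intro arg_cong2[where f = "(\<otimes>)"] refl fc_eval_prod_cong) auto
  qed
  then have "fc_eval R (\<Sum>p\<in>{p. p permutes {0..<n}}. signof p * (\<Prod>i = 0..<n. M i (p i))) =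
    fc_eval R (\<Sum>p\<in>{p. p permutes {0..<n}}. signof p * (\<Prod>i = 0..<n. fc_var (A i (p i))))"
    by (intro fc_eval_sum_cong) auto
  moreover have "det (mat n n (\<lambda>(i, j). N i j)) =
    (\<Sum>p\<in>{p. p permutes {0..<n}}. signof p * (\<Prod>i = 0..<n. N i (p i)))" for N :: "nat \<Rightarrow> nat \<Rightarrow> 'a free_cring"
    by (subst det_def') (auto intro!: sum.cong prod.cong simp: permutes_upt_less)
  ultimately show ?thesis by (simp add: rdet_def)
qed

lemma rdet_closed [simp]: "rdet R n A \<in> carrier R"
  by (simp add: rdet_def)

lemma rdet_cong: "(\<And>i j. i < n \<Longrightarrow> j < n \<Longrightarrow> A i j = B i j) \<Longrightarrow> rdet R n A = rdet R n B"
  unfolding rdet_def by (intro arg_cong[where f = "fc_eval R"] arg_cong[where f = det]) (auto intro!: eq_matI)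

lemma rdet_mult:
  assumes "\<And>i j. i < n \<Longrightarrow> j < n \<Longrightarrow> A i j \<in> carrier R" "\<And>i j. i < n \<Longrightarrow> j < n \<Longrightarrow> B i j \<in> carrier R"
  shows "rdet R n (\<lambda>i j. \<Oplus>k\<in>{..<n}. A i k \<otimes> B k j) = rdet R n A \<otimes> rdet R n B"
proof -
  let ?A = "mat n n (\<lambda>(i, j). fc_var (A i j))" and ?B = "mat n n (\<lambda>(i, j). fc_var (B i j))"
  have "rdet R n A \<otimes> rdet R n B = fc_eval R (det (?A * ?B))"
    by (subst det_mult[of _ n]) (auto simp: rdet_def)
  also have "?A * ?B = mat n n (\<lambda>(i, j). \<Sum>k\<in>{..<n}. fc_var (A i k) * fc_var (B k j))"
    by (intro eq_matI) (auto simp: scalar_prod_def atLeast0LessThan intro!: sum.cong)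
  also have "fc_eval R (det \<dots>) = rdet R n (\<lambda>i j. \<Oplus>k\<in>{..<n}. A i k \<otimes> B k j)"
    using assms by (intro fc_eval_det) (auto simp: fc_eval_sum intro!: finsum_cong')
  finally show ?thesis by simp
qed

lemma rdet_unitriangular:
  assumes "(\<forall>i<n. \<forall>j<i. A i j = \<zero>) \<or> (\<forall>j<n. \<forall>i<j. A i j = \<zero>)" "\<And>i. i < n \<Longrightarrow> A i i = \<one>"
    "\<And>i j. i < n \<Longrightarrow> j < n \<Longrightarrow> A i j \<in> carrier R"
  shows "rdet R n A = \<one>"
proof -
  \<comment> \<open>The variable named by the zero of \<open>R\<close> is not zero in the free ring,
    so zeros and the diagonal are lifted to genuine 0 and 1.\<close>
  let ?M = "\<lambda>i j. if i = j then 1 else if A i j = \<zero> then 0 else fc_var (A i j)"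
  let ?A = "mat n n (\<lambda>(i, j). ?M i j)"
  have d: "prod_list (diag_mat ?A) = 1"
    by (simp add: prod_list_diag_prod)
  have "det ?A = 1" using assms(1)
  proof
    assume *: "\<forall>i<n. \<forall>j<i. A i j = \<zero>"
    have "upper_triangular ?A" using * by (intro upper_triangularI) auto
    then show ?thesis using d det_upper_triangular[of ?A n] by auto
  next
    assume *: "\<forall>j<n. \<forall>i<j. A i j = \<zero>"
    then show ?thesis using d det_lower_triangular[of n ?A] by auto
  qed
  moreover have "fc_eval R (det ?A) = rdet R n A"
    using assms by (intro fc_eval_det) auto
  ultimately show ?thesis by simp
qed

end

section \<open>First-order expansion of a determinant near the identity\<close>

lemma prod_one_plus:
  fixes t :: "'r::comm_ring_1" and f :: "nat \<Rightarrow> 'r"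
  shows "t * t dvd (\<Prod>i<n. 1 + t * f i) - (1 + t * (\<Sum>i<n. f i))"
proof (induction n)
  case (Suc n)
  let ?p = "\<Prod>i<n. 1 + t * f i" and ?s = "\<Sum>i<n. f i"
  have "(\<Prod>i<Suc n. 1 + t * f i) - (1 + t * (\<Sum>i<Suc n. f i)) =
    (?p - (1 + t * ?s)) * (1 + t * f n) + t * t * (?s * f n)"
    by (simp add: algebra_simps)
  then show ?case using Suc by simp
qed simp

text \<open>A permutation other than the identity that moves i also moves p i, so its term has two
  off-diagonal factors, each divisible by t. Modulo the square of t only the diagonal product
  survives.\<close>

lemma det_one_plus:
  fixes t :: "'r::comm_ring_1" and M :: "nat \<Rightarrow> nat \<Rightarrow> 'r"
  shows "\<exists>y. det (mat n n (\<lambda>(i, j). (if i = j then 1 else 0) + t * M i j)) = 1 + t * (\<Sum>i<n. M i i) + t * t * y"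
proof -
  define B where "B = (\<lambda>i j. (if i = j then 1 else 0) + t * M i j)"
  let ?f = "\<lambda>p. signof p * (\<Prod>i<n. B i (p i)) :: 'r"
  let ?P = "{p. p permutes {0..<n}}"
  have "det (mat n n (\<lambda>(i, j). B i j)) = sum ?f ?P"
    by (subst det_def') (auto intro!: sum.cong prod.cong simp: permutes_upt_less atLeast0LessThan)
  also have "\<dots> = ?f id + sum ?f (?P - {id})"
    by (intro sum.remove) (auto simp: finite_permutations permutes_id)
  finally have eq: "det (mat n n (\<lambda>(i, j). B i j)) = ?f id + sum ?f (?P - {id})" .
  have 1: "t * t dvd ?f p" if "p \<in> ?P - {id}" for p
  proof -
    have p: "p permutes {0..<n}" "p \<noteq> id" using that by auto
    then obtain i where i: "p i \<noteq> i" by (metis eq_id_iff)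
    then have in': "i < n" using p(1) permutes_not_in by fastforce
    have pi: "p i < n" using p(1) in' by (rule permutes_upt_less)
    have ppi: "p (p i) \<noteq> p i" using i permutes_inj[OF p(1)] by (auto dest: injD)
    have "(\<Prod>i<n. B i (p i)) = B i (p i) * (B (p i) (p (p i)) * (\<Prod>j\<in>{..<n} - {i} - {p i}. B j (p j)))"
      using in' pi i by (simp add: prod.remove[of _ i] prod.remove[of _ "p i"])
    also have "\<dots> = t * t * (M i (p i) * M (p i) (p (p i)) * (\<Prod>j\<in>{..<n} - {i} - {p i}. B j (p j)))"
      using i ppi by (simp add: B_def)
    finally show ?thesis by simp
  qed
  have 2: "t * t dvd ?f id - (1 + t * (\<Sum>i<n. M i i))"
    using prod_one_plus[of t "\<lambda>i. M i i" n] by (simp add: B_def)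
  have "t * t dvd (?f id - (1 + t * (\<Sum>i<n. M i i))) + sum ?f (?P - {id})"
    by (intro dvd_add 2 dvd_sum 1)
  then obtain y where "?f id - (1 + t * (\<Sum>i<n. M i i)) + sum ?f (?P - {id}) = t * t * y" by (rule dvdE)
  then have "det (mat n n (\<lambda>(i, j). B i j)) = 1 + t * (\<Sum>i<n. M i i) + t * t * y"
    unfolding eq by (simp add: algebra_simps)
  then show ?thesis unfolding B_def by blast
qed

lemma (in cring) rdet_one_plus:
  assumes "\<And>i j. i < n \<Longrightarrow> j < n \<Longrightarrow> X i j \<in> carrier R"
    and A: "\<And>i j. i < n \<Longrightarrow> j < n \<Longrightarrow> A i j = mat_one R i j \<oplus> [(q::nat)] \<cdot> X i j"
  shows "\<exists>y\<in>carrier R. rdet R n A = \<one> \<oplus> [q] \<cdot> (\<Oplus>i\<in>{..<n}. X i i) \<oplus> [(q * q)] \<cdot> y"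
proof -
  obtain y :: "'a free_cring" where y:
    "det (mat n n (\<lambda>(i, j). (if i = j then 1 else 0) + of_nat q * fc_var (X i j))) =
      1 + of_nat q * (\<Sum>i<n. fc_var (X i i)) + of_nat q * of_nat q * y"
    using det_one_plus[of n "of_nat q" "\<lambda>i j. fc_var (X i j)"] by blast
  have "rdet R n A = fc_eval R (det (mat n n (\<lambda>(i, j). (if i = j then 1 else 0) + of_nat q * fc_var (X i j))))"
    using assms by (intro fc_eval_det[symmetric]) (auto simp: mat_one_def fc_eval_of_nat simp del: fc_eval_mult)
  also have "\<dots> = \<one> \<oplus> [q] \<cdot> fc_eval R (\<Sum>i<n. fc_var (X i i)) \<oplus> [(q * q)] \<cdot> fc_eval R y"
    unfolding y of_nat_mult[symmetric] by (simp add: fc_eval_of_nat del: fc_eval_mult of_nat_mult)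
  also have "fc_eval R (\<Sum>i<n. fc_var (X i i)) = (\<Oplus>i\<in>{..<n}. X i i)"
    using assms(1) by (auto simp: fc_eval_sum intro!: finsum_cong')
  finally show ?thesis by auto
qed

section \<open>Determinants over the group ring of an abelian subgroup\<close>

lemma (in abelian_monoid) finsum_Times:
  assumes "finite A" "finite B" "\<And>a b. a \<in> A \<Longrightarrow> b \<in> B \<Longrightarrow> f a b \<in> carrier G"
  shows "(\<Oplus>p\<in>A \<times> B. f (fst p) (snd p)) = (\<Oplus>a\<in>A. \<Oplus>b\<in>B. f a b)"
  using assms(1,3)
proof (induction A rule: finite_induct)
  case (insert a A)
  have "insert a A \<times> B = Pair a ` B \<union> A \<times> B" by auto
  then have "(\<Oplus>p\<in>insert a A \<times> B. f (fst p) (snd p)) =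
    (\<Oplus>p\<in>Pair a ` B. f (fst p) (snd p)) \<oplus> (\<Oplus>p\<in>A \<times> B. f (fst p) (snd p))"
    using insert assms(2) by (simp only:) (rule finsum_Un_disjoint, auto)
  also have "(\<Oplus>p\<in>Pair a ` B. f (fst p) (snd p)) = (\<Oplus>b\<in>B. f a b)"
    using insert by (subst finsum_reindex) (auto simp: inj_on_def)
  also have "(\<Oplus>p\<in>A \<times> B. f (fst p) (snd p)) = (\<Oplus>a\<in>A. \<Oplus>b\<in>B. f a b)"
    using insert by auto
  finally show ?case using insert by (simp add: finsum_insert finsum_closed Pi_def)
qed simp

lemma (in abelian_monoid) finsum_blocks:
  assumes "d > (0::nat)" "\<And>k. k < N * d \<Longrightarrow> f k \<in> carrier G"
  shows "(\<Oplus>k\<in>{..<N * d}. f k) = (\<Oplus>i\<in>{..<N}. \<Oplus>r\<in>{..<d}. f (i * d + r))"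
proof -
  let ?h = "\<lambda>p. fst p * d + snd p"
  have lt: "i * d + r < N * d" if "i < N" "r < d" for i r
  proof -
    have "i * d + r < Suc i * d" using that by simp
    also have "\<dots> \<le> N * d" using that by (intro mult_le_mono1) simp
    finally show ?thesis .
  qed
  have im: "?h ` ({..<N} \<times> {..<d}) = {..<N * d}"
  proof (intro equalityI subsetI)
    fix k assume "k \<in> {..<N * d}"
    then have "k div d < N" "k mod d < d" using assms(1) by (auto simp: less_mult_imp_div_less)
    then show "k \<in> ?h ` ({..<N} \<times> {..<d})" by (intro image_eqI[of _ _ "(k div d, k mod d)"]) auto
  qed (auto intro: lt)
  have inj: "inj_on ?h ({..<N} \<times> {..<d})"
    by (rule inj_on_inverseI[of _ "\<lambda>k. (k div d, k mod d)"]) auto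
  have "(\<Oplus>k\<in>{..<N * d}. f k) = (\<Oplus>p\<in>{..<N} \<times> {..<d}. f (fst p * d + snd p))"
    using finsum_reindex[of f ?h "{..<N} \<times> {..<d}", OF _ inj] assms(2) unfolding im by auto
  also have "\<dots> = (\<Oplus>i\<in>{..<N}. \<Oplus>r\<in>{..<d}. f (i * d + r))"
    using assms lt by (intro finsum_Times) auto
  finally show ?thesis .
qed

lemma eq_iff_mod_eq:
  fixes a b d :: nat
  assumes "a div d = b div d"
  shows "a = b \<longleftrightarrow> a mod d = b mod d"
proof
  assume "a mod d = b mod d"
  then have "a div d * d + a mod d = b div d * d + b mod d" by (simp only: assms)
  then show "a = b" by simp
qed simp

lemma (in finite_group_ring) finsum_inverse:
  assumes "f \<in> carrier G \<rightarrow> carrier R"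
  shows "(\<Oplus>x\<in>carrier G. f (inv\<^bsub>G\<^esub> x)) = (\<Oplus>x\<in>carrier G. f x)"
proof -
  have "(\<lambda>x. inv\<^bsub>G\<^esub> x) ` carrier G = carrier G"
  proof (intro equalityI subsetI)
    fix x assume "x \<in> carrier G"
    then show "x \<in> (\<lambda>x. inv\<^bsub>G\<^esub> x) ` carrier G" by (intro image_eqI[of _ _ "inv\<^bsub>G\<^esub> x"]) auto
  qed auto
  moreover have "inj_on (\<lambda>x. inv\<^bsub>G\<^esub> x) (carrier G)" by (auto intro: inj_onI)
  ultimately show ?thesis
    using finsum_reindex[of f "\<lambda>x. inv\<^bsub>G\<^esub> x" "carrier G"] assms by simp
qed

text \<open>\<open>R[G]\<close> is a free right module over the commutative ring \<open>R[C]\<close> with basis the coset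
  representatives \<open>e 0, \<dots>, e (d - 1)\<close>; \<open>\<rho>\<close> is the resulting matrix representation.\<close>

locale coset_representation = finite_group_ring +
  fixes C :: "'c set" and e :: "nat \<Rightarrow> 'c" and d :: nat
  assumes cring: "cring R" and subgroup: "subgroup C G"
    and comm: "\<And>x y. x \<in> C \<Longrightarrow> y \<in> C \<Longrightarrow> x \<otimes>\<^bsub>G\<^esub> y = y \<otimes>\<^bsub>G\<^esub> x"
    and e_closed [simp]: "\<And>s. s < d \<Longrightarrow> e s \<in> carrier G"
    and reps: "bij_betw (\<lambda>p. e (fst p) \<otimes>\<^bsub>G\<^esub> snd p) ({..<d} \<times> C) (carrier G)"
begin

abbreviation H where "H \<equiv> G\<lparr>carrier := C\<rparr>"
abbreviation S where "S \<equiv> group_ring R H"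

lemma C_sub: "C \<subseteq> carrier G" by (rule subgroup.subset[OF subgroup])

lemma C_carrier [simp]: "c \<in> C \<Longrightarrow> c \<in> carrier G" using C_sub by blast

lemma C_one [simp]: "\<one>\<^bsub>G\<^esub> \<in> C" by (rule subgroup.one_closed[OF subgroup])

lemma C_mult [simp]: "x \<in> C \<Longrightarrow> y \<in> C \<Longrightarrow> x \<otimes>\<^bsub>G\<^esub> y \<in> C" by (rule subgroup.m_closed[OF subgroup])

lemma C_inv [simp]: "x \<in> C \<Longrightarrow> inv\<^bsub>G\<^esub> x \<in> C" by (rule subgroup.m_inv_closed[OF subgroup])

lemma finC: "finite C" using C_sub fin by (rule finite_subset)

lemma inv_H [simp]: "c \<in> C \<Longrightarrow> inv\<^bsub>H\<^esub> c = inv\<^bsub>G\<^esub> c"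
  by (rule G.m_inv_consistent[OF subgroup])

lemma group_H: "group H"
  by (rule G.subgroup_imp_group[OF subgroup])

sublocale H: finite_group_ring R H
  by (intro finite_group_ring.intro finite_group_ring_axioms.intro ring_axioms group_H) (simp add: finC)

lemma cring_S: "cring S"
proof (rule H.cring_group_ring[OF cring])
  show "comm_group H"
    by (intro group.group_comm_groupI group_H) (simp add: comm)
qed

sublocale S: cring S by (rule cring_S)

lemma d_pos: "d > 0"
proof -
  have "carrier G \<noteq> {}" using G.one_closed by blast
  then have "{..<d} \<times> C \<noteq> {}" using reps by (auto simp: bij_betw_def)
  then show ?thesis by auto
qed


lemma rep_unique:
  assumes "s < d" "t < d" "c \<in> C" "c' \<in> C" "e s \<otimes>\<^bsub>G\<^esub> c = e t \<otimes>\<^bsub>G\<^esub> c'"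
  shows "s = t \<and> c = c'"
  using inj_onD[OF bij_betw_imp_inj_on[OF reps], of "(s, c)" "(t, c')"] assms by auto

lemma finsum_reps:
  assumes "f \<in> carrier G \<rightarrow> carrier R"
  shows "(\<Oplus>x\<in>carrier G. f x) = (\<Oplus>s\<in>{..<d}. \<Oplus>c\<in>C. f (e s \<otimes>\<^bsub>G\<^esub> c))"
proof -
  let ?h = "\<lambda>p. e (fst p) \<otimes>\<^bsub>G\<^esub> snd p"
  have im: "?h ` ({..<d} \<times> C) = carrier G" using reps by (simp add: bij_betw_def)
  have "(\<Oplus>x\<in>carrier G. f x) = (\<Oplus>p\<in>{..<d} \<times> C. f (e (fst p) \<otimes>\<^bsub>G\<^esub> snd p))"
    using finsum_reindex[of f ?h "{..<d} \<times> C", OF _ bij_betw_imp_inj_on[OF reps]] assms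
    unfolding im by simp
  also have "\<dots> = (\<Oplus>s\<in>{..<d}. \<Oplus>c\<in>C. f (e s \<otimes>\<^bsub>G\<^esub> c))"
    by (rule finsum_Times[where f = "\<lambda>s c. f (e s \<otimes>\<^bsub>G\<^esub> c)"]) (use assms finC in auto)
  finally show ?thesis .
qed

text \<open>Column t holds the coordinates of x e_t in the basis: the coefficient of x e_t at e_s c
  is the value of x at e_s c e_t^-1.\<close>

definition \<rho> :: "('c \<Rightarrow> 'a) \<Rightarrow> nat \<Rightarrow> nat \<Rightarrow> 'c \<Rightarrow> 'a" where
  "\<rho> x s t = (\<lambda>c\<in>C. x (e s \<otimes>\<^bsub>G\<^esub> c \<otimes>\<^bsub>G\<^esub> inv\<^bsub>G\<^esub> (e t)))"

lemma rho_apply: "c \<in> C \<Longrightarrow> \<rho> x s t c = x (e s \<otimes>\<^bsub>G\<^esub> c \<otimes>\<^bsub>G\<^esub> inv\<^bsub>G\<^esub> (e t))"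
  by (simp add: \<rho>_def)

lemma rho_closed [simp]: "x \<in> carrier \<Lambda> \<Longrightarrow> s < d \<Longrightarrow> t < d \<Longrightarrow> \<rho> x s t \<in> carrier S"
  unfolding \<rho>_def using H.gr_restrict[of "\<lambda>c. x (e s \<otimes>\<^bsub>G\<^esub> c \<otimes>\<^bsub>G\<^esub> inv\<^bsub>G\<^esub> (e t))"] by simp

lemma rho_mult:
  assumes x: "x \<in> carrier \<Lambda>" and y: "y \<in> carrier \<Lambda>" and st: "s < d" "t < d"
  shows "\<rho> (x \<otimes>\<^bsub>\<Lambda>\<^esub> y) s t = (\<Oplus>\<^bsub>S\<^esub>r\<in>{..<d}. \<rho> x s r \<otimes>\<^bsub>S\<^esub> \<rho> y r t)"
proof (rule H.gr_eqI)
  fix c assume "c \<in> carrier H"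
  then have c: "c \<in> C" by simp
  let ?w = "e s \<otimes>\<^bsub>G\<^esub> c \<otimes>\<^bsub>G\<^esub> inv\<^bsub>G\<^esub> (e t)"
  let ?F = "\<lambda>h. x h \<otimes> y (inv\<^bsub>G\<^esub> h \<otimes>\<^bsub>G\<^esub> ?w)"
  have w: "?w \<in> carrier G" using st c by simp
  have "\<rho> (x \<otimes>\<^bsub>\<Lambda>\<^esub> y) s t c = (\<Oplus>h\<in>carrier G. ?F h)"
    using c w by (simp add: rho_apply gr_mult)
  \<comment> \<open>The index becomes h = e_s g^-1, with g running over the elements e_r k. Then x
    is evaluated as \<open>\<rho> x s r\<close> at k^-1 and y as \<open>\<rho> y r t\<close> at kc;
    the sum over k is their convolution over C and the sum over r is the matrix product.\<close>
  also have "\<dots> = (\<Oplus>k\<in>carrier G. ?F (e s \<otimes>\<^bsub>G\<^esub> k))"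
    using st x y w by (intro finsum_translate[symmetric]) auto
  also have "\<dots> = (\<Oplus>k\<in>carrier G. ?F (e s \<otimes>\<^bsub>G\<^esub> inv\<^bsub>G\<^esub> k))"
    using st x y w by (intro finsum_inverse[symmetric]) auto
  also have "\<dots> = (\<Oplus>r\<in>{..<d}. \<Oplus>k\<in>C. ?F (e s \<otimes>\<^bsub>G\<^esub> inv\<^bsub>G\<^esub> (e r \<otimes>\<^bsub>G\<^esub> k)))"
    using st x y w by (intro finsum_reps) auto
  also have "\<dots> = (\<Oplus>r\<in>{..<d}. (\<rho> x s r \<otimes>\<^bsub>S\<^esub> \<rho> y r t) c)"
  proof (intro finsum_cong' refl)
    fix r assume "r \<in> {..<d}"
    then have r: "r < d" by simp
    have "(\<rho> x s r \<otimes>\<^bsub>S\<^esub> \<rho> y r t) c = (\<Oplus>k\<in>C. \<rho> x s r k \<otimes> \<rho> y r t (inv\<^bsub>G\<^esub> k \<otimes>\<^bsub>G\<^esub> c))"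
      using c H.gr_mult[of c "\<rho> x s r" "\<rho> y r t"] by (auto intro!: finsum_cong' simp: x y r st)
    also have "\<dots> = (\<Oplus>k\<in>C. \<rho> x s r (inv\<^bsub>G\<^esub> k) \<otimes> \<rho> y r t (k \<otimes>\<^bsub>G\<^esub> c))"
    proof -
      let ?g = "\<lambda>k. \<rho> x s r k \<otimes> \<rho> y r t (inv\<^bsub>G\<^esub> k \<otimes>\<^bsub>G\<^esub> c)"
      have "?g \<in> carrier H \<rightarrow> carrier R"
        using H.gr_closed[OF rho_closed[OF x st(1) r]] H.gr_closed[OF rho_closed[OF y r st(2)]] c by simp
      then have "(\<Oplus>k\<in>carrier H. ?g (inv\<^bsub>H\<^esub> k)) = (\<Oplus>k\<in>carrier H. ?g k)" by (rule H.finsum_inverse)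
      moreover have "(\<Oplus>k\<in>carrier H. ?g (inv\<^bsub>H\<^esub> k)) = (\<Oplus>k\<in>C. \<rho> x s r (inv\<^bsub>G\<^esub> k) \<otimes> \<rho> y r t (k \<otimes>\<^bsub>G\<^esub> c))"
        using H.gr_closed[OF rho_closed[OF x st(1) r]] H.gr_closed[OF rho_closed[OF y r st(2)]] c
        by (intro finsum_cong') auto
      ultimately show ?thesis by simp
    qed
    also have "\<dots> = (\<Oplus>k\<in>C. ?F (e s \<otimes>\<^bsub>G\<^esub> inv\<^bsub>G\<^esub> (e r \<otimes>\<^bsub>G\<^esub> k)))"
    proof (intro finsum_cong' refl)
      fix k assume k: "k \<in> C"
      have 1: "e s \<otimes>\<^bsub>G\<^esub> inv\<^bsub>G\<^esub> k \<otimes>\<^bsub>G\<^esub> inv\<^bsub>G\<^esub> (e r) = e s \<otimes>\<^bsub>G\<^esub> inv\<^bsub>G\<^esub> (e r \<otimes>\<^bsub>G\<^esub> k)"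
        using k r st by (simp add: G.inv_mult_group G.m_assoc)
      have 2: "e r \<otimes>\<^bsub>G\<^esub> (k \<otimes>\<^bsub>G\<^esub> c) \<otimes>\<^bsub>G\<^esub> inv\<^bsub>G\<^esub> (e t) =
        inv\<^bsub>G\<^esub> (e s \<otimes>\<^bsub>G\<^esub> inv\<^bsub>G\<^esub> (e r \<otimes>\<^bsub>G\<^esub> k)) \<otimes>\<^bsub>G\<^esub> ?w"
      proof -
        have "inv\<^bsub>G\<^esub> (e s \<otimes>\<^bsub>G\<^esub> inv\<^bsub>G\<^esub> (e r \<otimes>\<^bsub>G\<^esub> k)) = e r \<otimes>\<^bsub>G\<^esub> k \<otimes>\<^bsub>G\<^esub> inv\<^bsub>G\<^esub> (e s)"
          using k r st by (simp add: G.inv_mult_group G.m_assoc)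
        moreover have "inv\<^bsub>G\<^esub> (e s) \<otimes>\<^bsub>G\<^esub> (e s \<otimes>\<^bsub>G\<^esub> (c \<otimes>\<^bsub>G\<^esub> inv\<^bsub>G\<^esub> (e t))) = c \<otimes>\<^bsub>G\<^esub> inv\<^bsub>G\<^esub> (e t)"
          using c st by (simp add: G.m_assoc[symmetric])
        ultimately show ?thesis using k r st c by (simp add: G.m_assoc)
      qed
      show "\<rho> x s r (inv\<^bsub>G\<^esub> k) \<otimes> \<rho> y r t (k \<otimes>\<^bsub>G\<^esub> c) = ?F (e s \<otimes>\<^bsub>G\<^esub> inv\<^bsub>G\<^esub> (e r \<otimes>\<^bsub>G\<^esub> k))"
        using k c by (simp add: rho_apply 1 2)
    qed (use x y w r st in auto)
    finally show "(\<Oplus>k\<in>C. ?F (e s \<otimes>\<^bsub>G\<^esub> inv\<^bsub>G\<^esub> (e r \<otimes>\<^bsub>G\<^esub> k))) = (\<rho> x s r \<otimes>\<^bsub>S\<^esub> \<rho> y r t) c" by simp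
  qed (use x y st c in \<open>auto intro!: H.gr_closed H.gr_mult_closed\<close>)
  also have "\<dots> = (\<Oplus>\<^bsub>S\<^esub>r\<in>{..<d}. \<rho> x s r \<otimes>\<^bsub>S\<^esub> \<rho> y r t) c"
    using x y st c by (intro H.gr_finsum[symmetric]) auto
  finally show "\<rho> (x \<otimes>\<^bsub>\<Lambda>\<^esub> y) s t c = (\<Oplus>\<^bsub>S\<^esub>r\<in>{..<d}. \<rho> x s r \<otimes>\<^bsub>S\<^esub> \<rho> y r t) c" .
qed (use x y st in \<open>auto intro!: H.\<Lambda>.finsum_closed\<close>)

lemma rho_finsum:
  assumes f: "\<And>i. i \<in> A \<Longrightarrow> f i \<in> carrier \<Lambda>" and st: "s < d" "t < d"
  shows "\<rho> (\<Oplus>\<^bsub>\<Lambda>\<^esub>i\<in>A. f i) s t = (\<Oplus>\<^bsub>S\<^esub>i\<in>A. \<rho> (f i) s t)"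
proof (rule H.gr_eqI)
  fix c assume "c \<in> carrier H"
  then have c: "c \<in> C" by simp
  have "(\<Oplus>\<^bsub>S\<^esub>i\<in>A. \<rho> (f i) s t) c = (\<Oplus>i\<in>A. \<rho> (f i) s t c)"
    using f st c by (intro H.gr_finsum) auto
  then show "\<rho> (\<Oplus>\<^bsub>\<Lambda>\<^esub>i\<in>A. f i) s t c = (\<Oplus>\<^bsub>S\<^esub>i\<in>A. \<rho> (f i) s t) c"
    using f st c by (simp add: rho_apply gr_finsum)
qed (use f st in \<open>auto intro!: H.\<Lambda>.finsum_closed \<Lambda>.finsum_closed\<close>)

lemma rho_zero: "s < d \<Longrightarrow> t < d \<Longrightarrow> \<rho> \<zero>\<^bsub>\<Lambda>\<^esub> s t = \<zero>\<^bsub>S\<^esub>"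
  using rho_finsum[of "{}"] by simp

lemma rho_one:
  assumes st: "s < d" "t < d"
  shows "\<rho> \<one>\<^bsub>\<Lambda>\<^esub> s t = (if s = t then \<one>\<^bsub>S\<^esub> else \<zero>\<^bsub>S\<^esub>)"
proof (rule H.gr_eqI)
  fix c assume "c \<in> carrier H"
  then have c: "c \<in> C" by simp
  have "e s \<otimes>\<^bsub>G\<^esub> c \<otimes>\<^bsub>G\<^esub> inv\<^bsub>G\<^esub> (e t) = \<one>\<^bsub>G\<^esub> \<longleftrightarrow> s = t \<and> c = \<one>\<^bsub>G\<^esub>"
  proof
    assume *: "e s \<otimes>\<^bsub>G\<^esub> c \<otimes>\<^bsub>G\<^esub> inv\<^bsub>G\<^esub> (e t) = \<one>\<^bsub>G\<^esub>"
    have "e s \<otimes>\<^bsub>G\<^esub> c = e s \<otimes>\<^bsub>G\<^esub> c \<otimes>\<^bsub>G\<^esub> inv\<^bsub>G\<^esub> (e t) \<otimes>\<^bsub>G\<^esub> e t" using st c by (simp add: G.m_assoc)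
    also have "\<dots> = e t \<otimes>\<^bsub>G\<^esub> \<one>\<^bsub>G\<^esub>" using st by (simp add: *)
    finally have "e s \<otimes>\<^bsub>G\<^esub> c = e t \<otimes>\<^bsub>G\<^esub> \<one>\<^bsub>G\<^esub>" .
    then show "s = t \<and> c = \<one>\<^bsub>G\<^esub>" by (rule rep_unique[OF st c C_one])
  qed (use st in auto)
  then show "\<rho> \<one>\<^bsub>\<Lambda>\<^esub> s t c = (if s = t then \<one>\<^bsub>S\<^esub> else \<zero>\<^bsub>S\<^esub>) c"
    using st c H.gr_one[of c] H.gr_zero[of c] by (auto simp: rho_apply gr_one)
qed (use st in auto)

section \<open>The determinant over the group ring of \<open>C\<close>\<close>

definition blocks :: "(nat \<Rightarrow> nat \<Rightarrow> 'c \<Rightarrow> 'a) \<Rightarrow> nat \<Rightarrow> nat \<Rightarrow> 'c \<Rightarrow> 'a" where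
  "blocks A a b = \<rho> (A (a div d) (b div d)) (a mod d) (b mod d)"

text \<open>The determinant over R[C] of the endomorphism of the free module \<Lambda>^N given by A.
  The size \<open>N\<close> is explicit because \<open>rdet\<close> needs a finite matrix.\<close>

definition \<delta> :: "nat \<Rightarrow> (nat \<Rightarrow> nat \<Rightarrow> 'c \<Rightarrow> 'a) \<Rightarrow> 'c \<Rightarrow> 'a" where
  "\<delta> N A = rdet S (N * d) (blocks A)"

lemma mod_d [simp]: "a mod d < d" using d_pos by simp

lemma blocks_closed [simp]: "A \<in> carrier (Mat \<Lambda>) \<Longrightarrow> blocks A a b \<in> carrier S"
  by (simp add: blocks_def \<Lambda>.Mat_closed)

lemma det_blocks_mult:
  assumes A: "A \<in> carrier (mat_monoid \<Lambda> N)" and B: "B \<in> carrier (mat_monoid \<Lambda> N)"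
  shows "\<delta> N (mat_mult \<Lambda> A B) = \<delta> N A \<otimes>\<^bsub>S\<^esub> \<delta> N B"
proof -
  have AM: "A \<in> carrier (Mat \<Lambda>)" "B \<in> carrier (Mat \<Lambda>)" using A B \<Lambda>.MatI by auto
  have c [simp]: "A i j \<in> carrier \<Lambda>" "B i j \<in> carrier \<Lambda>" for i j using AM \<Lambda>.Mat_closed by auto
  have "blocks (mat_mult \<Lambda> A B) a b = (\<Oplus>\<^bsub>S\<^esub>k\<in>{..<N * d}. blocks A a k \<otimes>\<^bsub>S\<^esub> blocks B k b)"
    if ab: "a < N * d" "b < N * d" for a b
  proof -
    have aN: "a div d < N" using ab(1) by (rule less_mult_imp_div_less)
    have "blocks (mat_mult \<Lambda> A B) a b =
      \<rho> (\<Oplus>\<^bsub>\<Lambda>\<^esub>k\<in>{..<N}. A (a div d) k \<otimes>\<^bsub>\<Lambda>\<^esub> B k (b div d)) (a mod d) (b mod d)"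
      using aN \<Lambda>.mat_mult_lessThan[OF A, of B "b div d" N "a div d"] by (simp add: blocks_def)
    also have "\<dots> = (\<Oplus>\<^bsub>S\<^esub>k\<in>{..<N}. \<Oplus>\<^bsub>S\<^esub>r\<in>{..<d}. \<rho> (A (a div d) k) (a mod d) r \<otimes>\<^bsub>S\<^esub> \<rho> (B k (b div d)) r (b mod d))"
      by (simp add: rho_finsum rho_mult)
    also have "\<dots> = (\<Oplus>\<^bsub>S\<^esub>k\<in>{..<N}. \<Oplus>\<^bsub>S\<^esub>r\<in>{..<d}. blocks A a (k * d + r) \<otimes>\<^bsub>S\<^esub> blocks B (k * d + r) b)"
      using AM by (intro H.\<Lambda>.finsum_cong') (auto simp: blocks_def intro!: H.\<Lambda>.finsum_closed H.\<Lambda>.finsum_cong')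
    also have "\<dots> = (\<Oplus>\<^bsub>S\<^esub>k\<in>{..<N * d}. blocks A a k \<otimes>\<^bsub>S\<^esub> blocks B k b)"
      using AM d_pos by (intro H.\<Lambda>.finsum_blocks[symmetric]) auto
    finally show ?thesis .
  qed
  then have "\<delta> N (mat_mult \<Lambda> A B) = rdet S (N * d) (\<lambda>a b. \<Oplus>\<^bsub>S\<^esub>k\<in>{..<N * d}. blocks A a k \<otimes>\<^bsub>S\<^esub> blocks B k b)"
    unfolding \<delta>_def by (rule S.rdet_cong)
  also have "\<dots> = \<delta> N A \<otimes>\<^bsub>S\<^esub> \<delta> N B"
    unfolding \<delta>_def using AM by (intro S.rdet_mult) auto
  finally show ?thesis .
qed

text \<open>The block matrix has identity blocks on the diagonal and at most one further nonzero
  block, above or below the diagonal according to the order of \<open>i\<close> and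
  \<open>j\<close>; it is therefore unitriangular.\<close>

lemma det_blocks_elem_mat:
  assumes "i \<noteq> j" "x \<in> carrier \<Lambda>"
  shows "\<delta> N (elem_mat \<Lambda> i j x) = \<one>\<^bsub>S\<^esub>"
  unfolding \<delta>_def
proof (rule S.rdet_unitriangular)
  have b: "blocks (elem_mat \<Lambda> i j x) k l = (if k div d = i \<and> l div d = j then \<rho> x (k mod d) (l mod d)
      else if k = l then \<one>\<^bsub>S\<^esub> else \<zero>\<^bsub>S\<^esub>)" for k l
  proof (cases "k div d = l div d")
    case True
    then have "k = l \<longleftrightarrow> k mod d = l mod d" by (rule eq_iff_mod_eq)
    moreover have ne: "\<not> (k div d = i \<and> l div d = j)" using True assms by simp
    moreover have "blocks (elem_mat \<Lambda> i j x) k l = \<rho> \<one>\<^bsub>\<Lambda>\<^esub> (k mod d) (l mod d)"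
      unfolding blocks_def elem_mat_def mat_one_def if_not_P[OF ne] if_P[OF True] ..
    ultimately show ?thesis unfolding if_not_P[OF ne] by (simp add: rho_one)
  next
    case False
    then show ?thesis by (auto simp: blocks_def elem_mat_def mat_one_def rho_zero)
  qed
  show "(\<forall>k<N * d. \<forall>l<k. blocks (elem_mat \<Lambda> i j x) k l = \<zero>\<^bsub>S\<^esub>) \<or>
    (\<forall>l<N * d. \<forall>k<l. blocks (elem_mat \<Lambda> i j x) k l = \<zero>\<^bsub>S\<^esub>)"
  proof (cases "i < j")
    case True
    have "\<not> (k div d = i \<and> l div d = j)" if "l < k" for k l
      using True that div_le_mono[of l k d] by auto
    then show ?thesis by (auto simp: b)
  next
    case False
    have "\<not> (k div d = i \<and> l div d = j)" if "k < l" for k l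
      using False assms that div_le_mono[of k l d] by auto
    then show ?thesis by (auto simp: b)
  qed
  show "blocks (elem_mat \<Lambda> i j x) k k = \<one>\<^bsub>S\<^esub>" for k using assms(1) by (auto simp: b)
qed (use assms in \<open>auto intro!: blocks_closed \<Lambda>.elem_mat_Mat\<close>)

text \<open>The bound depends on a word for A: its factors may be larger than A itself, and
  multiplicativity of \<open>\<delta>\<close> needs all of them in one block size.\<close>

lemma det_blocks_elementary:
  assumes "A \<in> elementary_group \<Lambda>"
  shows "\<exists>m. \<forall>N\<ge>m. A \<in> carrier (mat_monoid \<Lambda> N) \<and> \<delta> N A = \<one>\<^bsub>S\<^esub>"
  using assms unfolding elementary_group_def
proof (induction rule: generate.induct)
  case one
  have "mat_one \<Lambda> = elem_mat \<Lambda> 0 1 \<zero>\<^bsub>\<Lambda>\<^esub>"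
    by (intro ext) (simp add: elem_mat_def mat_one_def)
  then show ?case using det_blocks_elem_mat[of 0 1 "\<zero>\<^bsub>\<Lambda>\<^esub>"] \<Lambda>.mat_one_mat_monoid by simp
next
  case (incl h)
  then obtain i j x where h: "h = elem_mat \<Lambda> i j x" "i \<noteq> j" "x \<in> carrier \<Lambda>" by blast
  then show ?case using det_blocks_elem_mat \<Lambda>.elem_mat_mat_monoid[of i _ j x]
    by (intro exI[of _ "Suc (max i j)"]) auto
next
  case (inv h)
  then obtain i j x where h: "h = elem_mat \<Lambda> i j x" "i \<noteq> j" "x \<in> carrier \<Lambda>" by blast
  then have "inv\<^bsub>GL \<Lambda>\<^esub> h = elem_mat \<Lambda> i j (\<ominus>\<^bsub>\<Lambda>\<^esub> x)" using \<Lambda>.inv_elem_mat by simp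
  then show ?case using h det_blocks_elem_mat \<Lambda>.elem_mat_mat_monoid[of i _ j "\<ominus>\<^bsub>\<Lambda>\<^esub> x"]
    by (intro exI[of _ "Suc (max i j)"]) auto
next
  case (eng h1 h2)
  then obtain m1 m2 where
    "\<forall>N\<ge>m1. h1 \<in> carrier (mat_monoid \<Lambda> N) \<and> \<delta> N h1 = \<one>\<^bsub>S\<^esub>"
    "\<forall>N\<ge>m2. h2 \<in> carrier (mat_monoid \<Lambda> N) \<and> \<delta> N h2 = \<one>\<^bsub>S\<^esub>" by blast
  then show ?case
    by (intro exI[of _ "max m1 m2"]) (simp add: \<Lambda>.mat_mult_monoid det_blocks_mult)
qed

text \<open>The expansion of det(1 + qX), where X is zero outside the block of index 0. The trace is
  thus that of \<open>\<rho> x\<close>, whatever \<open>N\<close> is.\<close>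

lemma det_blocks_diag:
  assumes x: "x \<in> carrier \<Lambda>" and N: "N \<ge> 1"
  shows "\<exists>y\<in>carrier S. \<delta> N (diag_at \<Lambda> 0 (\<one>\<^bsub>\<Lambda>\<^esub> \<oplus>\<^bsub>\<Lambda>\<^esub> [(q::nat)] \<cdot>\<^bsub>\<Lambda>\<^esub> x)) =
    \<one>\<^bsub>S\<^esub> \<oplus>\<^bsub>S\<^esub> [q] \<cdot>\<^bsub>S\<^esub> (\<Oplus>\<^bsub>S\<^esub>s\<in>{..<d}. \<rho> x s s) \<oplus>\<^bsub>S\<^esub> [(q * q)] \<cdot>\<^bsub>S\<^esub> y"
proof -
  define X where "X = (\<lambda>a b. if a < d \<and> b < d then \<rho> x a b else \<zero>\<^bsub>S\<^esub>)"
  have X: "X a b \<in> carrier S" for a b using x by (simp add: X_def)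
  have lin: "\<rho> (\<one>\<^bsub>\<Lambda>\<^esub> \<oplus>\<^bsub>\<Lambda>\<^esub> [q] \<cdot>\<^bsub>\<Lambda>\<^esub> x) s t = \<rho> \<one>\<^bsub>\<Lambda>\<^esub> s t \<oplus>\<^bsub>S\<^esub> [q] \<cdot>\<^bsub>S\<^esub> \<rho> x s t" if st: "s < d" "t < d" for s t
  proof (rule H.gr_eqI)
    fix c assume c: "c \<in> carrier H"
    then show "\<rho> (\<one>\<^bsub>\<Lambda>\<^esub> \<oplus>\<^bsub>\<Lambda>\<^esub> [q] \<cdot>\<^bsub>\<Lambda>\<^esub> x) s t c = (\<rho> \<one>\<^bsub>\<Lambda>\<^esub> s t \<oplus>\<^bsub>S\<^esub> [q] \<cdot>\<^bsub>S\<^esub> \<rho> x s t) c"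
      using st x H.gr_add[OF c] H.gr_add_pow[OF rho_closed[OF x st] c]
      by (simp add: rho_apply gr_add gr_add_pow)
  qed (use st x in auto)
  have "blocks (diag_at \<Lambda> 0 (\<one>\<^bsub>\<Lambda>\<^esub> \<oplus>\<^bsub>\<Lambda>\<^esub> [q] \<cdot>\<^bsub>\<Lambda>\<^esub> x)) a b = mat_one S a b \<oplus>\<^bsub>S\<^esub> [q] \<cdot>\<^bsub>S\<^esub> X a b" for a b
  proof (cases "a < d \<and> b < d")
    case True
    then show ?thesis using x
      by (auto simp: blocks_def diag_at_def lin X_def rho_one mat_one_def)
  next
    case False
    then have "\<not> (a div d = 0 \<and> b div d = 0)" using d_pos by (auto simp: div_eq_0_iff)
    then have "blocks (diag_at \<Lambda> 0 (\<one>\<^bsub>\<Lambda>\<^esub> \<oplus>\<^bsub>\<Lambda>\<^esub> [q] \<cdot>\<^bsub>\<Lambda>\<^esub> x)) a b = \<rho> (mat_one \<Lambda> (a div d) (b div d)) (a mod d) (b mod d)"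
      by (auto simp: blocks_def diag_at_def)
    also have "\<dots> = mat_one S a b"
    proof (cases "a div d = b div d")
      case True
      then have ab: "a = b \<longleftrightarrow> a mod d = b mod d" by (rule eq_iff_mod_eq)
      show ?thesis unfolding mat_one_def if_P[OF True] using ab by (simp add: rho_one)
    qed (auto simp: mat_one_def rho_zero)
    finally show ?thesis using False by (auto simp: X_def H.\<Lambda>.mat_one_closed)
  qed
  then obtain y where y: "y \<in> carrier S"
    "\<delta> N (diag_at \<Lambda> 0 (\<one>\<^bsub>\<Lambda>\<^esub> \<oplus>\<^bsub>\<Lambda>\<^esub> [q] \<cdot>\<^bsub>\<Lambda>\<^esub> x)) =
      \<one>\<^bsub>S\<^esub> \<oplus>\<^bsub>S\<^esub> [q] \<cdot>\<^bsub>S\<^esub> (\<Oplus>\<^bsub>S\<^esub>a\<in>{..<N * d}. X a a) \<oplus>\<^bsub>S\<^esub> [(q * q)] \<cdot>\<^bsub>S\<^esub> y"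
    unfolding \<delta>_def using S.rdet_one_plus[of "N * d" X _ q] X by blast
  have "(\<Oplus>\<^bsub>S\<^esub>a\<in>{..<N * d}. X a a) = (\<Oplus>\<^bsub>S\<^esub>a\<in>{..<d}. \<rho> x a a)"
    using N x by (intro H.\<Lambda>.add.finprod_mono_neutral_cong_right) (auto simp: X_def)
  then show ?thesis using y by auto
qed

text \<open>Equal classes have equal determinants over \<open>S\<close>, which reads 1 + q t + q^2
  z1 = 1 + q^2 t' + q^4 z2 with t and t' the traces. Dividing once by q shows that q divides the
  coefficient of t at g, the sum of x over the elements e_s g e_s^-1. The conclusion sums over all
  of G, which makes it independent of the representatives.\<close>

lemma conj_sum_divisible:
  assumes x: "x \<in> carrier \<Lambda>" and y: "y \<in> carrier \<Lambda>" and g: "g \<in> C"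
    and units: "\<one>\<^bsub>\<Lambda>\<^esub> \<oplus>\<^bsub>\<Lambda>\<^esub> [(q::nat)] \<cdot>\<^bsub>\<Lambda>\<^esub> x \<in> Units \<Lambda>" "\<one>\<^bsub>\<Lambda>\<^esub> \<oplus>\<^bsub>\<Lambda>\<^esub> [(q * q)] \<cdot>\<^bsub>\<Lambda>\<^esub> y \<in> Units \<Lambda>"
    and K1: "K1_class \<Lambda> (diag_at \<Lambda> 0 (\<one>\<^bsub>\<Lambda>\<^esub> \<oplus>\<^bsub>\<Lambda>\<^esub> [q] \<cdot>\<^bsub>\<Lambda>\<^esub> x)) =
      K1_class \<Lambda> (diag_at \<Lambda> 0 (\<one>\<^bsub>\<Lambda>\<^esub> \<oplus>\<^bsub>\<Lambda>\<^esub> [(q * q)] \<cdot>\<^bsub>\<Lambda>\<^esub> y))"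
    and torsion_free: "\<And>r. r \<in> carrier R \<Longrightarrow> [q] \<cdot> r = \<zero> \<Longrightarrow> r = \<zero>"
  shows "\<exists>z\<in>carrier R. (\<Oplus>h\<in>carrier G. x (h \<otimes>\<^bsub>G\<^esub> g \<otimes>\<^bsub>G\<^esub> inv\<^bsub>G\<^esub> h)) = [q] \<cdot> z"
proof -
  let ?D = "diag_at \<Lambda> 0 (\<one>\<^bsub>\<Lambda>\<^esub> \<oplus>\<^bsub>\<Lambda>\<^esub> [q] \<cdot>\<^bsub>\<Lambda>\<^esub> x)" and ?E = "diag_at \<Lambda> 0 (\<one>\<^bsub>\<Lambda>\<^esub> \<oplus>\<^bsub>\<Lambda>\<^esub> [(q * q)] \<cdot>\<^bsub>\<Lambda>\<^esub> y)"
  have DG: "?D \<in> carrier (GL \<Lambda>)" "?E \<in> carrier (GL \<Lambda>)" using units by (auto intro: \<Lambda>.diag_at_GL)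
  have "?D \<in> K1_class \<Lambda> ?E"
    unfolding K1[symmetric] unfolding K1_class_def
    by (rule group.rcos_self[OF \<Lambda>.group_GL DG(1) \<Lambda>.subgroup_elementary])
  then obtain u where u: "u \<in> elementary_group \<Lambda>" "?D = mat_mult \<Lambda> u ?E"
    by (auto simp: K1_class_def r_coset_def)
  then obtain m where m: "\<forall>N\<ge>m. u \<in> carrier (mat_monoid \<Lambda> N) \<and> \<delta> N u = \<one>\<^bsub>S\<^esub>"
    using det_blocks_elementary by blast
  define N where "N = Suc m"
  have uN: "u \<in> carrier (mat_monoid \<Lambda> N)" "\<delta> N u = \<one>\<^bsub>S\<^esub>" and N: "N \<ge> 1" using m by (auto simp: N_def)
  have EN: "?E \<in> carrier (mat_monoid \<Lambda> N)" using y N by (intro \<Lambda>.diag_at_mat_monoid) auto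
  let ?t = "\<Oplus>\<^bsub>S\<^esub>s\<in>{..<d}. \<rho> x s s" and ?t' = "\<Oplus>\<^bsub>S\<^esub>s\<in>{..<d}. \<rho> y s s"
  have tc: "?t \<in> carrier S" "?t' \<in> carrier S" using x y by (auto intro!: H.\<Lambda>.finsum_closed)
  have "\<delta> N ?D = \<delta> N ?E"
    using det_blocks_mult[OF uN(1) EN] u(2) uN(2) by (simp add: \<delta>_def)
  moreover obtain z1 where z1: "z1 \<in> carrier S"
    "\<delta> N ?D = \<one>\<^bsub>S\<^esub> \<oplus>\<^bsub>S\<^esub> [q] \<cdot>\<^bsub>S\<^esub> ?t \<oplus>\<^bsub>S\<^esub> [(q * q)] \<cdot>\<^bsub>S\<^esub> z1"
    using det_blocks_diag[OF x N, of q] by blast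
  moreover obtain z2 where z2: "z2 \<in> carrier S"
    "\<delta> N ?E = \<one>\<^bsub>S\<^esub> \<oplus>\<^bsub>S\<^esub> [(q * q)] \<cdot>\<^bsub>S\<^esub> ?t' \<oplus>\<^bsub>S\<^esub> [(q * q * (q * q))] \<cdot>\<^bsub>S\<^esub> z2"
    using det_blocks_diag[OF y N, of "q * q"] by blast
  ultimately have z: "z1 \<in> carrier S" "z2 \<in> carrier S"
    "\<one>\<^bsub>S\<^esub> \<oplus>\<^bsub>S\<^esub> [q] \<cdot>\<^bsub>S\<^esub> ?t \<oplus>\<^bsub>S\<^esub> [(q * q)] \<cdot>\<^bsub>S\<^esub> z1 =
      \<one>\<^bsub>S\<^esub> \<oplus>\<^bsub>S\<^esub> [(q * q)] \<cdot>\<^bsub>S\<^esub> ?t' \<oplus>\<^bsub>S\<^esub> [(q * q * (q * q))] \<cdot>\<^bsub>S\<^esub> z2"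
    by simp_all
  have cancel: "a = b" if "a \<in> carrier R" "b \<in> carrier R" "[q] \<cdot> a = [q] \<cdot> b" for a b
  proof -
    have "[q] \<cdot> (a \<ominus> b) = [q] \<cdot> a \<oplus> [q] \<cdot> (\<ominus> b)" using that(1,2) by (simp add: minus_eq add_pow_add)
    also have "\<dots> = \<zero>" using that by (simp add: add_pow_minus r_neg)
    finally have "a \<ominus> b = \<zero>" using that(1,2) torsion_free[of "a \<ominus> b"] by simp
    then show ?thesis using that(1,2) by simp
  qed
  have gH: "g \<in> carrier H" using g by simp
  let ?T = "\<Oplus>s\<in>{..<d}. x (e s \<otimes>\<^bsub>G\<^esub> g \<otimes>\<^bsub>G\<^esub> inv\<^bsub>G\<^esub> (e s))"
  have Tc: "?T \<in> carrier R" using x g by (intro finsum_closed) auto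
  have tg: "?t g = ?T"
    using x g H.gr_finsum[of "{..<d}" "\<lambda>s. \<rho> x s s" g] by (auto simp: rho_apply intro!: finsum_cong')
  let ?o = "\<one>\<^bsub>S\<^esub> g"
  have "?o \<oplus> [q] \<cdot> ?T \<oplus> [(q * q)] \<cdot> z1 g = ?o \<oplus> [(q * q)] \<cdot> ?t' g \<oplus> [(q * q * (q * q))] \<cdot> z2 g"
    using arg_cong[OF z(3), of "\<lambda>f. f g"] z(1,2) tc
    by (simp add: H.gr_add[OF gH] H.gr_add_pow[OF _ gH] tg)
  moreover have oc: "?o \<in> carrier R" "z1 g \<in> carrier R" "z2 g \<in> carrier R" "?t' g \<in> carrier R"
    using H.gr_closed[OF _ gH] z tc by auto
  ultimately have "[q] \<cdot> ?T \<oplus> [(q * q)] \<cdot> z1 g = [(q * q)] \<cdot> ?t' g \<oplus> [(q * q * (q * q))] \<cdot> z2 g"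
    using Tc by (simp add: a_assoc)
  then have "[q] \<cdot> ?T \<oplus> [q] \<cdot> ([q] \<cdot> z1 g) = [q] \<cdot> ([q] \<cdot> ?t' g) \<oplus> [q] \<cdot> ([q] \<cdot> ([(q * q)] \<cdot> z2 g))"
    using oc by (simp add: add_pow_pow mult.assoc)
  then have "[q] \<cdot> (?T \<oplus> [q] \<cdot> z1 g) = [q] \<cdot> ([q] \<cdot> ?t' g \<oplus> [q] \<cdot> ([(q * q)] \<cdot> z2 g))"
    using oc Tc by (simp add: add_pow_add)
  then have "?T \<oplus> [q] \<cdot> z1 g = [q] \<cdot> ?t' g \<oplus> [q] \<cdot> ([(q * q)] \<cdot> z2 g)"
    using cancel[of "?T \<oplus> [q] \<cdot> z1 g" "[q] \<cdot> ?t' g \<oplus> [q] \<cdot> ([(q * q)] \<cdot> z2 g)"] oc Tc by simp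
  then have "?T \<oplus> [q] \<cdot> z1 g \<ominus> [q] \<cdot> z1 g = [q] \<cdot> (?t' g \<oplus> [(q * q)] \<cdot> z2 g \<ominus> z1 g)"
    using oc by (simp add: minus_eq add_pow_add add_pow_minus)
  then have Tq: "?T = [q] \<cdot> (?t' g \<oplus> [(q * q)] \<cdot> z2 g \<ominus> z1 g)"
    using oc Tc by (simp add: minus_eq a_assoc r_neg)
  \<comment> \<open>All elements of a coset e_s C conjugate g in the same way, because C commutes
    with g; so this is \<open>card C\<close> times the sum over representatives.\<close>
  have "(\<Oplus>h\<in>carrier G. x (h \<otimes>\<^bsub>G\<^esub> g \<otimes>\<^bsub>G\<^esub> inv\<^bsub>G\<^esub> h)) =
    (\<Oplus>s\<in>{..<d}. \<Oplus>c\<in>C. x ((e s \<otimes>\<^bsub>G\<^esub> c) \<otimes>\<^bsub>G\<^esub> g \<otimes>\<^bsub>G\<^esub> inv\<^bsub>G\<^esub> (e s \<otimes>\<^bsub>G\<^esub> c)))"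
    using x g by (intro finsum_reps) auto
  also have "\<dots> = (\<Oplus>s\<in>{..<d}. \<Oplus>c\<in>C. x (e s \<otimes>\<^bsub>G\<^esub> g \<otimes>\<^bsub>G\<^esub> inv\<^bsub>G\<^esub> (e s)))"
  proof -
    have "(e s \<otimes>\<^bsub>G\<^esub> c) \<otimes>\<^bsub>G\<^esub> g \<otimes>\<^bsub>G\<^esub> inv\<^bsub>G\<^esub> (e s \<otimes>\<^bsub>G\<^esub> c) = e s \<otimes>\<^bsub>G\<^esub> g \<otimes>\<^bsub>G\<^esub> inv\<^bsub>G\<^esub> (e s)"
      if "s < d" "c \<in> C" for s c
    proof -
      have "(e s \<otimes>\<^bsub>G\<^esub> c) \<otimes>\<^bsub>G\<^esub> g \<otimes>\<^bsub>G\<^esub> inv\<^bsub>G\<^esub> (e s \<otimes>\<^bsub>G\<^esub> c) = e s \<otimes>\<^bsub>G\<^esub> (c \<otimes>\<^bsub>G\<^esub> g) \<otimes>\<^bsub>G\<^esub> (inv\<^bsub>G\<^esub> c \<otimes>\<^bsub>G\<^esub> inv\<^bsub>G\<^esub> (e s))"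
        using that g by (simp add: G.inv_mult_group G.m_assoc)
      also have "c \<otimes>\<^bsub>G\<^esub> g = g \<otimes>\<^bsub>G\<^esub> c" using that g by (intro comm)
      also have "e s \<otimes>\<^bsub>G\<^esub> (g \<otimes>\<^bsub>G\<^esub> c) \<otimes>\<^bsub>G\<^esub> (inv\<^bsub>G\<^esub> c \<otimes>\<^bsub>G\<^esub> inv\<^bsub>G\<^esub> (e s)) = e s \<otimes>\<^bsub>G\<^esub> g \<otimes>\<^bsub>G\<^esub> (c \<otimes>\<^bsub>G\<^esub> inv\<^bsub>G\<^esub> c) \<otimes>\<^bsub>G\<^esub> inv\<^bsub>G\<^esub> (e s)"
        using that g by (simp only: G.m_assoc G.m_closed G.inv_closed e_closed C_carrier)
      finally show ?thesis using that g by simp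
    qed
    then show ?thesis using x g by (intro finsum_cong' refl) (auto intro!: finsum_closed)
  qed
  also have "\<dots> = (\<Oplus>s\<in>{..<d}. [card C] \<cdot> x (e s \<otimes>\<^bsub>G\<^esub> g \<otimes>\<^bsub>G\<^esub> inv\<^bsub>G\<^esub> (e s)))"
    using x g by (intro finsum_cong') (auto simp: add.finprod_const)
  also have "\<dots> = [card C] \<cdot> ?T"
    by (rule add_pow_finsum[symmetric]) (use x g in auto)
  also have "\<dots> = [q] \<cdot> ([card C] \<cdot> (?t' g \<oplus> [(q * q)] \<cdot> z2 g \<ominus> z1 g))"
    unfolding Tq using oc by (simp add: add_pow_pow mult.commute)
  finally show ?thesis using oc by blast
qed

end

section \<open>Successive approximation\<close>

lemma (in group) coset_representatives_exist:
  assumes fin: "finite (carrier G)" and C: "subgroup C G"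
  shows "\<exists>(e :: nat \<Rightarrow> 'a) d. (\<forall>s<d. e s \<in> carrier G) \<and>
    bij_betw (\<lambda>p. e (fst p) \<otimes> snd p) ({..<d} \<times> C) (carrier G)"
proof -
  define K where "K = (\<lambda>x. x <# C) ` carrier G"
  obtain h where h: "bij_betw h {0..<card K} K"
    using ex_bij_betw_nat_finite[of K] fin by (auto simp: K_def)
  define e where "e = (\<lambda>s. SOME x. x \<in> carrier G \<and> x <# C = h s)"
  have e: "e s \<in> carrier G \<and> e s <# C = h s" if "s < card K" for s
  proof -
    have "h s \<in> K" using that bij_betwE[OF h] by simp
    then have "\<exists>x. x \<in> carrier G \<and> x <# C = h s" by (auto simp: K_def)
    then show ?thesis unfolding e_def by (rule someI_ex)
  qed
  have Cc: "c \<in> carrier G" if "c \<in> C" for c using subgroup.mem_carrier[OF C that] .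
  have coset: "x \<otimes> c <# C = x <# C" if "x \<in> carrier G" "c \<in> C" for x c
    using l_repr_independence[of "x \<otimes> c" x C] that C by (auto simp: l_coset_def)
  have "inj_on (\<lambda>p. e (fst p) \<otimes> snd p) ({..<card K} \<times> C)"
  proof (rule inj_onI)
    fix p q assume p: "p \<in> {..<card K} \<times> C" and q: "q \<in> {..<card K} \<times> C"
      and eq: "e (fst p) \<otimes> snd p = e (fst q) \<otimes> snd q"
    have P: "fst p < card K" "snd p \<in> C" "fst q < card K" "snd q \<in> C" using p q by auto
    have "e (fst p) <# C = e (fst q) <# C"
      using coset[of "e (fst p)" "snd p"] coset[of "e (fst q)" "snd q"] e P eq by simp
    then have "h (fst p) = h (fst q)" using e P by simp
    then have "fst p = fst q" using bij_betw_imp_inj_on[OF h] P by (auto dest: inj_onD)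
    moreover have "snd p = snd q" using eq e P Cc calculation by (metis l_cancel)
    ultimately show "p = q" by (simp add: prod_eq_iff)
  qed
  moreover have "(\<lambda>p. e (fst p) \<otimes> snd p) ` ({..<card K} \<times> C) = carrier G"
  proof (intro equalityI subsetI)
    fix g assume g: "g \<in> carrier G"
    then have "g <# C \<in> K" by (auto simp: K_def)
    then obtain s where s: "s < card K" "h s = g <# C"
      using bij_betw_imp_surj_on[OF h] by (metis atLeastLessThan_iff imageE)
    have "g \<in> g <# C" using g subgroup.one_closed[OF C] by (force simp: l_coset_def)
    then have "g \<in> e s <# C" using e s by simp
    then obtain c where "c \<in> C" "g = e s \<otimes> c" by (auto simp: l_coset_def)
    then show "g \<in> (\<lambda>p. e (fst p) \<otimes> snd p) ` ({..<card K} \<times> C)"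
      using s(1) by (intro image_eqI[of _ _ "(s, c)"]) auto
  qed (use e Cc in auto)
  ultimately show ?thesis
    using e by (intro exI[of _ e] exI[of _ "card K"]) (auto simp: bij_betw_def)
qed

section \<open>Congruences for products of quotients of units\<close>

context padic_complete_ring
begin

text \<open>Here u - 1 is divisible by p, so it pushes a from p^m to p^(m+1). First-order
  corrections may thus be multiplied by such u without effect.\<close>

lemma absorb:
  assumes a: "a \<in> P m" and u: "u \<in> carrier R" "proj 1 u = proj 1 \<one>"
  shows "proj (Suc m) (a \<otimes> u) = proj (Suc m) a" "proj (Suc m) (u \<otimes> a) = proj (Suc m) a"
proof -
  have ac: "a \<in> carrier R" using a by (rule padic_ideal_carrier)
  have u1: "u \<ominus> \<one> \<in> P 1" using u by (simp add: padic_proj_eq_iff)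
  have "a \<otimes> u \<ominus> a = a \<otimes> (u \<ominus> \<one>)" "u \<otimes> a \<ominus> a = (u \<ominus> \<one>) \<otimes> a"
    using ac u by (simp_all add: minus_eq r_distr l_distr r_minus l_minus)
  moreover have "a \<otimes> (u \<ominus> \<one>) \<in> P (Suc m)" "(u \<ominus> \<one>) \<otimes> a \<in> P (Suc m)"
    using padic_ideal_mult[OF a u1] padic_ideal_mult[OF u1 a] by simp_all
  ultimately show "proj (Suc m) (a \<otimes> u) = proj (Suc m) a" "proj (Suc m) (u \<otimes> a) = proj (Suc m) a"
    using ac u by (simp_all add: padic_proj_eq_iff)
qed

lemma proj_zero: "x \<in> P n \<Longrightarrow> proj n x = \<zero>\<^bsub>Q n\<^esub>"
proof -
  interpret h: ring_hom_ring R "Q n" "proj n" by (rule proj_hom)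
  assume x: "x \<in> P n"
  then have "proj n x = proj n \<zero>" using padic_ideal_carrier[OF x] by (simp add: padic_proj_eq_iff minus_eq del: h.hom_zero)
  then show ?thesis by simp
qed

lemma proj_one_plus: "x \<in> P n \<Longrightarrow> proj n (\<one> \<oplus> x) = proj n \<one>"
  using padic_ideal_carrier[of x p n] by (simp add: padic_proj_eq_iff minus_eq a_ac r_neg2 r_neg)

lemma proj_inv_cong:
  assumes "a \<in> Units R" "b \<in> Units R" "proj n a = proj n b"
  shows "proj n (inv a) = proj n (inv b)"
proof -
  interpret h: ring_hom_ring R "Q n" "proj n" by (rule proj_hom)
  have c: "a \<in> carrier R" "b \<in> carrier R" "inv a \<in> carrier R" "inv b \<in> carrier R" using assms by auto
  have "proj n (inv a) = proj n (inv a \<otimes> (b \<otimes> inv b))" using assms c by simp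
  also have "\<dots> = proj n (inv a \<otimes> (a \<otimes> inv b))" using assms(3) c by (simp add: h.hom_mult)
  also have "inv a \<otimes> (a \<otimes> inv b) = inv b" using assms c by (simp add: m_assoc[symmetric])
  finally show ?thesis .
qed

lemma units_one_plus: "x \<in> P 1 \<Longrightarrow> \<one> \<oplus> x \<in> Units R"
  by (rule one_plus_unit[of _ 1]) auto

lemma quot_factor_one:
  assumes "y \<in> P 1" "z \<in> P 1"
  shows "proj 1 ((\<one> \<oplus> y) \<otimes> inv (\<one> \<oplus> z)) = proj 1 \<one>"
proof -
  interpret h: ring_hom_ring R "Q 1" "proj 1" by (rule proj_hom)
  have U: "\<one> \<oplus> z \<in> Units R" "\<one> \<oplus> y \<in> Units R" using assms by (auto intro: units_one_plus)
  have "proj 1 (inv (\<one> \<oplus> z)) = proj 1 (inv \<one>)"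
    using U proj_one_plus[OF assms(2)] by (intro proj_inv_cong) auto
  then have "proj 1 ((\<one> \<oplus> y) \<otimes> inv (\<one> \<oplus> z)) = proj 1 (\<one> \<oplus> y) \<otimes>\<^bsub>Q 1\<^esub> proj 1 \<one>"
    using U by (subst h.hom_mult) auto
  then show ?thesis using proj_one_plus[OF assms(1)] by (simp del: One_nat_def h.hom_add)
qed

text \<open>The inverse is never expanded. With f the old quotient, (f + dy - dz)(1 + z + dz) is
  congruent to (1 + y) + dz + (dy - dz) = 1 + y + dy, because f and the new denominator are 1 modulo
  p and get absorbed. It remains to multiply by the inverse denominator.\<close>

lemma factor_step:
  assumes m: "m \<ge> 1" and y: "y \<in> P 1" and z: "z \<in> P 1" and dy: "dy \<in> P m" and dz: "dz \<in> P m"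
  shows "proj (Suc m) ((\<one> \<oplus> (y \<oplus> dy)) \<otimes> inv (\<one> \<oplus> (z \<oplus> dz))) =
    proj (Suc m) ((\<one> \<oplus> y) \<otimes> inv (\<one> \<oplus> z) \<oplus> (dy \<ominus> dz))"
proof -
  interpret h: ring_hom_ring R "Q (Suc m)" "proj (Suc m)" by (rule proj_hom)
  interpret I1: ideal "P 1" R by (rule padic_ideal_ideal)
  interpret Im: ideal "P m" R by (rule padic_ideal_ideal)
  have d1: "dy \<in> P 1" "dz \<in> P 1" using m dy dz padic_ideal_mono[of 1 m p] by auto
  have c: "y \<in> carrier R" "z \<in> carrier R" "dy \<in> carrier R" "dz \<in> carrier R"
    using y z dy dz padic_ideal_carrier by auto
  define w where "w = \<one> \<oplus> (z \<oplus> dz)"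
  define f where "f = (\<one> \<oplus> y) \<otimes> inv (\<one> \<oplus> z)"
  have zU: "\<one> \<oplus> z \<in> Units R" "\<one> \<oplus> y \<in> Units R" using z y by (auto intro: units_one_plus)
  have zz: "z \<oplus> dz \<in> P 1" using z d1 by (rule_tac I1.a_closed)
  have wU: "w \<in> Units R" unfolding w_def using zz by (rule units_one_plus)
  have wc: "w \<in> carrier R" "inv w \<in> carrier R" using wU by auto
  have w1: "proj 1 w = proj 1 \<one>" unfolding w_def by (rule proj_one_plus[OF zz])
  have fc: "f \<in> carrier R" using zU c by (simp add: f_def)
  have f1: "proj 1 f = proj 1 \<one>" unfolding f_def by (rule quot_factor_one[OF y z])
  have fz: "f \<otimes> (\<one> \<oplus> z) = \<one> \<oplus> y" unfolding f_def using zU c by (simp add: m_assoc)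
  have dd: "dy \<ominus> dz \<in> P m" using dy dz by (simp add: minus_eq)
  have "proj (Suc m) ((f \<oplus> (dy \<ominus> dz)) \<otimes> w) =
    proj (Suc m) (f \<otimes> (\<one> \<oplus> z) \<oplus> f \<otimes> dz \<oplus> (dy \<ominus> dz) \<otimes> w)"
  proof -
    have "(f \<oplus> (dy \<ominus> dz)) \<otimes> w = f \<otimes> w \<oplus> (dy \<ominus> dz) \<otimes> w" using fc c wc by (simp add: l_distr)
    also have "f \<otimes> w = f \<otimes> (\<one> \<oplus> z) \<oplus> f \<otimes> dz" unfolding w_def using fc c by (simp add: r_distr a_assoc)
    finally show ?thesis by simp
  qed
  also have "\<dots> = proj (Suc m) (\<one> \<oplus> y) \<oplus>\<^bsub>Q (Suc m)\<^esub> proj (Suc m) (f \<otimes> dz) \<oplus>\<^bsub>Q (Suc m)\<^esub> proj (Suc m) ((dy \<ominus> dz) \<otimes> w)"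
    unfolding fz using fc c wc by (subst h.hom_add, simp, simp)+ simp
  also have "\<dots> = proj (Suc m) (\<one> \<oplus> y) \<oplus>\<^bsub>Q (Suc m)\<^esub> proj (Suc m) dz \<oplus>\<^bsub>Q (Suc m)\<^esub> proj (Suc m) (dy \<ominus> dz)"
    by (simp only: absorb(2)[OF dz fc f1] absorb(1)[OF dd wc(1) w1])
  also have "\<dots> = proj (Suc m) (\<one> \<oplus> y \<oplus> dz \<oplus> (dy \<ominus> dz))"
    using c by simp
  also have "\<one> \<oplus> y \<oplus> dz \<oplus> (dy \<ominus> dz) = \<one> \<oplus> (y \<oplus> dy)"
    using c a_lcomm[of dz dy "\<ominus> dz"] by (simp add: minus_eq a_assoc r_neg)
  finally have eq: "proj (Suc m) ((f \<oplus> (dy \<ominus> dz)) \<otimes> w) = proj (Suc m) (\<one> \<oplus> (y \<oplus> dy))" .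
  have "proj (Suc m) ((\<one> \<oplus> (y \<oplus> dy)) \<otimes> inv w) = proj (Suc m) (((f \<oplus> (dy \<ominus> dz)) \<otimes> w) \<otimes> inv w)"
    using eq c wc fc by (subst (1 2) h.hom_mult) (auto simp del: h.hom_add h.hom_mult)
  also have "((f \<oplus> (dy \<ominus> dz)) \<otimes> w) \<otimes> inv w = f \<oplus> (dy \<ominus> dz)"
    using c wc fc wU by (simp add: m_assoc)
  finally show ?thesis unfolding w_def f_def .
qed

lemma prod_step:
  assumes a: "a \<in> carrier R" "a' \<in> carrier R" "proj 1 a = proj 1 \<one>" "da \<in> P m" "proj (Suc m) a' = proj (Suc m) (a \<oplus> da)"
    and b: "b \<in> carrier R" "b' \<in> carrier R" "proj 1 b = proj 1 \<one>" "db \<in> P m" "proj (Suc m) b' = proj (Suc m) (b \<oplus> db)"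
    and m: "m \<ge> 1"
  shows "proj (Suc m) (a' \<otimes> b') = proj (Suc m) (a \<otimes> b \<oplus> (da \<oplus> db))"
proof -
  interpret h: ring_hom_ring R "Q (Suc m)" "proj (Suc m)" by (rule proj_hom)
  interpret h1: ring_hom_ring R "Q 1" "proj 1" by (rule proj_hom)
  have d: "da \<in> carrier R" "db \<in> carrier R" using a b padic_ideal_carrier by auto
  have db1: "db \<in> P 1" using b(4) m padic_ideal_mono[of 1 m p] by auto
  have bb: "proj 1 (b \<oplus> db) = proj 1 \<one>"
    using b d proj_zero[OF db1] by (simp del: One_nat_def)
  have "proj (Suc m) (a' \<otimes> b') = proj (Suc m) ((a \<oplus> da) \<otimes> (b \<oplus> db))"
    using a b d by (simp add: h.hom_mult del: h.hom_add)
  also have "(a \<oplus> da) \<otimes> (b \<oplus> db) = a \<otimes> b \<oplus> (da \<otimes> (b \<oplus> db) \<oplus> a \<otimes> db)"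
    using a b d by (simp add: l_distr r_distr a_ac)
  also have "proj (Suc m) \<dots> = proj (Suc m) (a \<otimes> b) \<oplus>\<^bsub>Q (Suc m)\<^esub> (proj (Suc m) (da \<otimes> (b \<oplus> db)) \<oplus>\<^bsub>Q (Suc m)\<^esub> proj (Suc m) (a \<otimes> db))"
    using a b d by (simp del: h.hom_mult)
  also have "\<dots> = proj (Suc m) (a \<otimes> b) \<oplus>\<^bsub>Q (Suc m)\<^esub> (proj (Suc m) da \<oplus>\<^bsub>Q (Suc m)\<^esub> proj (Suc m) db)"
    using absorb(1)[OF a(4) _ bb] absorb(2)[OF b(4) a(1,3)] b d by simp
  also have "\<dots> = proj (Suc m) (a \<otimes> b \<oplus> (da \<oplus> db))"
    using a b d by (simp del: h.hom_mult)
  finally show ?thesis .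
qed

text \<open>A list fixes the order of the factors, which do not commute.\<close>

primrec quot_prod :: "('i \<Rightarrow> 'a) \<Rightarrow> ('i \<Rightarrow> 'a) \<Rightarrow> 'i list \<Rightarrow> 'a" where
  "quot_prod Y Z [] = \<one>"
| "quot_prod Y Z (i # L) = (\<one> \<oplus> Y i) \<otimes> inv (\<one> \<oplus> Z i) \<otimes> quot_prod Y Z L"

lemma quot_prod_eqI:
  "(\<And>i. i \<in> set L \<Longrightarrow> Y i = Y' i) \<Longrightarrow> (\<And>i. i \<in> set L \<Longrightarrow> Z i = Z' i) \<Longrightarrow>
    quot_prod Y Z L = quot_prod Y' Z' L"
  by (induction L) simp_all

lemma quot_factor_unit: "y \<in> P 1 \<Longrightarrow> z \<in> P 1 \<Longrightarrow> (\<one> \<oplus> y) \<otimes> inv (\<one> \<oplus> z) \<in> Units R"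
  by (simp add: units_one_plus)

lemma quot_prod_unit:
  "(\<And>i. i \<in> set L \<Longrightarrow> Y i \<in> P 1 \<and> Z i \<in> P 1) \<Longrightarrow> quot_prod Y Z L \<in> Units R"
  by (induction L) (auto simp: quot_factor_unit)

lemma quot_prod_one:
  "(\<And>i. i \<in> set L \<Longrightarrow> Y i \<in> P 1 \<and> Z i \<in> P 1) \<Longrightarrow> proj 1 (quot_prod Y Z L) = proj 1 \<one>"
proof (induction L)
  case (Cons i L)
  interpret h: ring_hom_ring R "Q 1" "proj 1" by (rule proj_hom)
  have U: "(\<one> \<oplus> Y i) \<otimes> inv (\<one> \<oplus> Z i) \<in> Units R" "quot_prod Y Z L \<in> Units R"
    using Cons.prems quot_factor_unit quot_prod_unit[of L Y Z] by auto
  have "proj 1 (quot_prod Y Z (i # L)) = proj 1 ((\<one> \<oplus> Y i) \<otimes> inv (\<one> \<oplus> Z i)) \<otimes>\<^bsub>Q 1\<^esub> proj 1 (quot_prod Y Z L)"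
    unfolding quot_prod.simps using U by (intro h.hom_mult) auto
  also have "\<dots> = proj 1 \<one>"
    using Cons quot_factor_one[of "Y i" "Z i"] by (simp del: One_nat_def h.hom_add h.hom_mult)
  finally show ?case .
qed simp

lemma quot_prod_cong:
  assumes "\<And>i. i \<in> set L \<Longrightarrow> Y i \<in> P 1 \<and> Z i \<in> P 1 \<and> Y' i \<in> P 1 \<and> Z' i \<in> P 1"
    "\<And>i. i \<in> set L \<Longrightarrow> proj n (Y i) = proj n (Y' i) \<and> proj n (Z i) = proj n (Z' i)"
  shows "proj n (quot_prod Y Z L) = proj n (quot_prod Y' Z' L)"
  using assms
proof (induction L)
  case (Cons i L)
  interpret h: ring_hom_ring R "Q n" "proj n" by (rule proj_hom)
  have I: "Y i \<in> P 1" "Z i \<in> P 1" "Y' i \<in> P 1" "Z' i \<in> P 1" using Cons.prems(1)[of i] by auto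
  have c: "Y i \<in> carrier R" "Z i \<in> carrier R" "Y' i \<in> carrier R" "Z' i \<in> carrier R"
    using I padic_ideal_carrier by auto
  have U: "\<one> \<oplus> Y i \<in> Units R" "\<one> \<oplus> Z i \<in> Units R" "\<one> \<oplus> Y' i \<in> Units R" "\<one> \<oplus> Z' i \<in> Units R"
    using I units_one_plus by auto
  have Q: "quot_prod Y Z L \<in> Units R" "quot_prod Y' Z' L \<in> Units R"
    using Cons.prems(1) by (auto intro!: quot_prod_unit)
  have "proj n (\<one> \<oplus> Y i) = proj n (\<one> \<oplus> Y' i)" "proj n (\<one> \<oplus> Z i) = proj n (\<one> \<oplus> Z' i)"
    using Cons.prems(2)[of i] c by simp_all
  moreover then have "proj n (inv (\<one> \<oplus> Z i)) = proj n (inv (\<one> \<oplus> Z' i))"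
    using U by (intro proj_inv_cong) auto
  moreover have "proj n (quot_prod Y Z L) = proj n (quot_prod Y' Z' L)"
    using Cons by auto
  ultimately show ?case
    using U Q by (simp add: Units_closed del: h.hom_add)
qed simp

text \<open>To first order the changes of the factors add up; neither their order nor the remaining
  factors matter modulo p^(m+1). Distinctness turns the sum along the list into one over its
  set.\<close>

lemma quot_prod_step:
  assumes "distinct L" "m \<ge> 1"
    and "\<And>i. i \<in> set L \<Longrightarrow> Y i \<in> P 1 \<and> Z i \<in> P 1 \<and> dY i \<in> P m \<and> dZ i \<in> P m"
  shows "proj (Suc m) (quot_prod (\<lambda>i. Y i \<oplus> dY i) (\<lambda>i. Z i \<oplus> dZ i) L) =
    proj (Suc m) (quot_prod Y Z L \<oplus> (\<Oplus>i\<in>set L. dY i \<ominus> dZ i))"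
  using assms(1,3)
proof (induction L)
  case (Cons i L)
  interpret I1: ideal "P 1" R by (rule padic_ideal_ideal)
  interpret Im: ideal "P m" R by (rule padic_ideal_ideal)
  have I: "Y j \<in> P 1" "Z j \<in> P 1" "dY j \<in> P m" "dZ j \<in> P m" if "j \<in> insert i (set L)" for j
    using Cons.prems(2)[of j] that by auto
  have sub: "P m \<subseteq> P 1" using assms(2) by (rule padic_ideal_mono)
  have I': "Y j \<oplus> dY j \<in> P 1" "Z j \<oplus> dZ j \<in> P 1" if "j \<in> insert i (set L)" for j
    using I[OF that] sub by (auto simp del: One_nat_def intro!: I1.a_closed)
  have dd: "dY j \<ominus> dZ j \<in> P m" if "j \<in> insert i (set L)" for j
    using I[OF that] by (simp add: minus_eq)
  have sum: "(\<Oplus>i\<in>A. dY i \<ominus> dZ i) \<in> P m" if "finite A" "A \<subseteq> insert i (set L)" for A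
    using that
  proof (induction A rule: finite_induct)
    case (insert a A)
    then have "(\<Oplus>i\<in>insert a A. dY i \<ominus> dZ i) = (dY a \<ominus> dZ a) \<oplus> (\<Oplus>i\<in>A. dY i \<ominus> dZ i)"
      using dd padic_ideal_carrier by (intro finsum_insert) auto
    then show ?case using insert dd by auto
  qed simp
  have F: "(\<one> \<oplus> Y i) \<otimes> inv (\<one> \<oplus> Z i) \<in> Units R"
    "(\<one> \<oplus> (Y i \<oplus> dY i)) \<otimes> inv (\<one> \<oplus> (Z i \<oplus> dZ i)) \<in> Units R"
    using I I' by (auto intro!: quot_factor_unit)
  have Qu: "quot_prod Y Z L \<in> Units R" "quot_prod (\<lambda>i. Y i \<oplus> dY i) (\<lambda>i. Z i \<oplus> dZ i) L \<in> Units R"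
    using I I' by (auto intro!: quot_prod_unit)
  have "proj (Suc m) (quot_prod (\<lambda>i. Y i \<oplus> dY i) (\<lambda>i. Z i \<oplus> dZ i) (i # L)) =
    proj (Suc m) ((\<one> \<oplus> Y i) \<otimes> inv (\<one> \<oplus> Z i) \<otimes> quot_prod Y Z L \<oplus>
      ((dY i \<ominus> dZ i) \<oplus> (\<Oplus>i\<in>set L. dY i \<ominus> dZ i)))"
    unfolding quot_prod.simps
  proof (rule prod_step)
    show "proj 1 ((\<one> \<oplus> Y i) \<otimes> inv (\<one> \<oplus> Z i)) = proj 1 \<one>" using I by (intro quot_factor_one) auto
    show "proj 1 (quot_prod Y Z L) = proj 1 \<one>" using I by (intro quot_prod_one) auto
    show "proj (Suc m) ((\<one> \<oplus> (Y i \<oplus> dY i)) \<otimes> inv (\<one> \<oplus> (Z i \<oplus> dZ i))) =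
      proj (Suc m) ((\<one> \<oplus> Y i) \<otimes> inv (\<one> \<oplus> Z i) \<oplus> (dY i \<ominus> dZ i))"
      using I assms(2) by (intro factor_step) auto
    show "proj (Suc m) (quot_prod (\<lambda>i. Y i \<oplus> dY i) (\<lambda>i. Z i \<oplus> dZ i) L) =
      proj (Suc m) (quot_prod Y Z L \<oplus> (\<Oplus>i\<in>set L. dY i \<ominus> dZ i))"
      using Cons by simp
  qed (use F Qu dd sum assms(2) in auto)
  moreover have "(\<Oplus>j\<in>set (i # L). dY j \<ominus> dZ j) = (dY i \<ominus> dZ i) \<oplus> (\<Oplus>i\<in>set L. dY i \<ominus> dZ i)"
    unfolding list.set(2) using Cons.prems(1) dd padic_ideal_carrier by (intro finsum_insert) auto
  ultimately show ?case by simp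
qed simp

lemma K1_class_quot_prod:
  assumes "\<And>i. i \<in> set L \<Longrightarrow> Y i \<in> P 1 \<and> Z i \<in> P 1 \<and>
    K1_class R (diag_at R 0 (\<one> \<oplus> Y i)) = K1_class R (diag_at R 0 (\<one> \<oplus> Z i))"
  shows "K1_class R (diag_at R 0 (quot_prod Y Z L)) = \<one>\<^bsub>K1 R\<^esub>"
  using assms
proof (induction L)
  case Nil
  then show ?case by (simp add: diag_at_one K1_class_elementary elementary_one)
next
  case (Cons i L)
  interpret K: group "K1 R" by (rule group_K1)
  have K: "K1_class R (diag_at R 0 (a \<otimes> b)) = K1_class R (diag_at R 0 a) \<otimes>\<^bsub>K1 R\<^esub> K1_class R (diag_at R 0 b)"
    if "a \<in> Units R" "b \<in> Units R" for a b
    using that by (simp add: K1_class_mult[symmetric] diag_at_GL diag_at_mult_diag Units_closed)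
  have U: "\<one> \<oplus> Y i \<in> Units R" "\<one> \<oplus> Z i \<in> Units R" using Cons.prems[of i] by (auto intro!: units_one_plus)
  have Q: "quot_prod Y Z L \<in> Units R" using Cons.prems by (intro quot_prod_unit) auto
  have "K1_class R (diag_at R 0 (\<one> \<oplus> Z i)) \<otimes>\<^bsub>K1 R\<^esub> K1_class R (diag_at R 0 (inv (\<one> \<oplus> Z i))) = \<one>\<^bsub>K1 R\<^esub>"
    unfolding K[OF U(2) Units_inv_Units[OF U(2)], symmetric]
    using U(2) by (simp add: diag_at_one K1_class_elementary elementary_one)
  then have "K1_class R (diag_at R 0 ((\<one> \<oplus> Y i) \<otimes> inv (\<one> \<oplus> Z i))) = \<one>\<^bsub>K1 R\<^esub>"
    using U Cons.prems[of i] by (simp add: K)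
  then show ?case using Cons U Q by (simp add: K[of "(\<one> \<oplus> Y i) \<otimes> inv (\<one> \<oplus> Z i)"])
qed

end

section \<open>Conjugacy classes, class sums and commutators\<close>

definition conj_class :: "('g, 'k) monoid_scheme \<Rightarrow> 'g \<Rightarrow> 'g set" where
  "conj_class G g = (\<lambda>h. h \<otimes>\<^bsub>G\<^esub> g \<otimes>\<^bsub>G\<^esub> inv\<^bsub>G\<^esub> h) ` carrier G"

text \<open>The choice depends only on the class as a set, so conjugate elements receive the same
  representative.\<close>

definition class_rep :: "('g, 'k) monoid_scheme \<Rightarrow> 'g \<Rightarrow> 'g" where
  "class_rep G g = (SOME y. y \<in> conj_class G g)"

context group
begin

lemma conj_class_subset: "g \<in> carrier G \<Longrightarrow> conj_class G g \<subseteq> carrier G"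
  by (auto simp: conj_class_def)

lemma conj_class_self: "g \<in> carrier G \<Longrightarrow> g \<in> conj_class G g"
  unfolding conj_class_def by (rule image_eqI[of _ _ \<one>]) auto

lemma conj_conj:
  "a \<in> carrier G \<Longrightarrow> b \<in> carrier G \<Longrightarrow> g \<in> carrier G \<Longrightarrow>
    a \<otimes> (b \<otimes> g \<otimes> inv b) \<otimes> inv a = (a \<otimes> b) \<otimes> g \<otimes> inv (a \<otimes> b)"
  by (simp add: inv_mult_group m_assoc)

lemma conj_class_eq:
  assumes g: "g \<in> carrier G" and x: "x \<in> conj_class G g"
  shows "conj_class G x = conj_class G g"
proof -
  obtain h where h: "h \<in> carrier G" "x = h \<otimes> g \<otimes> inv h" using x by (auto simp: conj_class_def)
  have gx: "g = inv h \<otimes> x \<otimes> inv (inv h)" unfolding h(2) using conj_conj[of "inv h" h g] h(1) g by simp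
  show ?thesis
  proof (intro equalityI subsetI)
    fix y assume "y \<in> conj_class G x"
    then obtain k where k: "k \<in> carrier G" "y = k \<otimes> x \<otimes> inv k" by (auto simp: conj_class_def)
    then have "y = (k \<otimes> h) \<otimes> g \<otimes> inv (k \<otimes> h)" unfolding k(2) h(2) using h(1) g by (intro conj_conj)
    then show "y \<in> conj_class G g" using k h(1) by (auto simp: conj_class_def)
  next
    fix y assume "y \<in> conj_class G g"
    then obtain k where k: "k \<in> carrier G" "y = k \<otimes> g \<otimes> inv k" by (auto simp: conj_class_def)
    have "x \<in> carrier G" using h g by simp
    then have "y = (k \<otimes> inv h) \<otimes> x \<otimes> inv (k \<otimes> inv h)"
      unfolding k(2) by (subst gx) (use h(1) k(1) in \<open>intro conj_conj; simp\<close>)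
    then show "y \<in> conj_class G x" using k h(1) unfolding conj_class_def by blast
  qed
qed

lemma class_rep_in: "g \<in> carrier G \<Longrightarrow> class_rep G g \<in> conj_class G g"
  unfolding class_rep_def by (rule someI[of "\<lambda>y. y \<in> conj_class G g" g]) (rule conj_class_self)

lemma class_rep_closed [simp]: "g \<in> carrier G \<Longrightarrow> class_rep G g \<in> carrier G"
  using class_rep_in conj_class_subset by blast

lemma class_rep_eq: "g \<in> carrier G \<Longrightarrow> x \<in> conj_class G g \<Longrightarrow> class_rep G x = class_rep G g"
  by (simp add: class_rep_def conj_class_eq)

lemma class_rep_idem: "g \<in> carrier G \<Longrightarrow> class_rep G (class_rep G g) = class_rep G g"
  by (rule class_rep_eq[OF _ class_rep_in])

lemma conj_class_iff_rep:
  assumes "g \<in> carrier G" "x \<in> carrier G"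
  shows "x \<in> conj_class G g \<longleftrightarrow> class_rep G x = class_rep G g"
proof
  assume "class_rep G x = class_rep G g"
  then have "class_rep G g \<in> conj_class G x" using class_rep_in[OF assms(2)] by simp
  then have "conj_class G x = conj_class G g"
    using conj_class_eq[OF assms(2)] conj_class_eq[OF assms(1) class_rep_in[OF assms(1)]] by metis
  then show "x \<in> conj_class G g" using conj_class_self[OF assms(2)] by simp
qed (rule class_rep_eq[OF assms(1)])

end

context finite_group_ring
begin

text \<open>The fibres of h going to h g h^-1 are cosets of the centralizer of g, so m is the order
  of that centralizer. The bound on m later limits its power of p.\<close>

lemma conj_sum_class_sum:
  assumes f: "f \<in> carrier G \<rightarrow> carrier R" and g: "g \<in> carrier G"
  shows "\<exists>m. 0 < m \<and> m \<le> card (carrier G) \<and>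
    (\<Oplus>h\<in>carrier G. f (h \<otimes>\<^bsub>G\<^esub> g \<otimes>\<^bsub>G\<^esub> inv\<^bsub>G\<^esub> h)) = [(m::nat)] \<cdot> (\<Oplus>x\<in>conj_class G g. f x)"
proof -
  let ?c = "\<lambda>h. h \<otimes>\<^bsub>G\<^esub> g \<otimes>\<^bsub>G\<^esub> inv\<^bsub>G\<^esub> h"
  define Z where "Z = {z \<in> carrier G. ?c z = g}"
  define F where "F = (\<lambda>x. {h \<in> carrier G. ?c h = x})"
  have finC: "finite (conj_class G g)" using fin G.conj_class_subset[OF g] by (rule rev_finite_subset)
  have cardF: "card (F x) = card Z" if x: "x \<in> conj_class G g" for x
  proof -
    obtain k where k: "k \<in> carrier G" "x = ?c k" using x by (auto simp: conj_class_def)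
    have xc: "x \<in> carrier G" using k g by simp
    have gx: "g = inv\<^bsub>G\<^esub> k \<otimes>\<^bsub>G\<^esub> x \<otimes>\<^bsub>G\<^esub> inv\<^bsub>G\<^esub> (inv\<^bsub>G\<^esub> k)"
      unfolding k(2) using G.conj_conj[of "inv\<^bsub>G\<^esub> k" k g] k(1) g by simp
    have "bij_betw (\<lambda>z. k \<otimes>\<^bsub>G\<^esub> z) Z (F x)"
    proof (rule bij_betw_byWitness[where f' = "\<lambda>h. inv\<^bsub>G\<^esub> k \<otimes>\<^bsub>G\<^esub> h"])
      show "\<forall>z\<in>Z. inv\<^bsub>G\<^esub> k \<otimes>\<^bsub>G\<^esub> (k \<otimes>\<^bsub>G\<^esub> z) = z" "\<forall>h\<in>F x. k \<otimes>\<^bsub>G\<^esub> (inv\<^bsub>G\<^esub> k \<otimes>\<^bsub>G\<^esub> h) = h"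
        using k(1) by (auto simp: Z_def F_def G.m_assoc[symmetric])
      show "(\<lambda>z. k \<otimes>\<^bsub>G\<^esub> z) ` Z \<subseteq> F x"
      proof safe
        fix z assume "z \<in> Z"
        then have z: "z \<in> carrier G" "?c z = g" by (auto simp: Z_def)
        have "?c (k \<otimes>\<^bsub>G\<^esub> z) = k \<otimes>\<^bsub>G\<^esub> (?c z) \<otimes>\<^bsub>G\<^esub> inv\<^bsub>G\<^esub> k"
          using k(1) z(1) g by (rule G.conj_conj[symmetric])
        also have "\<dots> = x" unfolding z(2) by (rule k(2)[symmetric])
        finally show "k \<otimes>\<^bsub>G\<^esub> z \<in> F x" using k(1) z(1) by (simp add: F_def)
      qed
      show "(\<lambda>h. inv\<^bsub>G\<^esub> k \<otimes>\<^bsub>G\<^esub> h) ` F x \<subseteq> Z"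
      proof safe
        fix h assume "h \<in> F x"
        then have h: "h \<in> carrier G" "?c h = x" by (auto simp: F_def)
        have "?c (inv\<^bsub>G\<^esub> k \<otimes>\<^bsub>G\<^esub> h) = inv\<^bsub>G\<^esub> k \<otimes>\<^bsub>G\<^esub> (?c h) \<otimes>\<^bsub>G\<^esub> inv\<^bsub>G\<^esub> (inv\<^bsub>G\<^esub> k)"
          using k(1) h(1) g G.conj_conj[of "inv\<^bsub>G\<^esub> k" h g] by simp
        also have "\<dots> = g" unfolding h(2) by (rule gx[symmetric])
        finally show "inv\<^bsub>G\<^esub> k \<otimes>\<^bsub>G\<^esub> h \<in> Z" using k(1) h(1) by (simp add: Z_def)
      qed
    qed
    then show ?thesis by (rule bij_betw_same_card[symmetric])
  qed
  have U: "(\<Union>x\<in>conj_class G g. F x) = carrier G"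
    by (auto simp: F_def conj_class_def)
  have fx: "f x \<in> carrier R" if "x \<in> conj_class G g" for x using f that G.conj_class_subset[OF g] by auto
  have "(\<Oplus>h\<in>carrier G. f (?c h)) = (\<Oplus>h\<in>(\<Union>x\<in>conj_class G g. F x). f (?c h))" unfolding U ..
  also have "\<dots> = (\<Oplus>x\<in>conj_class G g. \<Oplus>h\<in>F x. f (?c h))"
    using finC fin f g by (intro add.finprod_UN_disjoint) (auto simp: F_def pairwise_def disjnt_def)
  also have "\<dots> = (\<Oplus>x\<in>conj_class G g. [card Z] \<cdot> f x)"
  proof (intro finsum_cong' refl)
    fix x assume x: "x \<in> conj_class G g"
    have "(\<Oplus>h\<in>F x. f (?c h)) = (\<Oplus>h\<in>F x. f x)" using fx[OF x] by (intro finsum_cong') (auto simp: F_def)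
    then show "(\<Oplus>h\<in>F x. f (?c h)) = [card Z] \<cdot> f x"
      using fx[OF x] by (simp add: add.finprod_const cardF[OF x])
  qed (use fx in auto)
  also have "\<dots> = [card Z] \<cdot> (\<Oplus>x\<in>conj_class G g. f x)"
    by (rule add_pow_finsum[symmetric]) (use finC fx in auto)
  finally have "(\<Oplus>h\<in>carrier G. f (?c h)) = [card Z] \<cdot> (\<Oplus>x\<in>conj_class G g. f x)" .
  moreover have "\<one>\<^bsub>G\<^esub> \<in> Z" using g by (simp add: Z_def)
  then have "0 < card Z" using fin by (auto simp: Z_def card_gt_0_iff)
  moreover have "card Z \<le> card (carrier G)" using fin by (intro card_mono) (auto simp: Z_def)
  ultimately show ?thesis by blast
qed

lemma gmon_apply: "x \<in> carrier G \<Longrightarrow> gmon R G r g x = (if x = g then r else \<zero>)"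
  by (simp add: gmon_def)

lemma gmon_mult_gmon:
  assumes "r \<in> carrier R" "s \<in> carrier R" "g \<in> carrier G" "h \<in> carrier G"
  shows "gmon R G r g \<otimes>\<^bsub>\<Lambda>\<^esub> gmon R G s h = gmon R G (r \<otimes> s) (g \<otimes>\<^bsub>G\<^esub> h)"
proof (rule gr_eqI)
  fix x assume x: "x \<in> carrier G"
  have "inv\<^bsub>G\<^esub> g \<otimes>\<^bsub>G\<^esub> x = h \<longleftrightarrow> x = g \<otimes>\<^bsub>G\<^esub> h"
    using assms x by (metis G.inv_solve_left)
  then show "(gmon R G r g \<otimes>\<^bsub>\<Lambda>\<^esub> gmon R G s h) x = gmon R G (r \<otimes> s) (g \<otimes>\<^bsub>G\<^esub> h) x"
    using assms x by (simp add: gmon_mult) (simp add: gmon_def)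
qed (use assms in auto)

lemma gmon_padic: "r \<in> padic_ideal p R n \<Longrightarrow> gmon R G r g \<in> padic_ideal p \<Lambda> n"
  using padic_ideal_carrier[of r p n] padic_idealI[of \<zero> p n]
  by (auto simp: gr_padic_ideal gmon_def intro: gr_restrict)

lemma gmon_add_pow:
  "r \<in> carrier R \<Longrightarrow> s \<in> carrier R \<Longrightarrow>
    gmon R G (r \<oplus> [(q::nat)] \<cdot> s) g = gmon R G r g \<oplus>\<^bsub>\<Lambda>\<^esub> [q] \<cdot>\<^bsub>\<Lambda>\<^esub> gmon R G s g"
  by (rule gr_eqI) (auto simp: gr_add gr_add_pow gmon_apply)

text \<open>A difference of monomials rx - rx' with x and x' conjugate is an additive commutator.
  Subtracting these differences moves each coefficient of c to the representative of its class; what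
  is left is the class sum there and zero elsewhere.\<close>

lemma commutator_expansion:
  assumes c: "c \<in> carrier \<Lambda>"
    and cls: "\<And>g. g \<in> carrier G \<Longrightarrow> (\<Oplus>x\<in>conj_class G g. c x) \<in> padic_ideal p R 1"
  shows "c \<ominus>\<^bsub>\<Lambda>\<^esub> (\<Oplus>\<^bsub>\<Lambda>\<^esub>x\<in>carrier G. gmon R G (c x) x \<ominus>\<^bsub>\<Lambda>\<^esub> gmon R G (c x) (class_rep G x)) \<in> padic_ideal p \<Lambda> 1"
proof -
  let ?r = "class_rep G"
  let ?s = "\<Oplus>\<^bsub>\<Lambda>\<^esub>x\<in>carrier G. gmon R G (c x) x \<ominus>\<^bsub>\<Lambda>\<^esub> gmon R G (c x) (?r x)"
  have cc: "c x \<in> carrier R" if "x \<in> carrier G" for x using c that by simp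
  have sc: "?s \<in> carrier \<Lambda>" using cc by (auto intro!: \<Lambda>.finsum_closed)
  have "(c \<ominus>\<^bsub>\<Lambda>\<^esub> ?s) y \<in> padic_ideal p R 1" if y: "y \<in> carrier G" for y
  proof -
    have "?s y = (\<Oplus>x\<in>carrier G. (gmon R G (c x) x \<ominus>\<^bsub>\<Lambda>\<^esub> gmon R G (c x) (?r x)) y)"
      using cc y by (intro gr_finsum) auto
    also have "\<dots> = (\<Oplus>x\<in>carrier G. (if x = y then c x else \<zero>) \<oplus> (if ?r x = y then \<ominus> c x else \<zero>))"
      by (rule finsum_cong') (use cc y in \<open>auto simp: gr_minus gmon_apply minus_eq\<close>)
    also have "\<dots> = (\<Oplus>x\<in>carrier G. if x = y then c x else \<zero>) \<oplus> (\<Oplus>x\<in>carrier G. if ?r x = y then \<ominus> c x else \<zero>)"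
      using cc by (intro finsum_addf) auto
    also have "(\<Oplus>x\<in>carrier G. if x = y then c x else \<zero>) = c y"
      using cc y fin by (subst finsum_single[where k = y]) auto
    also have "(\<Oplus>x\<in>carrier G. if ?r x = y then \<ominus> c x else \<zero>) = (\<Oplus>x\<in>{x\<in>carrier G. ?r x = y}. \<ominus> c x)"
      using cc fin by (intro add.finprod_mono_neutral_cong_right) auto
    also have "\<dots> = \<ominus> (\<Oplus>x\<in>{x\<in>carrier G. ?r x = y}. c x)"
    proof -
      have "(\<Oplus>x\<in>A. \<ominus> c x) = \<ominus> (\<Oplus>x\<in>A. c x)" if "finite A" "A \<subseteq> carrier G" for A
        using that by (induction A rule: finite_induct) (auto simp: finsum_insert Pi_def cc subset_iff minus_add)
      then show ?thesis using fin by auto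
    qed
    finally have s: "?s y = c y \<oplus> \<ominus> (\<Oplus>x\<in>{x\<in>carrier G. ?r x = y}. c x)" .
    have tc: "(\<Oplus>x\<in>{x\<in>carrier G. ?r x = y}. c x) \<in> carrier R" using cc by (auto intro!: finsum_closed)
    have "(c \<ominus>\<^bsub>\<Lambda>\<^esub> ?s) y = c y \<ominus> (c y \<oplus> \<ominus> (\<Oplus>x\<in>{x\<in>carrier G. ?r x = y}. c x))"
      using y c sc by (simp add: gr_minus s)
    also have "\<dots> = (\<Oplus>x\<in>{x\<in>carrier G. ?r x = y}. c x)"
      using cc[OF y] tc by (simp add: minus_eq minus_add r_neg2 a_assoc[symmetric] r_neg)
    also have "\<dots> \<in> padic_ideal p R 1"
    proof (cases "?r y = y")
      case True
      then have "{x\<in>carrier G. ?r x = y} = conj_class G y"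
        using y G.conj_class_iff_rep[OF y] G.conj_class_subset[OF y] by auto
      then show ?thesis using cls[OF y] by simp
    next
      case False
      then have e: "{x\<in>carrier G. ?r x = y} = {}" using G.class_rep_idem by auto
      show ?thesis unfolding e using padic_idealI[of \<zero> p 1] by simp
    qed
    finally show ?thesis .
  qed
  then show ?thesis using c sc by (simp add: gr_padic_ideal del: One_nat_def)
qed

end

section \<open>Divisibility of class sums and triviality of the kernel\<close>

locale padic_group_ring = finite_group_ring + R: padic_complete_ring R p for p :: nat +
  assumes comm_R: "cring R" and prime_p: "Factorial_Ring.prime p"
    and torsion_free: "\<And>n r. 0 < n \<Longrightarrow> r \<in> carrier R \<Longrightarrow> [(n::nat)] \<cdot> r = \<zero> \<Longrightarrow> r = \<zero>"
begin

sublocale L: padic_complete_ring \<Lambda> p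
  by (rule padic_complete_group_ring) (rule R.padic_complete_ring_axioms)

lemma torsion_cancel:
  assumes "0 < n" "a \<in> carrier R" "b \<in> carrier R" "[(n::nat)] \<cdot> a = [n] \<cdot> b"
  shows "a = b"
proof -
  have "[n] \<cdot> (a \<ominus> b) = [n] \<cdot> a \<oplus> [n] \<cdot> (\<ominus> b)" using assms by (simp add: minus_eq add_pow_add)
  also have "\<dots> = \<zero>" using assms by (simp add: add_pow_minus r_neg)
  finally have "a \<ominus> b = \<zero>" using assms torsion_free[of n "a \<ominus> b"] by simp
  then show ?thesis using assms by simp
qed

text \<open>The factor \<open>m\<close> costs at most its \<open>p\<close>-adic valuation, which is smaller than \<open>j\<close>.\<close>

lemma divisible_by_p:
  assumes m: "0 < m" "m \<le> j" and t: "t \<in> carrier R" and z: "z \<in> carrier R" and eq: "[m] \<cdot> t = [(p ^ j)] \<cdot> z"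
  shows "t \<in> padic_ideal p R 1"
proof -
  define a where "a = multiplicity p m"
  have p1: "p > 1" using prime_p by (rule prime_gt_1_nat)
  obtain m' where m': "m = p ^ a * m'" "\<not> p dvd m'"
    using multiplicity_decompose'[of m p] m p1 prime_p unfolding a_def by (metis not_prime_unit not_gr_zero)
  have "a < j"
  proof -
    have "a < p ^ a" using p1 by (intro power_gt_expt) simp
    also have "p ^ a \<le> m" using m m' by (intro dvd_imp_le) auto
    finally show ?thesis using m by simp
  qed
  \<comment> \<open>The strict bound \<open>a < j\<close> splits p^j as p^a times p times the rest,
    so one factor p survives the cancellation of p^a.\<close>
  define z' where "z' = [(p ^ (j - a - 1))] \<cdot> z"
  have z': "z' \<in> carrier R" using z by (simp add: z'_def)
  have "[(p ^ a)] \<cdot> ([m'] \<cdot> t) = [(p ^ a)] \<cdot> ([p] \<cdot> z')"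
  proof -
    have "[(p ^ a)] \<cdot> ([m'] \<cdot> t) = [m] \<cdot> t" using t m' by (simp add: add_pow_pow)
    moreover have "[(p ^ a)] \<cdot> ([p] \<cdot> z') = [(p ^ j)] \<cdot> z"
    proof -
      have "p ^ a * (p * p ^ (j - a - 1)) = p ^ (a + Suc (j - a - 1))" by (simp add: power_add)
      also have "a + Suc (j - a - 1) = j" using \<open>a < j\<close> by simp
      finally show ?thesis using z by (simp add: z'_def add_pow_pow mult.assoc)
    qed
    ultimately show ?thesis using eq by simp
  qed
  then have m't: "[m'] \<cdot> t = [p] \<cdot> z'" using t z' p1 torsion_cancel[of "p ^ a"] by simp
  have "m' \<noteq> 0" using m m' by auto
  \<comment> \<open>Bezout for m' prime to p: t = m'xt - pyt, where m't is already a multiple of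
    p.\<close>
  then obtain x y where xy: "m' * x = p * y + gcd m' p" using bezout_nat by blast
  moreover have "gcd m' p = 1"
    using m'(2) prime_p by (metis coprime_commute coprime_imp_gcd_eq_1 prime_imp_coprime)
  ultimately have xy: "m' * x = p * y + 1" by simp
  have "[(m' * x)] \<cdot> t = [(p * y)] \<cdot> t \<oplus> t" unfolding xy using t by simp
  moreover have "[(m' * x)] \<cdot> t = [p] \<cdot> ([x] \<cdot> z')"
  proof -
    have "[(m' * x)] \<cdot> t = [x] \<cdot> ([m'] \<cdot> t)" using t by (simp add: add_pow_pow mult.commute)
    then show ?thesis unfolding m't using z' by (simp add: add_pow_pow mult.commute)
  qed
  moreover have "[(p * y)] \<cdot> t = [p] \<cdot> ([y] \<cdot> t)" using t by (simp add: add_pow_pow)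
  ultimately have e: "[p] \<cdot> ([y] \<cdot> t) \<oplus> t = [p] \<cdot> ([x] \<cdot> z')" by simp
  have "t = [p] \<cdot> ([x] \<cdot> z') \<ominus> [p] \<cdot> ([y] \<cdot> t)"
    unfolding e[symmetric] using t by (simp add: minus_eq a_ac r_neg1 r_neg2 r_neg)
  also have "\<dots> = [(p ^ 1)] \<cdot> ([x] \<cdot> z' \<ominus> [y] \<cdot> t)"
    using t z' by (simp add: minus_eq add_pow_add add_pow_minus)
  finally show ?thesis using padic_idealI[of "[x] \<cdot> z' \<ominus> [y] \<cdot> t" p 1] t z' by simp
qed

text \<open>The determinant argument shows that the sum of x over all conjugations of g is a
  multiple of p^j. It equals m times the class sum with m at most |G|; as j is at least |G|, a
  factor p remains for the class sum.\<close>

lemma class_sum_divisible: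
  assumes x: "x \<in> carrier \<Lambda>" and j: "card (carrier G) \<le> j"
    and approx: "\<And>n. n \<ge> 1 \<Longrightarrow> \<exists>y\<in>L.P n. K1_class \<Lambda> (diag_at \<Lambda> 0 (\<one>\<^bsub>\<Lambda>\<^esub> \<oplus>\<^bsub>\<Lambda>\<^esub> [(p ^ j)] \<cdot>\<^bsub>\<Lambda>\<^esub> x)) =
      K1_class \<Lambda> (diag_at \<Lambda> 0 (\<one>\<^bsub>\<Lambda>\<^esub> \<oplus>\<^bsub>\<Lambda>\<^esub> y))"
    and g: "g \<in> carrier G"
  shows "(\<Oplus>h\<in>conj_class G g. x h) \<in> padic_ideal p R 1"
proof -
  have j1: "j \<ge> 1"
    using j fin G.one_closed by (metis One_nat_def Suc_leI card_gt_0_iff empty_iff le_trans)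
  \<comment> \<open>A cyclic subgroup is commutative, so its group ring has determinants, and it
    contains g, so the trace has a coefficient there.\<close>
  define C where "C = generate G {g}"
  have C: "subgroup C G" unfolding C_def using g by (intro G.generate_is_subgroup) auto
  have gC: "g \<in> C" unfolding C_def by (rule generate.incl) simp
  have comm: "a \<otimes>\<^bsub>G\<^esub> b = b \<otimes>\<^bsub>G\<^esub> a" if ab: "a \<in> C" "b \<in> C" for a b
  proof -
    obtain i k :: int where "a = g [^]\<^bsub>G\<^esub> i" "b = g [^]\<^bsub>G\<^esub> k"
      using ab unfolding C_def G.generate_pow[OF g] by auto
    then show ?thesis using g by (simp add: G.int_pow_mult[symmetric] add.commute)
  qed
  obtain e :: "nat \<Rightarrow> 'c" and d where ed: "\<forall>s<d. e s \<in> carrier G"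
    "bij_betw (\<lambda>p. e (fst p) \<otimes>\<^bsub>G\<^esub> snd p) ({..<d} \<times> C) (carrier G)"
    using G.coset_representatives_exist[OF fin C] by (elim exE conjE) (rule that)
  have rep: "coset_representation R G C e d"
  proof (intro coset_representation.intro coset_representation_axioms.intro)
    show "finite_group_ring R G" by (rule finite_group_ring_axioms)
    show "\<And>a b. a \<in> C \<Longrightarrow> b \<in> C \<Longrightarrow> a \<otimes>\<^bsub>G\<^esub> b = b \<otimes>\<^bsub>G\<^esub> a" by (rule comm)
    show "\<And>s. s < d \<Longrightarrow> e s \<in> carrier G" using ed(1) by simp
  qed (fact comm_R C ed(2))+
  \<comment> \<open>The level 2j matches the second-order error of the determinant of 1 + p^j
    x.\<close>
  have "2 * j \<ge> 1" using j1 by simp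
  then obtain y where y: "y \<in> L.P (2 * j)"
    "K1_class \<Lambda> (diag_at \<Lambda> 0 (\<one>\<^bsub>\<Lambda>\<^esub> \<oplus>\<^bsub>\<Lambda>\<^esub> [(p ^ j)] \<cdot>\<^bsub>\<Lambda>\<^esub> x)) = K1_class \<Lambda> (diag_at \<Lambda> 0 (\<one>\<^bsub>\<Lambda>\<^esub> \<oplus>\<^bsub>\<Lambda>\<^esub> y))"
    using approx by blast
  obtain w where w: "w \<in> carrier \<Lambda>" "y = [(p ^ (2 * j))] \<cdot>\<^bsub>\<Lambda>\<^esub> w" using y(1) by (rule \<Lambda>.padic_idealE)
  have pp: "p ^ (2 * j) = p ^ j * p ^ j" by (simp add: mult_2 power_add)
  have p0: "0 < p ^ j" using prime_gt_0_nat[OF prime_p] by simp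
  obtain z where z: "z \<in> carrier R" "(\<Oplus>h\<in>carrier G. x (h \<otimes>\<^bsub>G\<^esub> g \<otimes>\<^bsub>G\<^esub> inv\<^bsub>G\<^esub> h)) = [(p ^ j)] \<cdot> z"
    using coset_representation.conj_sum_divisible[OF rep x w(1) gC, of "p ^ j"] y(2) torsion_free[OF p0]
      L.one_plus_unit[OF \<Lambda>.padic_idealI[OF x, of p j] j1] L.one_plus_unit[OF y(1) \<open>2 * j \<ge> 1\<close>]
    unfolding w(2) pp by blast
  obtain m where m: "0 < m" "m \<le> card (carrier G)"
    "(\<Oplus>h\<in>carrier G. x (h \<otimes>\<^bsub>G\<^esub> g \<otimes>\<^bsub>G\<^esub> inv\<^bsub>G\<^esub> h)) = [m] \<cdot> (\<Oplus>h\<in>conj_class G g. x h)"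
    using conj_sum_class_sum[of x g] x g by auto
  show ?thesis
  proof (rule divisible_by_p[of m j _ z])
    show "(\<Oplus>h\<in>conj_class G g. x h) \<in> carrier R"
      using x G.conj_class_subset[OF g] by (intro finsum_closed) auto
    show "[m] \<cdot> (\<Oplus>h\<in>conj_class G g. x h) = [(p ^ j)] \<cdot> z" using m(3) z(2) by simp
  qed (use m j z in auto)
qed

text \<open>For x' = h x h^-1 the monomials a = r x h^-1 and b = h have ab = rx and ba = rx', so 1 +
  ab and 1 + ba have the same class.\<close>

lemma K1_class_conjugate:
  assumes r: "r \<in> padic_ideal p R 1" and x: "x \<in> carrier G"
  shows "K1_class \<Lambda> (diag_at \<Lambda> 0 (\<one>\<^bsub>\<Lambda>\<^esub> \<oplus>\<^bsub>\<Lambda>\<^esub> gmon R G r x)) =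
    K1_class \<Lambda> (diag_at \<Lambda> 0 (\<one>\<^bsub>\<Lambda>\<^esub> \<oplus>\<^bsub>\<Lambda>\<^esub> gmon R G r (class_rep G x)))"
proof -
  obtain h where h: "h \<in> carrier G" "class_rep G x = h \<otimes>\<^bsub>G\<^esub> x \<otimes>\<^bsub>G\<^esub> inv\<^bsub>G\<^esub> h"
    using G.class_rep_in[OF x] by (auto simp: conj_class_def)
  have rc: "r \<in> carrier R" using r by (rule padic_ideal_carrier)
  let ?a = "gmon R G r (x \<otimes>\<^bsub>G\<^esub> inv\<^bsub>G\<^esub> h)" and ?b = "gmon R G \<one> h"
  have ab: "?a \<otimes>\<^bsub>\<Lambda>\<^esub> ?b = gmon R G r x" "?b \<otimes>\<^bsub>\<Lambda>\<^esub> ?a = gmon R G r (class_rep G x)"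
    using rc h x by (simp_all add: gmon_mult_gmon G.m_assoc)
  have "\<one>\<^bsub>\<Lambda>\<^esub> \<oplus>\<^bsub>\<Lambda>\<^esub> ?b \<otimes>\<^bsub>\<Lambda>\<^esub> ?a \<in> Units \<Lambda>"
    unfolding ab by (rule L.units_one_plus) (rule gmon_padic[OF r])
  then show ?thesis using \<Lambda>.K1_class_swap[of ?a ?b 0] rc unfolding ab by simp
qed

lemma K1_class_trivial:
  assumes x: "x \<in> L.P (card (carrier G))"
    and approx: "\<And>n. n \<ge> 1 \<Longrightarrow> \<exists>y\<in>L.P n. K1_class \<Lambda> (diag_at \<Lambda> 0 (\<one>\<^bsub>\<Lambda>\<^esub> \<oplus>\<^bsub>\<Lambda>\<^esub> x)) =
      K1_class \<Lambda> (diag_at \<Lambda> 0 (\<one>\<^bsub>\<Lambda>\<^esub> \<oplus>\<^bsub>\<Lambda>\<^esub> y))"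
  shows "K1_class \<Lambda> (diag_at \<Lambda> 0 (\<one>\<^bsub>\<Lambda>\<^esub> \<oplus>\<^bsub>\<Lambda>\<^esub> x)) = \<one>\<^bsub>K1 \<Lambda>\<^esub>"
proof -
  interpret K: group "K1 \<Lambda>" by (rule \<Lambda>.group_K1)
  define k where "k = card (carrier G)"
  have k1: "k \<ge> 1"
    unfolding k_def using fin G.one_closed by (metis One_nat_def Suc_leI card_gt_0_iff empty_iff)
  obtain gs where gs: "set gs = carrier G" "distinct gs" using finite_distinct_list[OF fin] by blast
  \<comment> \<open>The order of the factors is fixed by \<open>gs\<close> and only the coefficients
    \<open>r\<close> vary. Every admissible value has trivial class, so it remains to solve u =
    \<open>\<Phi> s\<close>.\<close>
  define \<Phi> where "\<Phi> = (\<lambda>r. L.quot_prod (\<lambda>i. gmon R G (r i) i) (\<lambda>i. gmon R G (r i) (class_rep G i)) gs)"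
  define u where "u = \<one>\<^bsub>\<Lambda>\<^esub> \<oplus>\<^bsub>\<Lambda>\<^esub> x"
  have xk: "x \<in> L.P k" using x by (simp add: k_def)
  have xc: "x \<in> carrier \<Lambda>" using x by (rule \<Lambda>.padic_ideal_carrier)
  have uU: "u \<in> Units \<Lambda>" unfolding u_def using xk k1 by (rule L.one_plus_unit)
  have uc: "u \<in> carrier \<Lambda>" using uU by blast
  define adm where "adm = (\<lambda>r. \<forall>i\<in>carrier G. r i \<in> padic_ideal p R k)"
  have Pk: "padic_ideal p R k \<subseteq> padic_ideal p R 1" using k1 by (rule padic_ideal_mono)
  have adm1: "gmon R G (r i) i \<in> L.P 1 \<and> gmon R G (r i) (class_rep G i) \<in> L.P 1"
    if "adm r" "i \<in> set gs" for r i
  proof -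
    have "r i \<in> padic_ideal p R 1" using that Pk by (auto simp: adm_def gs)
    then show ?thesis by (simp add: gmon_padic del: One_nat_def)
  qed
  have \<Phi>U: "\<Phi> r \<in> Units \<Lambda>" if "adm r" for r
    unfolding \<Phi>_def using adm1[OF that] by (rule L.quot_prod_unit)
  have \<Phi>K: "K1_class \<Lambda> (diag_at \<Lambda> 0 (\<Phi> r)) = \<one>\<^bsub>K1 \<Lambda>\<^esub>" if "adm r" for r
    unfolding \<Phi>_def
  proof (rule L.K1_class_quot_prod)
    fix i assume i: "i \<in> set gs"
    have "r i \<in> padic_ideal p R 1" using that i Pk by (auto simp: adm_def gs)
    then have "K1_class \<Lambda> (diag_at \<Lambda> 0 (\<one>\<^bsub>\<Lambda>\<^esub> \<oplus>\<^bsub>\<Lambda>\<^esub> gmon R G (r i) i)) =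
      K1_class \<Lambda> (diag_at \<Lambda> 0 (\<one>\<^bsub>\<Lambda>\<^esub> \<oplus>\<^bsub>\<Lambda>\<^esub> gmon R G (r i) (class_rep G i)))"
      using i gs by (intro K1_class_conjugate) auto
    then show "gmon R G (r i) i \<in> L.P 1 \<and> gmon R G (r i) (class_rep G i) \<in> L.P 1 \<and>
      K1_class \<Lambda> (diag_at \<Lambda> 0 (\<one>\<^bsub>\<Lambda>\<^esub> \<oplus>\<^bsub>\<Lambda>\<^esub> gmon R G (r i) i)) =
      K1_class \<Lambda> (diag_at \<Lambda> 0 (\<one>\<^bsub>\<Lambda>\<^esub> \<oplus>\<^bsub>\<Lambda>\<^esub> gmon R G (r i) (class_rep G i)))"
      using adm1[OF that i] by simp
  qed
  \<comment> \<open>Starting the exponents at k keeps each k + m at least |G|, as the divisibility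
    of class sums demands.\<close>
  define Inv where "Inv = (\<lambda>m r. adm r \<and> L.proj (k + m) u = L.proj (k + m) (\<Phi> r))"
  have step: "\<exists>r'. Inv (Suc m) r' \<and> (\<forall>i\<in>carrier G. r' i \<ominus> r i \<in> padic_ideal p R m)"
    if inv: "Inv m r" for m r
  proof -
    define j where "j = k + m"
    have j: "j \<ge> 1" "card (carrier G) \<le> j" using k1 by (auto simp: j_def k_def)
    interpret hj: ring_hom_ring \<Lambda> "L.Q j" "L.proj j" by (rule L.proj_hom)
    interpret hs: ring_hom_ring \<Lambda> "L.Q (Suc j)" "L.proj (Suc j)" by (rule L.proj_hom)
    have r: "adm r" and eq: "L.proj j u = L.proj j (\<Phi> r)" using inv by (auto simp: Inv_def j_def)
    have FU: "\<Phi> r \<in> Units \<Lambda>" using r by (rule \<Phi>U)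
    then have Fc: "\<Phi> r \<in> carrier \<Lambda>" "inv\<^bsub>\<Lambda>\<^esub> \<Phi> r \<in> carrier \<Lambda>" by auto
    \<comment> \<open>The multiplicative defect has the same class as u, since
      \<open>\<Phi> r\<close> is trivial in \<open>K1\<close>; so \<open>approx\<close> applies to
      it as well.\<close>
    define v where "v = u \<otimes>\<^bsub>\<Lambda>\<^esub> inv\<^bsub>\<Lambda>\<^esub> \<Phi> r"
    have vU: "v \<in> Units \<Lambda>" using uU FU by (simp add: v_def)
    have vc: "v \<in> carrier \<Lambda>" using vU by blast
    have vF: "v \<otimes>\<^bsub>\<Lambda>\<^esub> \<Phi> r = u" unfolding v_def using uc Fc FU by (simp add: \<Lambda>.m_assoc)
    have "L.proj j v = L.proj j (\<Phi> r \<otimes>\<^bsub>\<Lambda>\<^esub> inv\<^bsub>\<Lambda>\<^esub> \<Phi> r)"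
      unfolding v_def using eq uc Fc by (subst (1 2) hj.hom_mult) auto
    then have "L.proj j v = L.proj j \<one>\<^bsub>\<Lambda>\<^esub>" using FU by simp
    then have "v \<ominus>\<^bsub>\<Lambda>\<^esub> \<one>\<^bsub>\<Lambda>\<^esub> \<in> L.P j" using vc by (simp add: \<Lambda>.padic_proj_eq_iff del: hj.hom_one)
    then obtain c where c: "c \<in> carrier \<Lambda>" "v \<ominus>\<^bsub>\<Lambda>\<^esub> \<one>\<^bsub>\<Lambda>\<^esub> = [(p ^ j)] \<cdot>\<^bsub>\<Lambda>\<^esub> c" by (rule \<Lambda>.padic_idealE)
    have v: "v = \<one>\<^bsub>\<Lambda>\<^esub> \<oplus>\<^bsub>\<Lambda>\<^esub> [(p ^ j)] \<cdot>\<^bsub>\<Lambda>\<^esub> c"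
      unfolding c(2)[symmetric] using vc \<Lambda>.a_lcomm[of "\<one>\<^bsub>\<Lambda>\<^esub>" v "\<ominus>\<^bsub>\<Lambda>\<^esub> \<one>\<^bsub>\<Lambda>\<^esub>"]
      by (simp add: \<Lambda>.minus_eq \<Lambda>.r_neg)
    have Kv: "K1_class \<Lambda> (diag_at \<Lambda> 0 v) = K1_class \<Lambda> (diag_at \<Lambda> 0 u)"
    proof -
      have "K1_class \<Lambda> (diag_at \<Lambda> 0 u) = K1_class \<Lambda> (mat_mult \<Lambda> (diag_at \<Lambda> 0 v) (diag_at \<Lambda> 0 (\<Phi> r)))"
        using vc Fc by (simp add: \<Lambda>.diag_at_mult_diag vF)
      also have "\<dots> = K1_class \<Lambda> (diag_at \<Lambda> 0 v) \<otimes>\<^bsub>K1 \<Lambda>\<^esub> \<one>\<^bsub>K1 \<Lambda>\<^esub>"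
        using vU FU by (simp add: \<Lambda>.K1_class_mult \<Lambda>.diag_at_GL \<Phi>K[OF r])
      finally show ?thesis using vU \<Lambda>.diag_at_GL by simp
    qed
    have cls: "(\<Oplus>h\<in>conj_class G g. c h) \<in> padic_ideal p R 1" if g: "g \<in> carrier G" for g
    proof (rule class_sum_divisible[OF c(1) j(2) _ g])
      fix n :: nat assume "n \<ge> 1"
      then show "\<exists>y\<in>L.P n. K1_class \<Lambda> (diag_at \<Lambda> 0 (\<one>\<^bsub>\<Lambda>\<^esub> \<oplus>\<^bsub>\<Lambda>\<^esub> [(p ^ j)] \<cdot>\<^bsub>\<Lambda>\<^esub> c)) =
        K1_class \<Lambda> (diag_at \<Lambda> 0 (\<one>\<^bsub>\<Lambda>\<^esub> \<oplus>\<^bsub>\<Lambda>\<^esub> y))"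
        using approx[of n] Kv unfolding v u_def by simp
    qed
    \<comment> \<open>The coefficient of the defect at i becomes the increment of
      \<open>r i\<close>. To first order it changes the quotient for i by p^j times c_i (i - i'),
      and these changes add up to p^j \<open>D\<close>.\<close>
    define r' where "r' = (\<lambda>i. r i \<oplus> [(p ^ j)] \<cdot> c i)"
    define D where "D = (\<Oplus>\<^bsub>\<Lambda>\<^esub>i\<in>carrier G. gmon R G (c i) i \<ominus>\<^bsub>\<Lambda>\<^esub> gmon R G (c i) (class_rep G i))"
    have cc: "c i \<in> carrier R" if "i \<in> carrier G" for i using c(1) that by simp
    have rc: "r i \<in> carrier R" if "i \<in> carrier G" for i
      using r that padic_ideal_carrier by (auto simp: adm_def)
    have Dc: "D \<in> carrier \<Lambda>" unfolding D_def using cc by (auto intro!: \<Lambda>.finsum_closed)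
    have pc: "[(p ^ j)] \<cdot> c i \<in> padic_ideal p R j" if "i \<in> carrier G" for i
      using cc[OF that] by (rule padic_idealI)
    have adm': "adm r'"
      unfolding adm_def r'_def
    proof
      fix i assume i: "i \<in> carrier G"
      interpret I: ideal "padic_ideal p R k" R by (rule padic_ideal_ideal)
      have "padic_ideal p R j \<subseteq> padic_ideal p R k" by (rule padic_ideal_mono) (simp add: j_def)
      then show "r i \<oplus> [(p ^ j)] \<cdot> c i \<in> padic_ideal p R k"
        using pc[OF i] r i by (intro I.a_closed) (auto simp: adm_def)
    qed
    have "L.proj (Suc j) (\<Phi> r') = L.proj (Suc j) (\<Phi> r \<oplus>\<^bsub>\<Lambda>\<^esub> [(p ^ j)] \<cdot>\<^bsub>\<Lambda>\<^esub> D)"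
    proof -
      let ?dY = "\<lambda>i. [(p ^ j)] \<cdot>\<^bsub>\<Lambda>\<^esub> gmon R G (c i) i" and ?dZ = "\<lambda>i. [(p ^ j)] \<cdot>\<^bsub>\<Lambda>\<^esub> gmon R G (c i) (class_rep G i)"
      have "L.proj (Suc j) (\<Phi> r') = L.proj (Suc j) (L.quot_prod (\<lambda>i. gmon R G (r i) i \<oplus>\<^bsub>\<Lambda>\<^esub> ?dY i)
        (\<lambda>i. gmon R G (r i) (class_rep G i) \<oplus>\<^bsub>\<Lambda>\<^esub> ?dZ i) gs)"
      proof -
        have "\<Phi> r' = L.quot_prod (\<lambda>i. gmon R G (r i) i \<oplus>\<^bsub>\<Lambda>\<^esub> ?dY i)
            (\<lambda>i. gmon R G (r i) (class_rep G i) \<oplus>\<^bsub>\<Lambda>\<^esub> ?dZ i) gs"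
          unfolding \<Phi>_def by (rule L.quot_prod_eqI) (simp_all add: r'_def gs gmon_add_pow rc cc)
        then show ?thesis by (rule arg_cong)
      qed
      also have "\<dots> = L.proj (Suc j) (\<Phi> r \<oplus>\<^bsub>\<Lambda>\<^esub> (\<Oplus>\<^bsub>\<Lambda>\<^esub>i\<in>set gs. ?dY i \<ominus>\<^bsub>\<Lambda>\<^esub> ?dZ i))"
        unfolding \<Phi>_def using adm1[OF r] cc
        by (intro L.quot_prod_step gs j(1)) (auto simp: gs intro!: \<Lambda>.padic_idealI)
      also have "(\<Oplus>\<^bsub>\<Lambda>\<^esub>i\<in>set gs. ?dY i \<ominus>\<^bsub>\<Lambda>\<^esub> ?dZ i) = (\<Oplus>\<^bsub>\<Lambda>\<^esub>i\<in>carrier G. [(p ^ j)] \<cdot>\<^bsub>\<Lambda>\<^esub> (gmon R G (c i) i \<ominus>\<^bsub>\<Lambda>\<^esub> gmon R G (c i) (class_rep G i)))"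
        unfolding gs using cc by (intro \<Lambda>.finsum_cong') (auto simp: \<Lambda>.minus_eq \<Lambda>.add_pow_add \<Lambda>.add_pow_minus)
      also have "\<dots> = [(p ^ j)] \<cdot>\<^bsub>\<Lambda>\<^esub> D"
        unfolding D_def by (rule \<Lambda>.add_pow_finsum[symmetric]) (use fin cc in auto)
      finally show ?thesis .
    qed
    also have "\<dots> = L.proj (Suc j) (\<Phi> r \<oplus>\<^bsub>\<Lambda>\<^esub> [(p ^ j)] \<cdot>\<^bsub>\<Lambda>\<^esub> c)"
    proof -
      have "c \<ominus>\<^bsub>\<Lambda>\<^esub> D \<in> L.P 1" unfolding D_def by (rule commutator_expansion[OF c(1) cls])
      then obtain w where w: "w \<in> carrier \<Lambda>" "c \<ominus>\<^bsub>\<Lambda>\<^esub> D = [(p ^ 1)] \<cdot>\<^bsub>\<Lambda>\<^esub> w" by (rule \<Lambda>.padic_idealE)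
      have "[(p ^ j)] \<cdot>\<^bsub>\<Lambda>\<^esub> c \<ominus>\<^bsub>\<Lambda>\<^esub> [(p ^ j)] \<cdot>\<^bsub>\<Lambda>\<^esub> D = [(p ^ j)] \<cdot>\<^bsub>\<Lambda>\<^esub> (c \<ominus>\<^bsub>\<Lambda>\<^esub> D)"
        using c Dc by (simp add: \<Lambda>.minus_eq \<Lambda>.add_pow_add \<Lambda>.add_pow_minus)
      also have "\<dots> = [(p ^ Suc j)] \<cdot>\<^bsub>\<Lambda>\<^esub> w" unfolding w(2) using w(1) by (simp add: \<Lambda>.add_pow_pow mult.commute)
      also have "\<dots> \<in> L.P (Suc j)" using w(1) by (rule \<Lambda>.padic_idealI)
      finally have "L.proj (Suc j) ([(p ^ j)] \<cdot>\<^bsub>\<Lambda>\<^esub> c) = L.proj (Suc j) ([(p ^ j)] \<cdot>\<^bsub>\<Lambda>\<^esub> D)"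
        using c Dc by (simp add: \<Lambda>.padic_proj_eq_iff)
      then show ?thesis using Fc c Dc by (simp add: hs.hom_add)
    qed
    \<comment> \<open>As \<open>\<Phi> r\<close> is 1 modulo p, it is absorbed at this precision;
      this turns the additive correction into the multiplicative one v \<open>\<Phi> r\<close> =
      u.\<close>
    also have "\<dots> = L.proj (Suc j) (\<Phi> r \<oplus>\<^bsub>\<Lambda>\<^esub> [(p ^ j)] \<cdot>\<^bsub>\<Lambda>\<^esub> c \<otimes>\<^bsub>\<Lambda>\<^esub> \<Phi> r)"
    proof -
      have "L.proj 1 (\<Phi> r) = L.proj 1 \<one>\<^bsub>\<Lambda>\<^esub>"
        unfolding \<Phi>_def using adm1[OF r] by (rule L.quot_prod_one)
      then have "L.proj (Suc j) ([(p ^ j)] \<cdot>\<^bsub>\<Lambda>\<^esub> c \<otimes>\<^bsub>\<Lambda>\<^esub> \<Phi> r) = L.proj (Suc j) ([(p ^ j)] \<cdot>\<^bsub>\<Lambda>\<^esub> c)"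
        by (rule L.absorb(1)[OF \<Lambda>.padic_idealI[OF c(1)] Fc(1)])
      then show ?thesis using Fc c by (simp add: hs.hom_add del: hs.hom_mult)
    qed
    also have "\<Phi> r \<oplus>\<^bsub>\<Lambda>\<^esub> [(p ^ j)] \<cdot>\<^bsub>\<Lambda>\<^esub> c \<otimes>\<^bsub>\<Lambda>\<^esub> \<Phi> r = u"
      unfolding vF[symmetric] v using Fc c by (simp add: \<Lambda>.l_distr)
    finally have "Inv (Suc m) r'" using adm' by (simp add: Inv_def j_def)
    \<comment> \<open>The increment is even divisible by p^(k+m); the exponent m is the form that
      \<open>cauchy\<close> takes.\<close>
    moreover have "r' i \<ominus> r i \<in> padic_ideal p R m" if i: "i \<in> carrier G" for i
    proof -
      have "r' i \<ominus> r i = [(p ^ j)] \<cdot> c i"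
        unfolding r'_def using rc[OF i] cc[OF i] by (simp add: minus_eq a_ac r_neg2 r_neg1 r_neg)
      moreover have "padic_ideal p R j \<subseteq> padic_ideal p R m" by (rule padic_ideal_mono) (simp add: j_def)
      ultimately show ?thesis using pc[OF i] by auto
    qed
    ultimately show ?thesis by blast
  qed
  \<comment> \<open>With zero coefficients the product is 1, and u is 1 modulo p^k.\<close>
  have "Inv 0 (\<lambda>_. \<zero>)"
  proof -
    have z: "gmon R G \<zero> g = \<zero>\<^bsub>\<Lambda>\<^esub>" for g by (rule gr_eqI) (auto simp: gmon_apply gr_zero)
    have "L.quot_prod (\<lambda>i. \<zero>\<^bsub>\<Lambda>\<^esub>) (\<lambda>i. \<zero>\<^bsub>\<Lambda>\<^esub>) ls = \<one>\<^bsub>\<Lambda>\<^esub>" for ls :: "'c list" by (induction ls) auto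
    then have "\<Phi> (\<lambda>_. \<zero>) = \<one>\<^bsub>\<Lambda>\<^esub>" unfolding \<Phi>_def z .
    moreover have "\<zero> \<in> padic_ideal p R k" using padic_idealI[of \<zero> p k] by simp
    ultimately show ?thesis using L.proj_one_plus[OF xk] by (simp add: Inv_def adm_def u_def)
  qed
  then obtain r where r: "\<And>m. Inv m (r m)" "\<And>m i. i \<in> carrier G \<Longrightarrow> r (Suc m) i \<ominus> r m i \<in> padic_ideal p R m"
    using dependent_nat_choice[of Inv "\<lambda>m r r'. \<forall>i\<in>carrier G. r' i \<ominus> r i \<in> padic_ideal p R m"] step by metis
  have rad: "adm (r m)" for m using r(1)[of m] by (simp add: Inv_def)
  have rc: "r m i \<in> carrier R" if "i \<in> carrier G" for m i
    using rad[of m] that padic_ideal_carrier by (auto simp: adm_def)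
  have "\<exists>s\<in>carrier R. \<forall>m. s \<ominus> r m i \<in> padic_ideal p R m" if i: "i \<in> carrier G" for i
    using rc[OF i] r(2)[OF i] by (intro R.cauchy)
  then obtain s where s: "\<And>i. i \<in> carrier G \<Longrightarrow> s i \<in> carrier R"
    "\<And>i m. i \<in> carrier G \<Longrightarrow> s i \<ominus> r m i \<in> padic_ideal p R m" by metis
  have sad: "adm s" unfolding adm_def
  proof
    fix i assume i: "i \<in> carrier G"
    interpret I: ideal "padic_ideal p R k" R by (rule padic_ideal_ideal)
    have "(s i \<ominus> r k i) \<oplus> r k i \<in> padic_ideal p R k"
      using s(2)[OF i, of k] rad[of k] i by (intro I.a_closed) (auto simp: adm_def)
    also have "(s i \<ominus> r k i) \<oplus> r k i = s i" using s(1)[OF i] rc[OF i] by (simp add: minus_eq a_assoc l_neg)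
    finally show "s i \<in> padic_ideal p R k" .
  qed
  \<comment> \<open>The number of factors is fixed, so congruent coefficients give congruent
    products; both sides agree modulo every p^m and separatedness concludes.\<close>
  have "u = \<Phi> s"
  proof (rule L.proj_eqI)
    show "\<Phi> s \<in> carrier \<Lambda>" using \<Phi>U[OF sad] by blast
    fix m
    have Fc: "\<Phi> (r m) \<in> carrier \<Lambda>" by (rule \<Lambda>.Units_closed[OF \<Phi>U[OF rad]])
    have "L.proj (k + m) u = L.proj (k + m) (\<Phi> (r m))" using r(1)[of m] by (simp add: Inv_def)
    then have "L.proj m u = L.proj m (\<Phi> (r m))"
      by (rule \<Lambda>.padic_proj_mono[OF uc Fc]) simp
    also have "\<dots> = L.proj m (\<Phi> s)"
      unfolding \<Phi>_def
    proof (rule L.quot_prod_cong)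
      fix i assume i: "i \<in> set gs"
      show "gmon R G (r m i) i \<in> L.P 1 \<and> gmon R G (r m i) (class_rep G i) \<in> L.P 1 \<and>
        gmon R G (s i) i \<in> L.P 1 \<and> gmon R G (s i) (class_rep G i) \<in> L.P 1"
        using adm1[OF rad i] adm1[OF sad i] by blast
      have iG: "i \<in> carrier G" using i gs by simp
      have "L.proj m (gmon R G (s i) g) = L.proj m (gmon R G (r m i) g)" for g
      proof -
        have "gmon R G (s i) g \<ominus>\<^bsub>\<Lambda>\<^esub> gmon R G (r m i) g = gmon R G (s i \<ominus> r m i) g"
          using s(1)[OF iG] rc[OF iG] by (intro gr_eqI) (auto simp: gr_minus gmon_apply minus_eq)
        then have "gmon R G (s i) g \<ominus>\<^bsub>\<Lambda>\<^esub> gmon R G (r m i) g \<in> L.P m"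
          using gmon_padic[OF s(2)[OF iG]] by simp
        then show ?thesis using s(1)[OF iG] rc[OF iG] by (simp add: \<Lambda>.padic_proj_eq_iff)
      qed
      then show "L.proj m (gmon R G (r m i) i) = L.proj m (gmon R G (s i) i) \<and>
        L.proj m (gmon R G (r m i) (class_rep G i)) = L.proj m (gmon R G (s i) (class_rep G i))" by simp
    qed
    finally show "L.proj m u = L.proj m (\<Phi> s)" .
  qed (rule uc)
  then show ?thesis using \<Phi>K[OF sad] by (simp add: u_def)
qed

theorem completion_map_iso_group_ring:
  "K1_completion_map p \<Lambda> \<in> iso (K1 \<Lambda>) (completed_K1 p \<Lambda>)"
proof (rule L.completion_map_iso)
  show "card (carrier G) \<ge> 1"
    using fin G.one_closed by (metis One_nat_def Suc_leI card_gt_0_iff empty_iff)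
qed (rule K1_class_trivial)

end

theorem theorem1p2:
  fixes p :: nat
    and R :: "('a, 'm) ring_scheme"
    and G :: "('g, 'k) monoid_scheme"
  assumes "Factorial_Ring.prime p"
    and "noetherian_domain R"
    and "padically_complete p R"
    and "krull_dim R < \<infinity>"
    and "char_zero (fraction_field R)"
    and "group G"
    and "finite (carrier G)"
  shows "K1_completion_map p (group_ring R G)
    \<in> iso (K1 (group_ring R G)) (completed_K1 p (group_ring R G))"
proof -
  interpret domain R using assms(2) by (simp add: noetherian_domain_def)
  interpret G: group G by fact
  have "padic_complete_ring R p" using ring_axioms assms(3) by (rule padically_completeD)
  then interpret padic_complete_ring R p .
  interpret padic_group_ring R G p
  proof unfold_locales
    fix n :: nat and r assume n: "0 < n" and r: "r \<in> carrier R" "[n] \<cdot>\<^bsub>R\<^esub> r = \<zero>\<^bsub>R\<^esub>"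
    \<comment> \<open>The multiple n r is the product of n 1 and r; the first factor is nonzero by
      characteristic zero, so r vanishes in the domain.\<close>
    then have "[n] \<cdot>\<^bsub>R\<^esub> \<one>\<^bsub>R\<^esub> \<otimes>\<^bsub>R\<^esub> r = \<zero>\<^bsub>R\<^esub>" by (simp add: add_pow_one)
    then show "r = \<zero>\<^bsub>R\<^esub>"
      using char_zero_fraction_field[OF assms(5) n] r(1) integral by blast
  qed (use assms is_cring in auto)
  show ?thesis by (rule completion_map_iso_group_ring)
qed


end
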